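(* Let $n\ge 1$, let $0<s<1$, and let $\Omega\subset\mathbb R^n$ be a bounded domain with Lipschitz boundary. Then for every $u\in\widetilde H^s(\Omega)$ $$((-\Delta_\Omega)^s_Nu,u)\ \ge\ ((-\Delta_\Omega)^s_Du,u),$$ that is, $Q_s^N[u]\ge Q_s^D[u]$. If $u\not\equiv0$, then the inequality is strict.
   Context: Fourier transform: $\mathcal F u(\xi)=(2\pi)^{-n/2}\int_{\mathbb R^n}e^{-i\xi\cdot x}u(x)\,dx$. $H^s(\mathbb R^n)$ is the completion of $\mathcal C_0^\infty(\mathbb R^n)$ with respect to the norm $\|u\|_s^2=\int_{\mathbb R^n}(1+|\xi|^2)^s|\mathcal F u(\xi)|^2\,d\xi$, and $\widetilde H^s(\Omega)=\{u\in H^s(\mathbb R^n):\ \mathrm{supp}\,u\subset\overline\Omega\}$. Functions in $L_2(\Omega)$ are identified with their extensions by zero to $\mathbb R^n$. Let $\lambda_j$ and $\varphi_j$ ($j\in\mathbb N$) be the eigenvalues and the corresponding $L_2(\Omega)$-orthonormal eigenfunctions of the Dirichlet Laplacian $-\Delta$ in $\Omega$, and let $(\cdot,\cdot)$ be the scalar product in $L_2(\Omega)$. The "Navier" fractional Laplacian $(-\Delta_\Omega)^s_N$ and the "Dirichlet" fractional Laplacian $(-\Delta_\Omega)^s_D$ are defined by the quadratic forms $$Q_s^N[u]=((-\Delta_\Omega)^s_Nu,u):=\sum_j\lambda_j^s|(u,\varphi_j)|^2,\qquad Q_s^D[u]=((-\Delta_\Omega)^s_Du,u):=\int_{\mathbb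 R^n}|\xi|^{2s}|\mathcal F u(\xi)|^2\,d\xi,$$ both with domain $\widetilde H^s(\Omega)$. *)

theory Defs
  imports "HOL-Analysis.Analysis"
begin

text \<open>
  The Euclidean space \<open>\<real>\<^sup>n\<close> is a type of class \<^class>\<open>euclidean_space\<close>, with
  \<open>n = DIM('a)\<close>; so \<open>n \<ge> 1\<close> is automatic. Functions are complex valued, which covers the real
  valued case. Elements of \<open>L\<^sub>2\<close> and of the Sobolev spaces are represented by Borel functions on
  the whole space; all notions below are invariant under changes on null sets. Nonnegative
  quantities that may be infinite a priori take values in \<^typ>\<open>ennreal\<close>.
\<close>

section \<open>Test functions\<close>

abbreviation pderiv_dir :: "'a::euclidean_space \<Rightarrow> ('a \<Rightarrow> complex) \<Rightarrow> 'a \<Rightarrow> complex" where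
  "pderiv_dir b f x \<equiv> frechet_derivative f (at x) b"

primrec C_class :: "nat \<Rightarrow> ('a::euclidean_space \<Rightarrow> complex) \<Rightarrow> bool" where
  "C_class 0 f \<longleftrightarrow> continuous_on UNIV f"
| "C_class (Suc k) f \<longleftrightarrow>
     (\<forall>x. f differentiable (at x)) \<and> (\<forall>b\<in>Basis. C_class k (pderiv_dir b f))"

definition test_functions :: "'a::euclidean_space set \<Rightarrow> ('a \<Rightarrow> complex) set" where
  "test_functions S =
     {f. (\<forall>k. C_class k f) \<and> compact (closure {x. f x \<noteq> 0}) \<and> closure {x. f x \<noteq> 0} \<subseteq> S}"

section \<open>Convergence and scalar product in \<open>L\<^sub>2\<close>\<close>

definition L2_tendsto ::
  "(nat \<Rightarrow> 'a::euclidean_space \<Rightarrow> complex) \<Rightarrow> ('a \<Rightarrow> complex) \<Rightarrow> bool" where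
  "L2_tendsto f u \<longleftrightarrow>
     (\<lambda>k. \<integral>\<^sup>+ x. ennreal ((cmod (f k x - u x))\<^sup>2) \<partial>lborel) \<longlonglongrightarrow> 0"

definition L2_inner ::
  "'a::euclidean_space set \<Rightarrow> ('a \<Rightarrow> complex) \<Rightarrow> ('a \<Rightarrow> complex) \<Rightarrow> complex" where
  "L2_inner \<Omega> u v = (LINT x:\<Omega>|lborel. u x * cnj (v x))"

section \<open>Fourier transform and the spaces \<open>H\<^sup>s\<close>\<close>

definition fourier :: "('a::euclidean_space \<Rightarrow> complex) \<Rightarrow> 'a \<Rightarrow> complex" where
  "fourier u \<xi> =
     of_real ((2 * pi) powr (- real DIM('a) / 2)) *
     (LINT x|lborel. exp (- \<i> * of_real (\<xi> \<bullet> x)) * u x)"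

definition Hs_norm_sq :: "real \<Rightarrow> ('a::euclidean_space \<Rightarrow> complex) \<Rightarrow> ennreal" where
  "Hs_norm_sq s u =
     (\<integral>\<^sup>+ \<xi>. ennreal ((1 + (norm \<xi>)\<^sup>2) powr s * (cmod (fourier u \<xi>))\<^sup>2) \<partial>lborel)"

text \<open>
  The completion of the test functions in the \<open>H\<^sup>s\<close> norm, for \<open>s \<ge> 0\<close>. By Plancherel this norm
  dominates the \<open>L\<^sub>2\<close> norm, so every Cauchy sequence has an \<open>L\<^sub>2\<close> limit, and that limit represents
  the corresponding element of the completion. The norm is applied to test functions only, hence
  the integral formula for the Fourier transform suffices.
\<close>

definition Hs :: "real \<Rightarrow> ('a::euclidean_space \<Rightarrow> complex) set" where
  "Hs s = {u. u \<in> borel_measurable lborel \<and>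
     (\<exists>f. (\<forall>k. f k \<in> test_functions UNIV) \<and>
          (\<forall>e>0. \<exists>N. \<forall>i\<ge>N. \<forall>j\<ge>N. Hs_norm_sq s (\<lambda>x. f i x - f j x) < e) \<and>
          L2_tendsto f u)}"

text \<open>The support of a class of functions modulo null sets (the distributional support).\<close>

definition ess_support :: "('a::euclidean_space \<Rightarrow> complex) \<Rightarrow> 'a set" where
  "ess_support u = - \<Union>{U. open U \<and> (AE x in lborel. x \<in> U \<longrightarrow> u x = 0)}"

definition Hs_tilde :: "real \<Rightarrow> 'a::euclidean_space set \<Rightarrow> ('a \<Rightarrow> complex) set" where
  "Hs_tilde s \<Omega> = {u \<in> Hs s. ess_support u \<subseteq> closure \<Omega>}"

section \<open>Lipschitz domains\<close>

text \<open>
  Near each boundary point, \<open>\<Omega>\<close> is the part of a ball lying above the graph of a Lipschitz function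
  of the coordinates orthogonal to a unit vector \<open>e\<close>.
\<close>

definition lipschitz_boundary :: "'a::euclidean_space set \<Rightarrow> bool" where
  "lipschitz_boundary \<Omega> \<longleftrightarrow>
     (\<forall>p\<in>frontier \<Omega>. \<exists>r>0. \<exists>e L. \<exists>g :: 'a \<Rightarrow> real.
        norm e = 1 \<and> L-lipschitz_on {y. y \<bullet> e = 0} g \<and>
        \<Omega> \<inter> ball p r = {x \<in> ball p r. g (x - (x \<bullet> e) *\<^sub>R e) < x \<bullet> e})"

definition bounded_lipschitz_domain :: "'a::euclidean_space set \<Rightarrow> bool" where
  "bounded_lipschitz_domain \<Omega> \<longleftrightarrow>
     open \<Omega> \<and> connected \<Omega> \<and> \<Omega> \<noteq> {} \<and> bounded \<Omega> \<and> lipschitz_boundary \<Omega>"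

section \<open>Eigenfunctions of the Dirichlet Laplacian\<close>

text \<open>
  \<open>H10_grad \<Omega> u G\<close>: \<open>u\<close> (extended by zero) belongs to \<open>H\<^sub>0\<^sup>1(\<Omega>)\<close>, the closure of the test functions
  in \<open>\<Omega>\<close> in the first order Sobolev norm, and \<open>G b\<close> is its weak derivative in direction \<open>b\<close>.
\<close>

definition H10_grad ::
  "'a::euclidean_space set \<Rightarrow> ('a \<Rightarrow> complex) \<Rightarrow> ('a \<Rightarrow> 'a \<Rightarrow> complex) \<Rightarrow> bool" where
  "H10_grad \<Omega> u G \<longleftrightarrow>
     u \<in> borel_measurable lborel \<and> (\<forall>b\<in>Basis. G b \<in> borel_measurable lborel) \<and>
     (\<exists>f. (\<forall>k. f k \<in> test_functions \<Omega>) \<and> L2_tendsto f u \<and>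
          (\<forall>b\<in>Basis. L2_tendsto (\<lambda>k. pderiv_dir b (f k)) (G b)))"

text \<open>The equation \<open>-\<Delta>v = \<mu>v\<close> in \<open>\<Omega>\<close> with \<open>v \<in> H\<^sub>0\<^sup>1(\<Omega>)\<close>, \<open>v \<noteq> 0\<close>, in the weak (form) sense.\<close>

definition dirichlet_eigenpair ::
  "'a::euclidean_space set \<Rightarrow> real \<Rightarrow> ('a \<Rightarrow> complex) \<Rightarrow> bool" where
  "dirichlet_eigenpair \<Omega> \<mu> v \<longleftrightarrow>
     \<not> (AE x in lborel. v x = 0) \<and>
     (\<exists>G. H10_grad \<Omega> v G \<and>
       (\<forall>\<psi>\<in>test_functions \<Omega>.
          (\<Sum>b\<in>Basis. L2_inner \<Omega> (G b) (pderiv_dir b \<psi>)) = of_real \<mu> * L2_inner \<Omega> v \<psi>))"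

text \<open>
  An orthonormal enumeration of all eigenfunctions, eigenvalues being repeated according to
  multiplicity: no eigenfunction is orthogonal to the whole system. Completeness in \<open>L\<^sub>2(\<Omega>)\<close> is not
  part of the definition; it is the spectral theorem.
\<close>

definition dirichlet_eigensystem ::
  "'a::euclidean_space set \<Rightarrow> (nat \<Rightarrow> real) \<Rightarrow> (nat \<Rightarrow> 'a \<Rightarrow> complex) \<Rightarrow> bool" where
  "dirichlet_eigensystem \<Omega> lam \<phi> \<longleftrightarrow>
     (\<forall>j. dirichlet_eigenpair \<Omega> (lam j) (\<phi> j)) \<and>
     (\<forall>i j. L2_inner \<Omega> (\<phi> i) (\<phi> j) = (if i = j then 1 else 0)) \<and>
     (\<forall>\<mu> v. dirichlet_eigenpair \<Omega> \<mu> v \<longrightarrow> (\<exists>j. L2_inner \<Omega> v (\<phi> j) \<noteq> 0))"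

section \<open>Quadratic forms of the fractional Laplacians\<close>

definition Q_Navier ::
  "'a::euclidean_space set \<Rightarrow> (nat \<Rightarrow> real) \<Rightarrow> (nat \<Rightarrow> 'a \<Rightarrow> complex) \<Rightarrow> real \<Rightarrow>
   ('a \<Rightarrow> complex) \<Rightarrow> ennreal" where
  "Q_Navier \<Omega> lam \<phi> s u = (\<Sum>j. ennreal (lam j powr s * (cmod (L2_inner \<Omega> u (\<phi> j)))\<^sup>2))"

text \<open>
  Used for square integrable \<open>u\<close> vanishing almost everywhere outside a bounded set; such \<open>u\<close> is
  integrable, so its Fourier transform is given by the integral formula.
\<close>

definition Q_Dirichlet :: "real \<Rightarrow> ('a::euclidean_space \<Rightarrow> complex) \<Rightarrow> ennreal" where
  "Q_Dirichlet s u =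
     (\<integral>\<^sup>+ \<xi>. ennreal (norm \<xi> powr (2 * s) * (cmod (fourier u \<xi>))\<^sup>2) \<partial>lborel)"

end

theory Submission
  imports Defs "HOL-Probability.Probability" "HOL-Complex_Analysis.Great_Picard"
begin

text \<open>
  For \<open>0 < s < 1\<close> the number \<open>\<lambda>\<^sup>s\<close> is, up to a constant, the integral of
  \<open>t\<^bsup>s-2\<^esup> (t\<lambda> / (t + \<lambda>))\<close> over \<open>t > 0\<close>, so it suffices to compare, for each \<open>t\<close>, the forms
  \<open>N\<^sub>t = \<Sum>\<^sub>j t\<lambda>\<^sub>j / (t + \<lambda>\<^sub>j) |(u, \<phi>\<^sub>j)|\<^sup>2\<close> and \<open>D\<^sub>t = \<integral> t|\<xi>|\<^sup>2 / (t + |\<xi>|\<^sup>2) |\<F>u(\<xi>)|\<^sup>2 d\<xi>\<close>.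
  Both are minima of the same functional \<open>J(w) = \<integral> |\<nabla>w|\<^sup>2 + t \<integral> |u - w|\<^sup>2\<close>, over \<open>H\<^sub>0\<^sup>1(\<Omega>)\<close> and over
  \<open>H\<^sup>1(\<real>\<^sup>n)\<close> respectively; hence \<open>N\<^sub>t \<ge> D\<^sub>t\<close>. If the integrals over \<open>t\<close> agree, then \<open>N\<^sub>t = D\<^sub>t\<close> for
  almost every \<open>t\<close>, the minimiser over \<open>H\<^sub>0\<^sup>1(\<Omega>)\<close> solves \<open>-\<Delta>w + tw = tu\<close> on the whole space, and testing
  with \<open>exp(\<eta> \<bullet> x)\<close>, \<open>|\<eta>|\<^sup>2 = t\<close>, gives \<open>\<integral> u exp(\<eta> \<bullet> x) dx = 0\<close>. Exponentials span a dense set of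
  continuous functions, so \<open>u = 0\<close>. That \<open>N\<^sub>t\<close> is the minimum over \<open>H\<^sub>0\<^sup>1(\<Omega>)\<close> uses the completeness of the
  eigenfunctions, which follows from Rellich's theorem.
\<close>

section \<open>Hilbert space lemmas\<close>

text \<open>An eigensystem is given as orthonormal and maximal; completeness must be proved before u
  can be expanded, which is the purpose of the Hilbert space and compactness parts. Exact minimisers
  are avoided: a truncated expansion, replaced by a nearby test function f, has energy at most N_t +
  d for any d > 0, and the energy of every \<open>C1_functions\<close> element bounds D_t from
  above. For that bound it suffices that the Fourier transform does not increase the L2 norm,
  applied to derivatives of f and to u - f; neither inversion nor the full Plancherel identity
  appears. The case of equality is a perturbation argument with the same error d: f is compared with
  f + r g for all real r. Complex functions live in a real Hilbert space with scalar product Re (u,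
  v); complex statements are recovered by testing with a function and with \<i> times it. Two facts
  link the definitions to this scheme: the frontier of a Lipschitz domain is a null set, so u
  vanishes almost everywhere outside \<Omega> and not merely outside its closure; and
  \<open>Q_Dirichlet\<close> is finite on \<open>Hs_tilde\<close>, without which equal integrals
  over t would say nothing about their integrands.\<close>

lemma norm_add_scaleR_square:
  fixes a b :: "'e::real_inner"
  shows "(norm (a + c *\<^sub>R b))\<^sup>2 = (norm a)\<^sup>2 + 2 * c * (a \<bullet> b) + c\<^sup>2 * (norm b)\<^sup>2"
  unfolding power2_norm_eq_inner inner_add_left inner_add_right inner_scaleR_left inner_scaleR_right
    inner_commute[of b a]
  by (simp add: power2_eq_square algebra_simps)

text \<open>The representer minimises \<open>(norm v)\<^sup>2 - 2 * f v\<close> over S. By the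
  parallelogram law minimising sequences are Cauchy, so completeness and closedness of S supply the
  minimum, and the first variation there is the asserted identity.\<close>

lemma riesz_representation_subspace:
  fixes S :: "'e::{real_inner,complete_space} set" and f :: "'e \<Rightarrow> real"
  assumes S: "subspace S" "closed S" and f: "bounded_linear f"
  shows "\<exists>w\<in>S. \<forall>v\<in>S. w \<bullet> v = f v"
proof -
  interpret f: bounded_linear f by fact
  define q where "q v = (norm v)\<^sup>2 - 2 * f v" for v
  obtain K where K: "\<And>v. norm (f v) \<le> norm v * K" using f.bounded by blast
  have qlow: "- K\<^sup>2 \<le> q v" for v
  proof -
    have "f v \<le> norm v * K" using K[of v] by (auto simp: abs_le_iff)
    moreover have "0 \<le> (norm v - K)\<^sup>2" by simp
    ultimately show ?thesis unfolding q_def by (simp add: power2_diff)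
  qed
  define m where "m = (INF v\<in>S. q v)"
  have bdd: "bdd_below (q ` S)" using qlow by (auto intro!: bdd_belowI2)
  have ne: "S \<noteq> {}" using S subspace_0 by blast
  have mle: "m \<le> q v" if "v \<in> S" for v unfolding m_def using bdd that by (rule cINF_lower)
  have "\<exists>v\<in>S. q v < m + 1 / Suc k" for k
    using cINF_less_iff[OF ne bdd, of "m + 1 / Suc k"] unfolding m_def by simp
  then obtain v where v: "\<And>k. v k \<in> S" "\<And>k. q (v k) < m + 1 / Suc k" by metis
  \<comment> \<open>The midpoint of x and y lies in S, so q is at least m there; the parallelogram
    law turns this into a bound on |x - y|.\<close>
  have par: "(norm (x - y))\<^sup>2 \<le> 2 * (q x - m) + 2 * (q y - m)" if "x \<in> S" "y \<in> S" for x y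
  proof -
    have "(1/2) *\<^sub>R (x + y) \<in> S" using S that by (simp add: subspace_add subspace_scale)
    from mle[OF this] show ?thesis unfolding q_def
      by (simp add: power2_norm_eq_inner f.add f.scaleR inner_add inner_diff inner_commute algebra_simps)
  qed
  have "Cauchy v"
  proof (rule CauchyI)
    fix e :: real assume e: "0 < e"
    obtain M where M: "1 / Suc M < e\<^sup>2 / 4" using e reals_Archimedean[of "e\<^sup>2 / 4"] by (auto simp: inverse_eq_divide)
    have "norm (v i - v j) < e" if "M \<le> i" "M \<le> j" for i j
    proof -
      have "1 / Suc i \<le> 1 / Suc M" "1 / Suc j \<le> 1 / Suc M" using that by (auto simp: divide_simps)
      then have qM: "q (v i) - m < 1 / Suc M" "q (v j) - m < 1 / Suc M" using v(2)[of i] v(2)[of j] by linarith+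
      have qe: "q (v i) - m < e\<^sup>2 / 4" "q (v j) - m < e\<^sup>2 / 4" by (rule less_trans[OF qM(1) M], rule less_trans[OF qM(2) M])
      have lin: "A < E / 4 \<Longrightarrow> B < E / 4 \<Longrightarrow> N \<le> 2 * A + 2 * B \<Longrightarrow> N < E" for A B E N :: real by linarith
      have "(norm (v i - v j))\<^sup>2 < e\<^sup>2" 
        by (rule lin[OF qe par[OF v(1)[of i] v(1)[of j]]])
      then show ?thesis using e by (simp add: power2_less_imp_less)
    qed
    then show "\<exists>M. \<forall>i\<ge>M. \<forall>j\<ge>M. norm (v i - v j) < e" by blast
  qed
  then obtain w where w: "v \<longlonglongrightarrow> w" using Cauchy_convergent convergent_def by blast
  have wS: "w \<in> S" using S(2) v(1) w closed_sequentially by blast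
  have "(\<lambda>k. q (v k)) \<longlonglongrightarrow> q w" unfolding q_def by (intro tendsto_intros w f.tendsto)
  moreover have "(\<lambda>k. m + 1 / Suc k) \<longlonglongrightarrow> m + 0"
    using LIMSEQ_inverse_real_of_nat by (intro tendsto_intros) (simp add: inverse_eq_divide)
  ultimately have qw: "q w \<le> m" using v(2) LIMSEQ_le[of "\<lambda>k. q (v k)" "q w" "\<lambda>k. m + 1 / Suc k" "m + 0"] by (auto intro: less_imp_le)
  have "w \<bullet> x = f x" if x: "x \<in> S" for x
  proof -
    have "w + s *\<^sub>R x \<in> S" for s using S wS x by (simp add: subspace_add subspace_scale)
    from order_trans[OF qw mle[OF this]]
    have key: "0 \<le> 2 * s * (w \<bullet> x - f x) + s\<^sup>2 * (norm x)\<^sup>2" for s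
      unfolding q_def norm_add_scaleR_square f.add f.scaleR by (simp add: algebra_simps)
    define d where "d = w \<bullet> x - f x"
    \<comment> \<open>The quadratic polynomial in \<open>key\<close> is tested at s = - d / N;
      adding 1 keeps the division valid for x = 0.\<close>
    define N where "N = (norm x)\<^sup>2 + 1"
    have N: "N > 0" unfolding N_def by (smt (verit) zero_le_power2)
    have "0 \<le> 2 * (- d / N) * d + (- d / N)\<^sup>2 * (norm x)\<^sup>2" using key[of "- d / N"] d_def by simp
    also have "\<dots> \<le> 2 * (- d / N) * d + (- d / N)\<^sup>2 * N" unfolding N_def by (simp add: mult_left_mono)
    also have "\<dots> = - d\<^sup>2 / N" using N by (simp add: field_simps power2_eq_square)
    finally have "d\<^sup>2 \<le> 0" using N by (simp add: field_simps)
    then show ?thesis unfolding d_def by simp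
  qed
  then show ?thesis using wS by blast
qed

text \<open>Completeness of eigenvectors for a form domain S with compact embedding P: F consists of
  eigenvectors, and \<open>max\<close> says that no eigenvector is orthogonal to all of F. If u were
  orthogonal to P F but not to P S, the vectors of S whose images are orthogonal to P F would not
  all be killed by P; a maximiser of the Rayleigh quotient |P x|^2 / |x|^2 among them is a further
  eigenvector, against \<open>max\<close>.\<close>

lemma spectral_orthogonality:
  fixes S :: "'e::{real_inner,complete_space} set" and P :: "'e \<Rightarrow> 'l::real_inner"
    and F :: "'e set" and c :: "'e \<Rightarrow> real"
  assumes S: "subspace S" "closed S" and P: "bounded_linear P"
    and compact: "\<And>x :: nat \<Rightarrow> 'e. \<lbrakk>\<And>k. x k \<in> S; bounded (range x)\<rbrakk> \<Longrightarrow> \<exists>r :: nat \<Rightarrow> nat. strict_mono r \<and> Cauchy (\<lambda>k. P (x (r k)))"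
    and F: "F \<subseteq> S" "\<And>\<phi> v. \<phi> \<in> F \<Longrightarrow> v \<in> S \<Longrightarrow> \<phi> \<bullet> v = c \<phi> * (P \<phi> \<bullet> P v)"
    and max: "\<And>v \<mu>. \<lbrakk>v \<in> S; v \<noteq> 0; \<And>\<psi>. \<psi> \<in> S \<Longrightarrow> v \<bullet> \<psi> = \<mu> * (P v \<bullet> P \<psi>)\<rbrakk> \<Longrightarrow> \<exists>\<phi>\<in>F. P v \<bullet> P \<phi> \<noteq> 0"
    and u: "\<And>\<phi>. \<phi> \<in> F \<Longrightarrow> u \<bullet> P \<phi> = 0"
    and v: "v \<in> S"
  shows "u \<bullet> P v = 0"
proof (rule ccontr)
  assume ne: "u \<bullet> P v \<noteq> 0"
  interpret P: bounded_linear P by fact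
  have "\<exists>w\<in>S. \<forall>x\<in>S. w \<bullet> x = y \<bullet> P x" for y
    by (rule riesz_representation_subspace[OF S])
       (intro bounded_linear_compose[OF bounded_linear_inner_right P])
  \<comment> \<open>T is the adjoint of P restricted to S, so \<open>T \<circ> P\<close> is the
    self-adjoint operator whose largest eigenvalue on V is sought.\<close>
  then obtain T where T: "\<And>y. T y \<in> S" "\<And>y x. x \<in> S \<Longrightarrow> T y \<bullet> x = y \<bullet> P x" by metis
  define V where "V = {x \<in> S. \<forall>\<phi>\<in>F. P x \<bullet> P \<phi> = 0}"
  \<comment> \<open>Since \<phi> is an eigenvector, orthogonality to P \<phi> passes from y to P (T
    y). The factor c \<phi> can be cancelled unless it is 0, and then \<phi> itself is 0.\<close>
  have TV: "T y \<in> V" if "\<And>\<phi>. \<phi> \<in> F \<Longrightarrow> y \<bullet> P \<phi> = 0" for y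
  proof -
    have "P (T y) \<bullet> P \<phi> = 0" if \<phi>: "\<phi> \<in> F" for \<phi>
    proof -
      have "\<phi> \<in> S" using F \<phi> by blast
      then have *: "c \<phi> * (P (T y) \<bullet> P \<phi>) = 0" "\<phi> \<bullet> \<phi> = c \<phi> * (P \<phi> \<bullet> P \<phi>)"
        using F(2)[OF \<phi> T(1)[of y]] T(2)[of \<phi> y] \<open>\<And>\<phi>. \<phi> \<in> F \<Longrightarrow> y \<bullet> P \<phi> = 0\<close>[OF \<phi>] F(2)[OF \<phi>, of \<phi>]
        by (simp_all add: inner_commute)
      show ?thesis
      proof (cases "c \<phi> = 0")
        case True
        then have "\<phi> = 0" using * by simp
        then show ?thesis by (simp add: P.zero)
      qed (use * in simp)
    qed
    then show ?thesis using T(1) unfolding V_def by simp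
  qed
  have V: "subspace V"
    using S(1) unfolding V_def subspace_def
    by (auto simp: P.zero P.add P.scaleR inner_add)
  \<comment> \<open>The witness is T u: if P (T u) = 0 then T u = 0, and u \<bullet> P v = T u
    \<bullet> v would be 0.\<close>
  have "\<exists>v\<in>V. P v \<noteq> 0"
  proof (intro bexI[of _ "T u"] notI)
    assume "P (T u) = 0"
    then have "T u \<bullet> T u = 0" using T(2)[OF T(1)[of u], of u] by simp
    then have "T u = 0" by simp
    then show False using T(2)[OF v, of u] ne by simp
  qed (use TV u in auto)
  then obtain v0 where v0: "v0 \<in> V" "P v0 \<noteq> 0" by blast
  then have v0': "v0 \<noteq> 0" using P.zero by auto
  define U where "U = {x \<in> V. norm x = 1}"
  define M where "M = (SUP x\<in>U. (norm (P x))\<^sup>2)"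
  obtain K where K: "\<And>x. norm (P x) \<le> norm x * K" using P.bounded by blast
  have bdd: "bdd_above ((\<lambda>x. (norm (P x))\<^sup>2) ` U)"
  proof (rule bdd_aboveI2[of _ _ "K\<^sup>2"])
    fix x assume "x \<in> U"
    then have "norm (P x) \<le> K" using K[of x] by (simp add: U_def)
    then show "(norm (P x))\<^sup>2 \<le> K\<^sup>2" by (simp add: power_mono)
  qed
  have v1: "(1 / norm v0) *\<^sub>R v0 \<in> U" using V v0 v0' by (simp add: U_def subspace_scale)
  have leM: "(norm (P x))\<^sup>2 \<le> M" if "x \<in> U" for x unfolding M_def using bdd that by (rule cSUP_upper2) simp
  have M0: "M > 0" 
  proof -
    have "0 < (norm (P ((1 / norm v0) *\<^sub>R v0)))\<^sup>2" using v0 v0' by (simp add: P.scaleR)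
    then show ?thesis using leM[OF v1] by linarith
  qed
  have leM': "(norm (P x))\<^sup>2 \<le> M * (norm x)\<^sup>2" if "x \<in> V" for x
  proof (cases "x = 0")
    case False
    then have "(1 / norm x) *\<^sub>R x \<in> U" using V that by (simp add: U_def subspace_scale)
    from leM[OF this] have "(norm (P x))\<^sup>2 / (norm x)\<^sup>2 \<le> M" by (simp add: P.scaleR power_divide)
    then show ?thesis using False by (simp add: divide_le_eq)
  qed (simp add: P.zero)
  have Une: "U \<noteq> {}" using v1 by blast
  have "\<exists>x\<in>U. M - 1 / Suc k < (norm (P x))\<^sup>2" for k
    using less_cSUP_iff[OF Une bdd, of "M - 1 / Suc k"] unfolding M_def by simp
  then obtain x where x: "\<And>k. x k \<in> U" "\<And>k. M - 1 / Suc k < (norm (P (x k)))\<^sup>2" by metis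
  have PV: "P x \<bullet> P \<phi> = 0" if "x \<in> V" "\<phi> \<in> F" for x \<phi> using that by (simp add: V_def)
  \<comment> \<open>|T P y|^2 = P y \<bullet> P (T P y), and \<open>leM'\<close> estimates the
    second factor. So T is bounded by sqrt M on P V and will carry the Cauchy sequence found by
    compactness to a Cauchy sequence in S.\<close>
  have TPbd: "(norm (T (P y)))\<^sup>2 \<le> M * (norm (P y))\<^sup>2" if y: "y \<in> V" for y
  proof -
    let ?z = "T (P y)"
    have zV: "?z \<in> V" using TV PV y by blast
    have "(norm ?z)\<^sup>2 = P y \<bullet> P ?z" using T by (simp add: power2_norm_eq_inner)
    also have "\<dots> \<le> norm (P y) * norm (P ?z)" by (rule norm_cauchy_schwarz)
    also have "\<dots> \<le> norm (P y) * (sqrt M * norm ?z)"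
    proof -
      have "norm (P ?z) \<le> sqrt (M * (norm ?z)\<^sup>2)" using leM'[OF zV] by (simp add: real_le_rsqrt)
      then show ?thesis using M0 by (simp add: real_sqrt_mult mult_left_mono)
    qed
    finally have "norm ?z * norm ?z \<le> (sqrt M * norm (P y)) * norm ?z" by (simp add: power2_eq_square algebra_simps)
    then have "norm ?z \<le> sqrt M * norm (P y)"
      using M0 by (cases "norm ?z = 0") (simp, metis mult_right_le_imp_le norm_ge_zero order_le_less)
    then have "(norm ?z)\<^sup>2 \<le> (sqrt M * norm (P y))\<^sup>2" by (simp add: power_mono)
    then show ?thesis using M0 by (simp add: power_mult_distrib)
  qed
  have bddx: "bounded (range x)" using x by (auto simp: U_def bounded_iff intro!: exI[of _ 1])
  have xV: "x k \<in> V" "norm (x k) = 1" for k using x(1)[of k] by (auto simp: U_def)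
  have xS: "x k \<in> S" for k using xV(1)[of k] by (simp add: V_def)
  obtain r where r: "strict_mono r" "Cauchy (\<lambda>k. P (x (r k)))" using compact[of x] xS bddx by blast
  define y where "y k = x (r k)" for k
  have Tlin: "T (P a) - T (P b) = T (P (a - b))" for a b
  proof -
    define d where "d = T (P a) - T (P b) - T (P (a - b))"
    have dS: "d \<in> S" unfolding d_def using S T by (simp add: subspace_diff)
    have "d \<bullet> d = T (P a) \<bullet> d - T (P b) \<bullet> d - T (P (a - b)) \<bullet> d" by (metis d_def inner_diff_left)
    also have "\<dots> = 0" by (simp only: T(2)[OF dS] P.diff inner_diff_left)
    finally have "d \<bullet> d = 0" .
    then show ?thesis by (simp add: d_def)
  qed
  have "Cauchy (\<lambda>k. T (P (y k)))"
  proof (rule CauchyI)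
    fix e :: real assume "0 < e"
    then have "0 < e / sqrt M" using M0 by simp
    from CauchyD[OF r(2) this] obtain N where N: "\<And>i j. N \<le> i \<Longrightarrow> N \<le> j \<Longrightarrow> norm (P (y i) - P (y j)) < e / sqrt M"
      unfolding y_def by blast
    have "norm (T (P (y i)) - T (P (y j))) < e" if "N \<le> i" "N \<le> j" for i j
    proof -
      have "y i - y j \<in> V" using V xV by (simp add: y_def subspace_diff)
      from TPbd[OF this] have "norm (T (P (y i - y j))) \<le> sqrt (M * (norm (P (y i - y j)))\<^sup>2)"
        by (simp add: real_le_rsqrt)
      also have "\<dots> = sqrt M * norm (P (y i) - P (y j))" by (simp add: real_sqrt_mult P.diff)
      also have "\<dots> < e" using N[OF that] M0 by (simp add: field_simps)
      finally show ?thesis by (simp add: Tlin)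
    qed
    then show "\<exists>N. \<forall>i\<ge>N. \<forall>j\<ge>N. norm (T (P (y i)) - T (P (y j))) < e" by blast
  qed
  then obtain z where z: "(\<lambda>k. T (P (y k))) \<longlonglongrightarrow> z" using Cauchy_convergent convergent_def by blast
  have lim0: "(\<lambda>k. 1 / real (Suc (r k))) \<longlonglongrightarrow> 0"
    using LIMSEQ_subseq_LIMSEQ[OF LIMSEQ_inverse_real_of_nat r(1)] by (simp add: inverse_eq_divide o_def)
  \<comment> \<open>Expanding the square gives |T P y - M y|^2 \<le> M (M - |P y|^2) for unit
    vectors y in V, which tends to 0 along a maximising sequence. Hence y k itself converges,
    although compactness speaks of P (y k).\<close>
  have diff: "(\<lambda>k. T (P (y k)) - M *\<^sub>R y k) \<longlonglongrightarrow> 0"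
  proof (rule Lim_null_comparison)
    show "(\<lambda>k. sqrt (M * (1 / real (Suc (r k))))) \<longlonglongrightarrow> 0"
      using tendsto_real_sqrt[OF tendsto_mult_left[OF lim0, of M]] by simp
    have "norm (T (P (y k)) - M *\<^sub>R y k) \<le> sqrt (M * (1 / real (Suc (r k))))" for k
    proof (rule real_le_rsqrt)
      have yS: "y k \<in> S" "y k \<in> V" "norm (y k) = 1" using xV unfolding y_def by (auto simp: V_def)
      have "(norm (T (P (y k)) - M *\<^sub>R y k))\<^sup>2 = (norm (T (P (y k))))\<^sup>2 - 2 * M * (T (P (y k)) \<bullet> y k) + M\<^sup>2 * (norm (y k))\<^sup>2"
        using norm_add_scaleR_square[of "T (P (y k))" "- M" "y k"] by simp
      also have "T (P (y k)) \<bullet> y k = (norm (P (y k)))\<^sup>2" using T yS by (simp add: power2_norm_eq_inner)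
      also have "(norm (T (P (y k))))\<^sup>2 - 2 * M * (norm (P (y k)))\<^sup>2 + M\<^sup>2 * (norm (y k))\<^sup>2 \<le> M * (M - (norm (P (y k)))\<^sup>2)"
        using TPbd[OF yS(2)] yS(3) by (simp add: algebra_simps power2_eq_square)
      also have "\<dots> \<le> M * (1 / real (Suc (r k)))" using x(2)[of "r k"] M0 unfolding y_def
        by (intro mult_left_mono) auto
      finally show "(norm (T (P (y k)) - M *\<^sub>R y k))\<^sup>2 \<le> M * (1 / real (Suc (r k)))" .
    qed
    then show "\<forall>\<^sub>F k in sequentially. norm (T (P (y k)) - M *\<^sub>R y k) \<le> sqrt (M * (1 / real (Suc (r k))))" by simp
  qed
  have "(\<lambda>k. (1 / M) *\<^sub>R (T (P (y k)) - (T (P (y k)) - M *\<^sub>R y k))) \<longlonglongrightarrow> (1 / M) *\<^sub>R (z - 0)"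
    by (intro tendsto_intros z diff)
  then have ylim: "y \<longlonglongrightarrow> (1 / M) *\<^sub>R z" using M0 by simp
  define w where "w = (1 / M) *\<^sub>R z"
  have ylim: "y \<longlonglongrightarrow> w" using ylim w_def by simp
  have wS: "w \<in> S" using closed_sequentially[OF S(2) _ ylim] xS by (simp add: y_def)
  have "norm w = 1" using tendsto_norm[OF ylim] xV(2) by (simp add: y_def LIMSEQ_const_iff)
  then have w0: "w \<noteq> 0" by auto
  have Plim: "(\<lambda>k. P (y k)) \<longlonglongrightarrow> P w" using ylim by (rule P.tendsto)
  \<comment> \<open>The limit z of \<open>T (P (y k))\<close> is M times w, so the adjoint relation
    becomes the eigenvector equation with factor 1 / M.\<close>
  have eig: "w \<bullet> \<psi> = (1 / M) * (P w \<bullet> P \<psi>)" if \<psi>: "\<psi> \<in> S" for \<psi>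
  proof -
    have "(\<lambda>k. T (P (y k)) \<bullet> \<psi>) \<longlonglongrightarrow> z \<bullet> \<psi>" by (intro tendsto_intros z)
    moreover have "(\<lambda>k. T (P (y k)) \<bullet> \<psi>) \<longlonglongrightarrow> P w \<bullet> P \<psi>" using T(2)[OF \<psi>] by (auto intro!: tendsto_intros Plim)
    ultimately have "z \<bullet> \<psi> = P w \<bullet> P \<psi>" using LIMSEQ_unique by blast
    then show ?thesis by (simp add: w_def)
  qed
  obtain \<phi> where \<phi>: "\<phi> \<in> F" "P w \<bullet> P \<phi> \<noteq> 0" using max[OF wS w0 eig] by blast
  have "(\<lambda>k. P (y k) \<bullet> P \<phi>) \<longlonglongrightarrow> P w \<bullet> P \<phi>" by (intro tendsto_intros Plim)
  moreover have "P (y k) \<bullet> P \<phi> = 0" for k using PV xV(1) \<phi>(1) unfolding y_def by blast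
  ultimately show False using \<phi>(2) by (simp add: LIMSEQ_const_iff)
qed

text \<open>Totality is assumed inside a closed subspace Z, in the application the functions
  vanishing outside \<Omega>. Bessel's inequality makes the partial sums Cauchy, and their limit
  differs from u by an element of Z orthogonal to every e k.\<close>

lemma orthonormal_expansion_limit:
  fixes e :: "nat \<Rightarrow> 'l::{real_inner,complete_space}"
  assumes on: "\<And>i j. e i \<bullet> e j = (if i = j then 1 else 0)"
    and Z: "subspace Z" "closed Z" "\<And>k. e k \<in> Z"
    and total: "\<And>r. r \<in> Z \<Longrightarrow> (\<And>k. r \<bullet> e k = 0) \<Longrightarrow> r = 0"
    and u: "u \<in> Z"
  shows "(\<lambda>m. \<Sum>k<m. (u \<bullet> e k) *\<^sub>R e k) \<longlonglongrightarrow> u" "(\<lambda>k. (u \<bullet> e k)\<^sup>2) sums (norm u)\<^sup>2"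
proof -
  define p where "p m = (\<Sum>k<m. (u \<bullet> e k) *\<^sub>R e k)" for m
  have pe: "p m \<bullet> e k = (if k < m then u \<bullet> e k else 0)" for m k
  proof -
    have "p m \<bullet> e k = (\<Sum>j<m. if j = k then u \<bullet> e k else 0)"
      unfolding p_def inner_sum_left by (intro sum.cong) (auto simp: on)
    then show ?thesis by (simp add: sum.delta')
  qed
  have pp: "p m \<bullet> p n = (\<Sum>k<min m n. (u \<bullet> e k)\<^sup>2)" for m n
  proof -
    have "p m \<bullet> p n = (\<Sum>k<n. (u \<bullet> e k) * (p m \<bullet> e k))"
      by (subst (2) p_def) (simp add: inner_sum_right)
    also have "\<dots> = (\<Sum>k\<in>{..<n}. if k < m then (u \<bullet> e k)\<^sup>2 else 0)"
      by (intro sum.cong) (auto simp: pe power2_eq_square)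
    also have "\<dots> = (\<Sum>k\<in>{..<n} \<inter> {k. k < m}. (u \<bullet> e k)\<^sup>2)" by (simp add: sum.inter_restrict)
    also have "{..<n} \<inter> {k. k < m} = {..<min m n}" by auto
    finally show ?thesis .
  qed
  have up: "u \<bullet> p m = (\<Sum>k<m. (u \<bullet> e k)\<^sup>2)" for m
    unfolding p_def inner_sum_right by (simp add: power2_eq_square)
  have bess: "(\<Sum>k<m. (u \<bullet> e k)\<^sup>2) \<le> (norm u)\<^sup>2" for m
  proof -
    have "0 \<le> (norm (u - p m))\<^sup>2" by simp
    also have "\<dots> = (norm u)\<^sup>2 - (\<Sum>k<m. (u \<bullet> e k)\<^sup>2)"
      using pp[of m m] up[of m] by (simp add: power2_norm_eq_inner inner_diff inner_commute)
    finally show ?thesis by simp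
  qed
  have summ: "summable (\<lambda>k. (u \<bullet> e k)\<^sup>2)" by (rule summableI_nonneg_bounded[of _ "(norm u)\<^sup>2"]) (auto simp: bess)
  \<comment> \<open>By \<open>pp\<close>, p m \<bullet> p n is the Bessel sum up to min m n, so the
    squared distance is a difference of partial sums of a convergent series.\<close>
  have dist: "(norm (p m - p n))\<^sup>2 = \<bar>(\<Sum>k<m. (u \<bullet> e k)\<^sup>2) - (\<Sum>k<n. (u \<bullet> e k)\<^sup>2)\<bar>" for m n
  proof -
    define s where "s m = (\<Sum>k<m. (u \<bullet> e k)\<^sup>2)" for m
    have smono: "s i \<le> s j" if "i \<le> j" for i j unfolding s_def using that by (intro sum_mono2) auto
    have "(norm (p m - p n))\<^sup>2 = s m + s n - 2 * s (min m n)"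
      by (simp add: power2_norm_eq_inner inner_diff inner_commute pp s_def min.commute)
    then show ?thesis using smono[of m n] smono[of n m] unfolding s_def[symmetric]
      by (cases "m \<le> n") (auto simp: min_def)
  qed
  have "Cauchy p"
  proof (rule CauchyI)
    fix r :: real assume "0 < r"
    then have r2: "0 < r\<^sup>2" by simp
    from summ have "Cauchy (\<lambda>m. \<Sum>k<m. (u \<bullet> e k)\<^sup>2)"
      by (simp add: summable_iff_convergent convergent_Cauchy)
    from CauchyD[OF this r2] obtain N where N: "\<And>i j. N \<le> i \<Longrightarrow> N \<le> j \<Longrightarrow> (norm (p i - p j))\<^sup>2 < r\<^sup>2"
      unfolding dist real_norm_def by blast
    then show "\<exists>N. \<forall>i\<ge>N. \<forall>j\<ge>N. norm (p i - p j) < r" using \<open>0 < r\<close> power2_less_imp_less less_imp_le by metis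
  qed
  then obtain w where w: "p \<longlonglongrightarrow> w" using Cauchy_convergent convergent_def by blast
  have pZ: "p m \<in> Z" for m unfolding p_def by (intro subspace_sum subspace_scale Z)
  have wZ: "w \<in> Z" using closed_sequentially[OF Z(2) _ w] pZ by blast
  have "u - w = 0"
  proof (rule total)
    show "u - w \<in> Z" using Z u wZ by (simp add: subspace_diff)
    fix k
    have "(\<lambda>m. p m \<bullet> e k) \<longlonglongrightarrow> w \<bullet> e k" by (intro tendsto_intros w)
    moreover have "(\<lambda>m. p m \<bullet> e k) \<longlonglongrightarrow> u \<bullet> e k"
      by (rule tendsto_eventually) (rule eventually_mono[OF eventually_gt_at_top[of k]], simp add: pe)
    ultimately show "(u - w) \<bullet> e k = 0" using LIMSEQ_unique by (auto simp: inner_diff)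
  qed
  then have pu: "p \<longlonglongrightarrow> u" using w by simp
  then show "(\<lambda>m. \<Sum>k<m. (u \<bullet> e k) *\<^sub>R e k) \<longlonglongrightarrow> u" unfolding p_def .
  have "(\<lambda>m. u \<bullet> p m) \<longlonglongrightarrow> u \<bullet> u" by (intro tendsto_intros pu)
  then show "(\<lambda>k. (u \<bullet> e k)\<^sup>2) sums (norm u)\<^sup>2" unfolding sums_def up power2_norm_eq_inner .
qed

text \<open>In the application the norm of S is the first order Sobolev norm, so
  \<open>(norm v)\<^sup>2 - (norm (P v))\<^sup>2\<close> is the Dirichlet energy and l k the Laplace
  eigenvalue. On the span of finitely many eigenvectors the functional splits into scalar problems,
  each solved exactly; d pays for the tail of u.\<close>

lemma eigen_expansion_energy:
  fixes P :: "'e::real_inner \<Rightarrow> 'l::{real_inner,complete_space}" and \<epsilon> :: "nat \<Rightarrow> 'e"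
  assumes S: "subspace S" "\<And>k. \<epsilon> k \<in> S" and P: "linear P"
    and on: "\<And>i j. P (\<epsilon> i) \<bullet> P (\<epsilon> j) = (if i = j then 1 else 0)"
    and eig: "\<And>k v. v \<in> S \<Longrightarrow> \<epsilon> k \<bullet> v = (1 + l k) * (P (\<epsilon> k) \<bullet> P v)"
    and l: "\<And>k. l k \<ge> 0"
    and Z: "subspace Z" "closed Z" "\<And>k. P (\<epsilon> k) \<in> Z"
    and total: "\<And>r. r \<in> Z \<Longrightarrow> (\<And>k. r \<bullet> P (\<epsilon> k) = 0) \<Longrightarrow> r = 0"
    and u: "u \<in> Z" and t: "t > 0" and d: "d > 0"
  shows "\<exists>v\<in>S. \<exists>m. (norm v)\<^sup>2 - (norm (P v))\<^sup>2 + t * (norm (u - P v))\<^sup>2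
            \<le> (\<Sum>k<m. t * l k / (t + l k) * (u \<bullet> P (\<epsilon> k))\<^sup>2) + d"
proof -
  interpret P: linear P by fact
  define e where "e k = P (\<epsilon> k)" for k
  define c where "c k = u \<bullet> e k" for k
  define p where "p m = (\<Sum>k<m. c k *\<^sub>R e k)" for m
  note lims = orthonormal_expansion_limit[OF on Z total u, folded e_def, folded c_def, folded p_def]
  have "(\<lambda>m. t * (norm (u - p m))\<^sup>2) \<longlonglongrightarrow> t * (norm (u - u))\<^sup>2"
    by (intro tendsto_intros lims)
  then have "(\<lambda>m. t * (norm (u - p m))\<^sup>2) \<longlonglongrightarrow> 0" by simp
  from order_tendstoD(2)[OF this d] obtain m where m: "t * (norm (u - p m))\<^sup>2 < d"
    by (auto simp: eventually_sequentially)
  \<comment> \<open>For fixed c the value a = t c / (t + l) minimises l a^2 + t (c - a)^2, with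
    minimum t l c^2 / (t + l); \<open>alg\<close> below evaluates it.\<close>
  define a where "a k = t / (t + l k) * c k" for k
  define v where "v = (\<Sum>k<m. a k *\<^sub>R \<epsilon> k)"
  have vS: "v \<in> S" unfolding v_def by (intro subspace_sum subspace_scale S)
  have Pv: "P v = (\<Sum>k<m. a k *\<^sub>R e k)" unfolding v_def e_def by (simp add: P.sum P.scale)
  have ee: "e i \<bullet> e j = (if i = j then 1 else 0)" for i j using on by (simp add: e_def)
  have sumsq: "(norm (\<Sum>k<m. b k *\<^sub>R e k))\<^sup>2 = (\<Sum>k<m. (b k)\<^sup>2)" for b
  proof -
    have "(norm (\<Sum>k<m. b k *\<^sub>R e k))\<^sup>2 = (\<Sum>k<m. \<Sum>j<m. b j * (b k * (e j \<bullet> e k)))"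
      by (simp add: power2_norm_eq_inner inner_sum_left inner_sum_right sum_distrib_left algebra_simps)
    also have "\<dots> = (\<Sum>k<m. \<Sum>j<m. if j = k then b k * b k else 0)"
      by (intro sum.cong) (auto simp: ee)
    finally show ?thesis by (simp add: power2_eq_square)
  qed
  have ev: "e k \<bullet> P v = a k" if "k < m" for k
    using that by (simp add: Pv inner_sum_right ee if_distrib cong: if_cong)
  have "v \<bullet> v = (\<Sum>k<m. a k * (\<epsilon> k \<bullet> v))" by (subst (1) v_def) (simp add: inner_sum_left)
  also have "\<dots> = (\<Sum>k<m. (1 + l k) * (a k)\<^sup>2)"
    by (intro sum.cong) (auto simp: eig[OF vS, folded e_def] ev power2_eq_square)
  finally have nv: "(norm v)\<^sup>2 = (\<Sum>k<m. (1 + l k) * (a k)\<^sup>2)" by (simp add: power2_norm_eq_inner)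
  have nPv: "(norm (P v))\<^sup>2 = (\<Sum>k<m. (a k)\<^sup>2)" unfolding Pv sumsq ..
  have orth: "(u - p m) \<bullet> e k = 0" if "k < m" for k
    using that by (simp add: p_def inner_diff inner_sum_left ee if_distrib c_def cong: if_cong)
  have dec: "u - P v = (u - p m) + (\<Sum>k<m. (c k - a k) *\<^sub>R e k)"
    by (simp add: Pv p_def sum_subtractf algebra_simps)
  have "(u - p m) \<bullet> (\<Sum>k<m. (c k - a k) *\<^sub>R e k) = 0"
    using orth by (simp add: inner_sum_right)
  then have nu: "(norm (u - P v))\<^sup>2 = (norm (u - p m))\<^sup>2 + (\<Sum>k<m. (c k - a k)\<^sup>2)"
    unfolding dec using sumsq[of "\<lambda>k. c k - a k"]
    by (simp only: power2_norm_eq_inner inner_add inner_commute[of "\<Sum>k<m. (c k - a k) *\<^sub>R e k" "u - p m"])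
  have alg: "(1 + l k) * (a k)\<^sup>2 - (a k)\<^sup>2 + t * (c k - a k)\<^sup>2 = t * l k / (t + l k) * (c k)\<^sup>2" for k
  proof -
    have tl: "t + l k > 0" using t l[of k] by linarith
    have "c k - a k = l k / (t + l k) * c k" using tl unfolding a_def by (simp add: field_simps)
    have *: "(1 + l k) * (a k)\<^sup>2 - (a k)\<^sup>2 + t * (c k - a k)\<^sup>2
      = l k * (t / (t + l k) * c k)\<^sup>2 + t * (l k / (t + l k) * c k)\<^sup>2"
      unfolding \<open>c k - a k = _\<close> by (simp add: a_def algebra_simps)
    also have "\<dots> = (l k * t\<^sup>2 + t * (l k)\<^sup>2) / (t + l k)\<^sup>2 * (c k)\<^sup>2"
      by (simp add: power_mult_distrib power_divide add_divide_distrib algebra_simps)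
    also have "(l k * t\<^sup>2 + t * (l k)\<^sup>2) = t * l k * (t + l k)" by (simp add: power2_eq_square algebra_simps)
    finally show ?thesis using tl by (simp add: power2_eq_square)
  qed
  have "(norm v)\<^sup>2 - (norm (P v))\<^sup>2 + t * (norm (u - P v))\<^sup>2
    = (\<Sum>k<m. (1 + l k) * (a k)\<^sup>2 - (a k)\<^sup>2 + t * (c k - a k)\<^sup>2) + t * (norm (u - p m))\<^sup>2"
    unfolding nv nPv nu by (simp add: sum.distrib sum_subtractf sum_distrib_left algebra_simps)
  also have "\<dots> \<le> (\<Sum>k<m. t * l k / (t + l k) * (c k)\<^sup>2) + d" unfolding alg using m by simp
  finally show ?thesis using vS unfolding c_def e_def by blast
qed

section \<open>The Hilbert space of square integrable functions\<close>

definition square_integrable :: "('a::euclidean_space \<Rightarrow> 'b::euclidean_space) \<Rightarrow> bool" where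
  "square_integrable f \<longleftrightarrow> f \<in> borel_measurable lborel \<and> integrable lborel (\<lambda>x. (norm (f x))\<^sup>2)"


lemma square_integrable_iff_nn_integral:
  "square_integrable f \<longleftrightarrow> f \<in> borel_measurable lborel \<and> (\<integral>\<^sup>+x. ennreal ((norm (f x))\<^sup>2) \<partial>lborel) < \<infinity>"
  unfolding square_integrable_def
  by (auto intro!: integrableI_bounded simp: integrable_iff_bounded)

lemma integrable_mult_square:
  fixes f :: "'a::euclidean_space \<Rightarrow> 'b::euclidean_space" and g :: "'a \<Rightarrow> 'c::euclidean_space"
  assumes "square_integrable f" "square_integrable g"
  shows "integrable lborel (\<lambda>x. norm (f x) * norm (g x))"
proof (rule Bochner_Integration.integrable_bound[of _ "\<lambda>x. (norm (f x))\<^sup>2 + (norm (g x))\<^sup>2"])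
  have [measurable]: "f \<in> borel_measurable lborel" "g \<in> borel_measurable lborel"
    using assms by (auto simp: square_integrable_def)
  show "integrable lborel (\<lambda>x. (norm (f x))\<^sup>2 + (norm (g x))\<^sup>2)" using assms by (simp add: square_integrable_def)
  show "(\<lambda>x. norm (f x) * norm (g x)) \<in> borel_measurable lborel" by measurable
  have "norm (norm (f x) * norm (g x)) \<le> norm ((norm (f x))\<^sup>2 + (norm (g x))\<^sup>2)" for x
  proof -
    have "p * q \<le> p\<^sup>2 + q\<^sup>2" if "p \<ge> 0" "q \<ge> 0" for p q :: real
      using sum_squares_bound[of p q] mult_nonneg_nonneg[OF that] by linarith
    then show ?thesis by simp
  qed
  then show "AE x in lborel. norm (norm (f x) * norm (g x)) \<le> norm ((norm (f x))\<^sup>2 + (norm (g x))\<^sup>2)" by simp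
qed

lemma integrable_inner_square:
  assumes "square_integrable f" "square_integrable g"
  shows "integrable lborel (\<lambda>x. f x \<bullet> g x)"
proof -
  have [measurable]: "f \<in> borel_measurable lborel" "g \<in> borel_measurable lborel"
    using assms by (auto simp: square_integrable_def)
  show ?thesis
    by (rule Bochner_Integration.integrable_bound[OF integrable_mult_square[OF assms]])
       (auto simp: abs_mult Cauchy_Schwarz_ineq2)
qed

lemma square_integrable_add:
  assumes "square_integrable f" "square_integrable g"
  shows "square_integrable (\<lambda>x. f x + g x)"
proof -
  have [measurable]: "f \<in> borel_measurable lborel" "g \<in> borel_measurable lborel"
    using assms by (auto simp: square_integrable_def)
  have "integrable lborel (\<lambda>x. (norm (f x))\<^sup>2 + (norm (g x))\<^sup>2 + 2 * (f x \<bullet> g x))"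
    using assms integrable_inner_square[OF assms] by (simp add: square_integrable_def)
  also have "(\<lambda>x. (norm (f x))\<^sup>2 + (norm (g x))\<^sup>2 + 2 * (f x \<bullet> g x)) = (\<lambda>x. (norm (f x + g x))\<^sup>2)"
    by (simp add: power2_norm_eq_inner inner_add inner_commute algebra_simps)
  finally show ?thesis by (simp add: square_integrable_def)
qed

lemma square_integrable_scaleR: "square_integrable f \<Longrightarrow> square_integrable (\<lambda>x. c *\<^sub>R f x)"
  by (auto simp: square_integrable_def power_mult_distrib)

lemma square_integrable_minus: "square_integrable f \<Longrightarrow> square_integrable (\<lambda>x. - f x)"
  by (auto simp: square_integrable_def)

lemma square_integrable_diff:
  "square_integrable f \<Longrightarrow> square_integrable g \<Longrightarrow> square_integrable (\<lambda>x. f x - g x)"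
  using square_integrable_add[of f "\<lambda>x. - g x"] square_integrable_minus[of g] by simp

lemma square_integrable_zero: "square_integrable (\<lambda>x. 0)"
  by (simp add: square_integrable_def)

\<comment> \<open>Values range over any Euclidean space: \<open>complex\<close> for functions,
  \<open>'a \<times> 'a\<close> for gradients. The result is a real Hilbert space in which complex
  functions carry the scalar product Re (u, v). The quotient is partial because square integrability
  is part of the relation.\<close>
quotient_type (overloaded) ('a, 'b) L2 = "'a::euclidean_space \<Rightarrow> 'b::euclidean_space" / partial:
  "\<lambda>f g. square_integrable f \<and> square_integrable g \<and> (AE x in lborel. f x = g x)"
  morphisms rep_L2 L2
proof (rule part_equivpI)
  show "\<exists>x :: 'a \<Rightarrow> 'b. square_integrable x \<and> square_integrable x \<and> (AE xa in lborel. x xa = x xa)"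
    using square_integrable_zero by auto
  show "symp (\<lambda>f g :: 'a \<Rightarrow> 'b. square_integrable f \<and> square_integrable g \<and> (AE x in lborel. f x = g x))"
    by (auto simp: symp_def eq_commute)
  show "transp (\<lambda>f g :: 'a \<Rightarrow> 'b. square_integrable f \<and> square_integrable g \<and> (AE x in lborel. f x = g x))"
    unfolding transp_def by (auto elim: AE_mp)
qed

instantiation L2 :: (euclidean_space, euclidean_space) real_vector
begin

lift_definition zero_L2 :: "('a, 'b) L2" is "\<lambda>x. 0" by (simp add: square_integrable_zero)
lift_definition plus_L2 :: "('a, 'b) L2 \<Rightarrow> ('a, 'b) L2 \<Rightarrow> ('a, 'b) L2" is "\<lambda>f g x. f x + g x"
  by (auto intro: square_integrable_add elim!: AE_mp)
lift_definition minus_L2 :: "('a, 'b) L2 \<Rightarrow> ('a, 'b) L2 \<Rightarrow> ('a, 'b) L2" is "\<lambda>f g x. f x - g x"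
  by (auto intro: square_integrable_diff elim!: AE_mp)
lift_definition uminus_L2 :: "('a, 'b) L2 \<Rightarrow> ('a, 'b) L2" is "\<lambda>f x. - f x"
  by (auto intro: square_integrable_minus elim!: AE_mp)
lift_definition scaleR_L2 :: "real \<Rightarrow> ('a, 'b) L2 \<Rightarrow> ('a, 'b) L2" is "\<lambda>c f x. c *\<^sub>R f x"
  by (auto intro: square_integrable_scaleR elim!: AE_mp)
instance
proof
  fix a b c :: "('a, 'b) L2" and r s :: real
  show "a + b + c = a + (b + c)"
    by transfer (simp add: add.assoc square_integrable_add)
  show "a + b = b + a" by transfer (simp add: add.commute square_integrable_add)
  show "0 + a = a" by transfer simp
  show "- a + a = 0" by transfer (simp add: square_integrable_zero)
  show "a - b = a + - b" by transfer (simp add: square_integrable_diff)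
  show "r *\<^sub>R (a + b) = r *\<^sub>R a + r *\<^sub>R b"
    by transfer (use square_integrable_scaleR square_integrable_add in \<open>fastforce simp: scaleR_add_right\<close>)
  show "(r + s) *\<^sub>R a = r *\<^sub>R a + s *\<^sub>R a"
    by transfer (use square_integrable_scaleR square_integrable_add in \<open>fastforce simp: scaleR_add_left\<close>)
  show "r *\<^sub>R s *\<^sub>R a = (r * s) *\<^sub>R a"
    by transfer (simp add: square_integrable_scaleR)
  show "1 *\<^sub>R a = a" by transfer simp
qed

end

instantiation L2 :: (euclidean_space, euclidean_space) real_inner
begin

lift_definition inner_L2 :: "('a, 'b) L2 \<Rightarrow> ('a, 'b) L2 \<Rightarrow> real" is "\<lambda>f g. \<integral>x. f x \<bullet> g x \<partial>lborel"
proof -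
  fix f f' g g' :: "'a \<Rightarrow> 'b"
  assume *: "square_integrable f \<and> square_integrable f' \<and> (AE x in lborel. f x = f' x)"
    "square_integrable g \<and> square_integrable g' \<and> (AE x in lborel. g x = g' x)"
  then have [measurable]: "f \<in> borel_measurable lborel" "g \<in> borel_measurable lborel"
    "f' \<in> borel_measurable lborel" "g' \<in> borel_measurable lborel"
    by (auto simp: square_integrable_def)
  show "(\<integral>x. f x \<bullet> g x \<partial>lborel) = (\<integral>x. f' x \<bullet> g' x \<partial>lborel)"
    using * by (intro integral_cong_AE) (auto elim!: AE_mp)
qed

definition norm_L2 :: "('a, 'b) L2 \<Rightarrow> real" where "norm_L2 x = sqrt (x \<bullet> x)"
definition sgn_L2 :: "('a, 'b) L2 \<Rightarrow> ('a, 'b) L2" where "sgn_L2 x = inverse (norm x) *\<^sub>R x"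
definition dist_L2 :: "('a, 'b) L2 \<Rightarrow> ('a, 'b) L2 \<Rightarrow> real" where "dist_L2 x y = norm (x - y)"
definition uniformity_L2 :: "(('a, 'b) L2 \<times> ('a, 'b) L2) filter"
  where "uniformity_L2 = (INF e\<in>{0 <..}. principal {(x, y). dist x y < e})"
definition open_L2 :: "('a, 'b) L2 set \<Rightarrow> bool"
  where "open_L2 U \<longleftrightarrow> (\<forall>x\<in>U. eventually (\<lambda>(x', y). x' = x \<longrightarrow> y \<in> U) uniformity)"

instance
proof
  fix a b c :: "('a, 'b) L2" and r s :: real
  show "dist a b = norm (a - b)" by (simp add: dist_L2_def)
  show "sgn a = a /\<^sub>R norm a" by (simp add: sgn_L2_def)
  show "(uniformity :: (('a, 'b) L2 \<times> ('a, 'b) L2) filter) = (INF e\<in>{0 <..}. principal {(x, y). dist x y < e})"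
    by (rule uniformity_L2_def)
  show "open U \<longleftrightarrow> (\<forall>x\<in>U. \<forall>\<^sub>F (x', y) in uniformity. x' = x \<longrightarrow> y \<in> U)" for U :: "('a, 'b) L2 set"
    by (rule open_L2_def)
  show "norm a = sqrt (a \<bullet> a)" by (simp add: norm_L2_def)
  show "a \<bullet> b = b \<bullet> a" by transfer (simp add: inner_commute)
  show "(a + b) \<bullet> c = a \<bullet> c + b \<bullet> c"
    by transfer (simp add: inner_add_left integrable_inner_square)
  show "r *\<^sub>R a \<bullet> b = r * (a \<bullet> b)" by transfer simp
  show "0 \<le> a \<bullet> a" by transfer simp
  show "a \<bullet> a = 0 \<longleftrightarrow> a = 0"
  proof transfer
    fix f :: "'a \<Rightarrow> 'b" assume f: "square_integrable f \<and> square_integrable f \<and> (AE x in lborel. f x = f x)"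
    have "((\<integral>x. f x \<bullet> f x \<partial>lborel) = 0) = (AE x in lborel. f x \<bullet> f x = 0)"
      using f by (intro integral_nonneg_eq_0_iff_AE) (auto intro: integrable_inner_square)
    then show "((\<integral>x. f x \<bullet> f x \<partial>lborel) = 0) = (square_integrable f \<and> square_integrable (\<lambda>x. 0::'b) \<and> (AE x in lborel. f x = 0))"
      using f by (simp add: square_integrable_zero)
  qed
qed

end

lemma L2_eq_iff:
  "square_integrable f \<Longrightarrow> square_integrable g \<Longrightarrow> L2 f = L2 g \<longleftrightarrow> (AE x in lborel. f x = g x)"
  using Quotient_rel[OF Quotient_L2, of f g] by auto

lemma L2_cases:
  obtains f where "square_integrable f" "x = L2 f"
  using Quotient_abs_rep[OF Quotient_L2, of x] Quotient_rep_reflp[OF Quotient_L2, of x] by metis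

lemma L2_plus: "square_integrable f \<Longrightarrow> square_integrable g \<Longrightarrow> L2 f + L2 g = L2 (\<lambda>x. f x + g x)"
  by (rule plus_L2.abs_eq) (auto simp: eq_onp_def)

lemma L2_minus: "square_integrable f \<Longrightarrow> square_integrable g \<Longrightarrow> L2 f - L2 g = L2 (\<lambda>x. f x - g x)"
  by (rule minus_L2.abs_eq) (auto simp: eq_onp_def)

lemma L2_scaleR: "square_integrable f \<Longrightarrow> c *\<^sub>R L2 f = L2 (\<lambda>x. c *\<^sub>R f x)"
  by (rule scaleR_L2.abs_eq) (auto simp: eq_onp_def)

lemma L2_zero: "0 = L2 (\<lambda>x. 0)"
  by (rule zero_L2.abs_eq)

lemma L2_inner_eq: "square_integrable f \<Longrightarrow> square_integrable g \<Longrightarrow> L2 f \<bullet> L2 g = (\<integral>x. f x \<bullet> g x \<partial>lborel)"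
  by (rule inner_L2.abs_eq) (auto simp: eq_onp_def)

lemma norm_L2_square: "square_integrable f \<Longrightarrow> (norm (L2 f))\<^sup>2 = (\<integral>x. (norm (f x))\<^sup>2 \<partial>lborel)"
  unfolding power2_norm_eq_inner by (rule L2_inner_eq)

lemma ennreal_norm_L2_square:
  "square_integrable f \<Longrightarrow> ennreal ((norm (L2 f))\<^sup>2) = (\<integral>\<^sup>+x. ennreal ((norm (f x))\<^sup>2) \<partial>lborel)"
  unfolding norm_L2_square by (subst nn_integral_eq_integral) (auto simp: square_integrable_def)

lemma ennreal_dist_L2_square:
  "square_integrable f \<Longrightarrow> square_integrable g \<Longrightarrow>
    ennreal ((dist (L2 f) (L2 g))\<^sup>2) = (\<integral>\<^sup>+x. ennreal ((norm (f x - g x))\<^sup>2) \<partial>lborel)"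
  by (simp add: dist_norm L2_minus ennreal_norm_L2_square square_integrable_diff)

text \<open>Riesz-Fischer: a rapidly convergent subsequence converges almost everywhere, and Fatou's
  lemma shows that its pointwise limit is also the limit in norm.\<close>

instance L2 :: (euclidean_space, euclidean_space) complete_space
proof
  fix X :: "nat \<Rightarrow> ('a, 'b) L2" assume X: "Cauchy X"
  have "\<exists>M. \<forall>m\<ge>M. \<forall>n\<ge>M. dist (X m) (X n) < (1/2)^k" for k
    by (rule metric_CauchyD[OF X]) simp
  then obtain M where M: "\<And>k m n. M k \<le> m \<Longrightarrow> M k \<le> n \<Longrightarrow> dist (X m) (X n) < (1/2)^k" by metis
  \<comment> \<open>Summing the thresholds makes r strictly increasing while r j is still at least M
    k for every k \<le> j.\<close>
  define r where "r k = k + (\<Sum>i\<le>k. M i)" for k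
  have r: "strict_mono r" unfolding r_def by (rule strict_mono_Suc_iff[THEN iffD2]) simp
  have rM: "M k \<le> r j" if "k \<le> j" for k j
  proof -
    have "M k \<le> (\<Sum>i\<le>j. M i)" using that by (intro member_le_sum) auto
    then show ?thesis by (simp add: r_def)
  qed
  have "\<exists>f. square_integrable f \<and> X (r k) = L2 f" for k by (rule L2_cases[of "X (r k)"]) auto
  then obtain f where f: "\<And>k. square_integrable (f k)" "\<And>k. X (r k) = L2 (f k)" by metis
  have [measurable]: "f k \<in> borel_measurable lborel" for k using f(1)[of k] by (simp add: square_integrable_def)
  have bd: "(\<integral>\<^sup>+x. ennreal ((norm (f i x - f j x))\<^sup>2) \<partial>lborel) \<le> ennreal ((1/4)^k)" if "k \<le> i" "k \<le> j" for i j k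
  proof -
    have "dist (L2 (f i)) (L2 (f j)) < (1/2)^k" using M[OF rM[OF that(1)] rM[OF that(2)]] f(2) by simp
    then have "(dist (L2 (f i)) (L2 (f j)))\<^sup>2 \<le> ((1/2)^k)\<^sup>2" by (intro power_mono) auto
    also have "((1/2)^k)\<^sup>2 = ((1/4)^k :: real)"
      by (simp add: power2_eq_square flip: power_mult_distrib)
    finally show ?thesis using f(1) by (simp add: ennreal_dist_L2_square[symmetric] ennreal_leI)
  qed
  \<comment> \<open>Against the bound 4^(-k) the weight 2^k still leaves a convergent series; it
    forces the increments at almost every x to be of order 2^(-k/2), hence summable.\<close>
  have "(\<integral>\<^sup>+x. (\<Sum>k. ennreal (2^k * (norm (f (Suc k) x - f k x))\<^sup>2)) \<partial>lborel)
      = (\<Sum>k. \<integral>\<^sup>+x. ennreal (2^k * (norm (f (Suc k) x - f k x))\<^sup>2) \<partial>lborel)"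
    by (rule nn_integral_suminf) simp
  also have "\<dots> \<le> (\<Sum>k. ennreal ((1/2)^k))"
  proof (intro suminf_le)
    fix k
    have "(\<integral>\<^sup>+x. ennreal (2^k * (norm (f (Suc k) x - f k x))\<^sup>2) \<partial>lborel)
       = ennreal (2^k) * (\<integral>\<^sup>+x. ennreal ((norm (f (Suc k) x - f k x))\<^sup>2) \<partial>lborel)"
      by (simp add: ennreal_mult nn_integral_cmult)
    also have "\<dots> \<le> ennreal (2^k) * ennreal ((1/4)^k)" by (intro mult_left_mono bd) auto
    also have "\<dots> = ennreal ((1/2)^k)"
      by (simp add: ennreal_mult[symmetric] power_mult_distrib[symmetric])
    finally show "(\<integral>\<^sup>+x. ennreal (2^k * (norm (f (Suc k) x - f k x))\<^sup>2) \<partial>lborel) \<le> ennreal ((1/2)^k)" .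
  qed auto
  also have "\<dots> < \<infinity>"
    by (subst suminf_ennreal2) auto
  finally have "AE x in lborel. (\<Sum>k. ennreal (2^k * (norm (f (Suc k) x - f k x))\<^sup>2)) \<noteq> \<infinity>"
    by (intro nn_integral_PInf_AE) auto
  then have conv: "AE x in lborel. convergent (\<lambda>k. f k x)"
  proof eventually_elim
    case (elim x)
    then have s: "summable (\<lambda>k. 2^k * (norm (f (Suc k) x - f k x))\<^sup>2)"
      by (intro summable_suminf_not_top) auto
    then have "Bseq (\<lambda>k. 2^k * (norm (f (Suc k) x - f k x))\<^sup>2)"
      by (intro convergent_imp_Bseq) (auto dest: summable_LIMSEQ_zero simp: convergent_def)
    then obtain C where C: "C > 0" "\<And>k. 2^k * (norm (f (Suc k) x - f k x))\<^sup>2 \<le> C"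
      unfolding Bseq_def by (auto simp: abs_mult)
    have le: "norm (f (Suc k) x - f k x) \<le> sqrt C * (1 / sqrt 2)^k" for k
    proof -
      have "(norm (f (Suc k) x - f k x))\<^sup>2 \<le> C / 2^k" using C(2)[of k] by (simp add: field_simps)
      then have "norm (f (Suc k) x - f k x) \<le> sqrt (C / 2^k)" by (simp add: real_le_rsqrt)
      then show ?thesis by (simp add: real_sqrt_divide real_sqrt_power power_divide)
    qed
    have "summable (\<lambda>k. sqrt C * (1 / sqrt 2)^k)" by (intro summable_mult summable_geometric) auto
    then have "summable (\<lambda>k. f (Suc k) x - f k x)"
      by (rule summable_comparison_test'[where N=0]) (simp add: le)
    then have "convergent (\<lambda>n. \<Sum>k<n. f (Suc k) x - f k x)" by (simp add: summable_iff_convergent)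
    then have "convergent (\<lambda>n. f n x - f 0 x)" by (simp only: sum_lessThan_telescope[of "\<lambda>k. f k x"])
    then have "convergent (\<lambda>n. (f n x - f 0 x) + f 0 x)" by (intro convergent_add convergent_const)
    then show ?case by simp
  qed
  define g where "g x = lim (\<lambda>k. f k x)" for x
  have [measurable]: "g \<in> borel_measurable lborel" unfolding g_def by measurable
  have fg: "AE x in lborel. (\<lambda>k. f k x) \<longlonglongrightarrow> g x"
    using conv unfolding g_def by eventually_elim (simp add: convergent_LIMSEQ_iff)
  have lim: "(\<integral>\<^sup>+x. ennreal ((norm (f k x - g x))\<^sup>2) \<partial>lborel) \<le> ennreal ((1/4)^k)" for k
  proof -
    have "(\<integral>\<^sup>+x. ennreal ((norm (f k x - g x))\<^sup>2) \<partial>lborel)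
       = (\<integral>\<^sup>+x. liminf (\<lambda>j. ennreal ((norm (f k x - f j x))\<^sup>2)) \<partial>lborel)"
      using fg by (intro nn_integral_cong_AE, eventually_elim)
        (intro lim_imp_Liminf[symmetric] tendsto_intros, auto)
    also have "\<dots> \<le> liminf (\<lambda>j. \<integral>\<^sup>+x. ennreal ((norm (f k x - f j x))\<^sup>2) \<partial>lborel)"
      by (rule nn_integral_liminf) measurable
    also have "\<dots> \<le> ennreal ((1/4)^k)"
      by (rule order_trans[OF Liminf_le_Limsup Limsup_bounded], simp,
          rule eventually_mono[OF eventually_ge_at_top[of k]]) (simp add: bd)
    finally show ?thesis .
  qed
  have sd: "square_integrable (\<lambda>x. f 0 x - g x)"
    unfolding square_integrable_iff_nn_integral using lim[of 0] by (auto intro: le_less_trans)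
  have g: "square_integrable g"
    using square_integrable_diff[OF f(1)[of 0] sd] by simp
  have "(\<lambda>k. dist (X (r k)) (L2 g)) \<longlonglongrightarrow> 0"
  proof (rule Lim_null_comparison)
    show "(\<lambda>k. (1/2)^k) \<longlonglongrightarrow> (0::real)" by (rule LIMSEQ_power_zero) simp
    have "dist (X (r k)) (L2 g) \<le> (1/2)^k" for k
    proof (rule power2_le_imp_le)
      have "ennreal ((dist (X (r k)) (L2 g))\<^sup>2) \<le> ennreal ((1/4)^k)"
        using lim[of k] by (simp add: f(2) ennreal_dist_L2_square[OF f(1) g])
      then show "(dist (X (r k)) (L2 g))\<^sup>2 \<le> ((1/2)^k)\<^sup>2"
        by (simp add: power2_eq_square flip: power_mult_distrib)
    qed simp
    then show "\<forall>\<^sub>F k in sequentially. norm (dist (X (r k)) (L2 g)) \<le> (1/2)^k" by simp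
  qed
  then have "(X \<circ> r) \<longlonglongrightarrow> L2 g" unfolding tendsto_dist_iff[of "X \<circ> r"] by (simp add: o_def)
  then have "X \<longlonglongrightarrow> L2 g" using Cauchy_converges_subseq[OF X r] by blast
  then show "convergent X" by (auto simp: convergent_def)
qed

lemma L2_tendsto_iff:
  fixes f :: "nat \<Rightarrow> 'a::euclidean_space \<Rightarrow> complex"
  assumes "\<And>k. square_integrable (f k)" "square_integrable u"
  shows "L2_tendsto f u \<longleftrightarrow> (\<lambda>k. L2 (f k)) \<longlonglongrightarrow> L2 u"
proof -
  have "L2_tendsto f u \<longleftrightarrow> (\<lambda>k. ennreal ((dist (L2 (f k)) (L2 u))\<^sup>2)) \<longlonglongrightarrow> ennreal 0"
    unfolding L2_tendsto_def by (simp add: ennreal_dist_L2_square[OF assms(1,2)])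
  also have "\<dots> \<longleftrightarrow> (\<lambda>k. (dist (L2 (f k)) (L2 u))\<^sup>2) \<longlonglongrightarrow> 0"
    by (rule tendsto_ennreal_iff) simp_all
  also have "\<dots> \<longleftrightarrow> (\<lambda>k. dist (L2 (f k)) (L2 u)) \<longlonglongrightarrow> 0"
    by simp
  finally show ?thesis unfolding tendsto_dist_iff[of "\<lambda>k. L2 (f k)"] .
qed

lemma L2_tendsto_square_integrable:
  fixes f :: "nat \<Rightarrow> 'a::euclidean_space \<Rightarrow> complex"
  assumes f: "\<And>k. square_integrable (f k)" and u: "u \<in> borel_measurable lborel" and lim: "L2_tendsto f u"
  shows "square_integrable u"
proof -
  have "\<forall>\<^sub>F k in sequentially. (\<integral>\<^sup>+x. ennreal ((cmod (f k x - u x))\<^sup>2) \<partial>lborel) < 1"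
    using lim unfolding L2_tendsto_def by (rule order_tendstoD(2)) simp
  then obtain k where k: "(\<integral>\<^sup>+x. ennreal ((cmod (f k x - u x))\<^sup>2) \<partial>lborel) < 1"
    by (auto simp: eventually_sequentially)
  have "f k \<in> borel_measurable lborel" using f[of k] by (simp add: square_integrable_def)
  then have "square_integrable (\<lambda>x. f k x - u x)"
    unfolding square_integrable_iff_nn_integral using u less_trans[OF k, of \<infinity>] by auto
  from square_integrable_diff[OF f this, of k] show ?thesis by simp
qed

text \<open>Models L2(A) inside L2 of the whole space, through extension by zero.\<close>

definition zero_outside :: "'a set \<Rightarrow> ('a::euclidean_space, 'b::euclidean_space) L2 set" where
  "zero_outside A = {x. \<exists>f. square_integrable f \<and> x = L2 f \<and> (AE y in lborel. y \<notin> A \<longrightarrow> f y = 0)}"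

lemma L2_mem_zero_outside:
  assumes "square_integrable f"
  shows "L2 f \<in> zero_outside A \<longleftrightarrow> (AE y in lborel. y \<notin> A \<longrightarrow> f y = 0)"
  unfolding zero_outside_def using assms by (auto simp: L2_eq_iff elim!: AE_mp)

lemma subspace_zero_outside: "subspace (zero_outside A)"
  unfolding subspace_def
proof (intro conjI ballI allI)
  show "0 \<in> zero_outside A"
    by (simp add: L2_zero L2_mem_zero_outside square_integrable_zero)
next
  fix x y :: "('a, 'b) L2" assume "x \<in> zero_outside A" "y \<in> zero_outside A"
  moreover obtain f where "square_integrable f" "x = L2 f" by (rule L2_cases)
  moreover obtain g where "square_integrable g" "y = L2 g" by (rule L2_cases)
  ultimately show "x + y \<in> zero_outside A"
    by (auto simp: L2_plus L2_mem_zero_outside square_integrable_add elim!: AE_mp)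
next
  fix x :: "('a, 'b) L2" and c assume "x \<in> zero_outside A"
  moreover obtain f where "square_integrable f" "x = L2 f" by (rule L2_cases)
  ultimately show "c *\<^sub>R x \<in> zero_outside A"
    by (auto simp: L2_scaleR L2_mem_zero_outside square_integrable_scaleR elim!: AE_mp)
qed

text \<open>\<open>zero_outside A\<close> is the orthogonal complement of the functions supported in \<open>- A\<close>.\<close>

lemma closed_zero_outside:
  fixes A :: "'a::euclidean_space set"
  assumes A[measurable]: "A \<in> sets borel"
  shows "closed (zero_outside A :: ('a, 'b::euclidean_space) L2 set)"
proof -
  have si: "square_integrable (\<lambda>x. indicator (- A) x *\<^sub>R f x)" if "square_integrable f" for f :: "'a \<Rightarrow> 'b"
  proof -
    have [measurable]: "f \<in> borel_measurable lborel" using that by (simp add: square_integrable_def)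
    have "integrable lborel (\<lambda>x. (norm (indicator (- A) x *\<^sub>R f x))\<^sup>2)"
      by (rule Bochner_Integration.integrable_bound[of _ "\<lambda>x. (norm (f x))\<^sup>2"])
         (use that in \<open>auto simp: square_integrable_def indicator_def\<close>)
    then show ?thesis by (simp add: square_integrable_def)
  qed
  have "(zero_outside A :: ('a, 'b) L2 set)
      = (\<Inter>f\<in>{f. square_integrable f}. {x. x \<bullet> L2 (\<lambda>y. indicator (- A) y *\<^sub>R f y) = 0})"
  proof (intro equalityI subsetI)
    fix x :: "('a, 'b) L2" assume x: "x \<in> zero_outside A"
    obtain g where g: "square_integrable g" "x = L2 g" by (rule L2_cases)
    have ae: "AE y in lborel. y \<notin> A \<longrightarrow> g y = 0" using x g by (simp add: L2_mem_zero_outside)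
    show "x \<in> (\<Inter>f\<in>{f. square_integrable f}. {x. x \<bullet> L2 (\<lambda>y. indicator (- A) y *\<^sub>R f y) = 0})"
    proof safe
      fix f :: "'a \<Rightarrow> 'b" assume f: "square_integrable f"
      have [measurable]: "f \<in> borel_measurable lborel" "g \<in> borel_measurable lborel"
        using f g by (auto simp: square_integrable_def)
      have "(\<integral>y. g y \<bullet> (indicator (- A) y *\<^sub>R f y) \<partial>lborel) = 0"
        by (rule integral_eq_zero_AE) (use ae in \<open>auto simp: indicator_def elim!: AE_mp\<close>)
      then show "x \<bullet> L2 (\<lambda>y. indicator (- A) y *\<^sub>R f y) = 0"
        using f g by (simp add: L2_inner_eq si)
    qed
  next
    fix x :: "('a, 'b) L2"
    assume x: "x \<in> (\<Inter>f\<in>{f. square_integrable f}. {x. x \<bullet> L2 (\<lambda>y. indicator (- A) y *\<^sub>R f y) = 0})"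
    obtain g where g: "square_integrable g" "x = L2 g" by (rule L2_cases)
    have [measurable]: "g \<in> borel_measurable lborel" using g by (auto simp: square_integrable_def)
    have "(\<integral>y. g y \<bullet> (indicator (- A) y *\<^sub>R g y) \<partial>lborel) = 0"
      using x g by (auto simp: L2_inner_eq si)
    then have "AE y in lborel. g y \<bullet> (indicator (- A) y *\<^sub>R g y) = 0"
      by (subst (asm) integral_nonneg_eq_0_iff_AE[OF integrable_inner_square[OF g(1) si[OF g(1)]]])
        (auto simp: indicator_def)
    then show "x \<in> zero_outside A"
      using g by (auto simp: L2_mem_zero_outside indicator_def elim!: AE_mp)
  qed
  also have "closed \<dots>"
    by (intro closed_INT ballI closed_Collect_eq) (auto intro!: continuous_intros)
  finally show ?thesis .
qed

section \<open>Translation invariance of Lebesgue integrals\<close>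

lemma lborel_distr_translation: "distr lborel borel (\<lambda>x. t + x) = (lborel :: 'a::euclidean_space measure)"
  using lborel_affine[of 1 t] by (simp add: density_1)

lemma nn_integral_translation:
  fixes f :: "'a::euclidean_space \<Rightarrow> ennreal"
  assumes "f \<in> borel_measurable borel"
  shows "(\<integral>\<^sup>+x. f (x + t) \<partial>lborel) = (\<integral>\<^sup>+x. f x \<partial>lborel)"
  by (subst (2) lborel_distr_translation[of t, symmetric], subst nn_integral_distr)
     (use assms in \<open>auto simp: add.commute\<close>)

lemma integral_translation:
  fixes f :: "'a::euclidean_space \<Rightarrow> 'b::{banach, second_countable_topology}"
  assumes "f \<in> borel_measurable borel"
  shows "(\<integral>x. f (x + t) \<partial>lborel) = (\<integral>x. f x \<partial>lborel)"
  by (subst (2) lborel_distr_translation[of t, symmetric], subst integral_distr)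
     (use assms in \<open>auto simp: add.commute\<close>)

lemma integrable_translation:
  fixes f :: "'a::euclidean_space \<Rightarrow> 'b::{banach, second_countable_topology}"
  assumes "integrable lborel f"
  shows "integrable lborel (\<lambda>x. f (x + t))"
proof -
  have "f \<in> borel_measurable borel" using assms by auto
  moreover have "integrable (distr lborel borel (\<lambda>x. t + x)) f" using assms by (simp add: lborel_distr_translation)
  ultimately show ?thesis by (subst (asm) integrable_distr_eq) (auto simp: add.commute)
qed

section \<open>Continuous functions with bounded support\<close>

lemma bounded_subset_ball_radius:
  assumes "bounded S"
  obtains R where "R > 0" "S \<subseteq> ball (0::'a::euclidean_space) R"
  using bounded_subset_ballD[OF assms, of 0] by auto

lemma integrable_bounded_support:
  fixes f :: "'a::euclidean_space \<Rightarrow> 'b::euclidean_space"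
  assumes f: "f \<in> borel_measurable lborel" and S: "bounded {x. f x \<noteq> 0}" and B: "\<And>x. norm (f x) \<le> B"
  shows "integrable lborel f"
proof -
  obtain R where R: "{x. f x \<noteq> 0} \<subseteq> ball 0 R" using bounded_subset_ball_radius[OF S] by metis
  show ?thesis
  proof (rule Bochner_Integration.integrable_bound)
    show "integrable lborel (\<lambda>x. B * indicator (ball 0 R) x :: real)"
      by (auto intro!: integrable_mult_right emeasure_lborel_ball_finite)
    show "AE x in lborel. norm (f x) \<le> norm (B * indicator (ball 0 R) x :: real)"
    proof (rule AE_I2)
      fix x show "norm (f x) \<le> norm (B * indicator (ball 0 R) x :: real)"
      proof (cases "f x = 0")
        case False
        then have "x \<in> ball 0 R" using R by auto
        then show ?thesis using B[of x] by (simp add: indicator_def)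
      qed simp
    qed
  qed (use f in auto)
qed

lemma continuous_bounded_support_bound:
  fixes f :: "'a::euclidean_space \<Rightarrow> 'b::euclidean_space"
  assumes f: "continuous_on UNIV f" and S: "bounded {x. f x \<noteq> 0}"
  obtains B where "B > 0" "\<And>x. norm (f x) \<le> B"
proof -
  have "compact (closure {x. f x \<noteq> 0})" using S by (simp add: compact_closure)
  then have "compact (f ` closure {x. f x \<noteq> 0})" using f continuous_on_subset by (intro compact_continuous_image) blast+
  then obtain B where B: "B > 0" "\<And>y. y \<in> f ` closure {x. f x \<noteq> 0} \<Longrightarrow> norm y \<le> B"
    using compact_imp_bounded bounded_pos by metis
  have "norm (f x) \<le> B" for x
  proof (cases "f x = 0")
    case False then show ?thesis using B(2) closure_subset[of "{x. f x \<noteq> 0}"] by blast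
  qed (use B in simp)
  then show ?thesis using that B by blast
qed

lemma
  fixes f :: "'a::euclidean_space \<Rightarrow> 'b::euclidean_space"
  assumes f: "continuous_on UNIV f" and S: "bounded {x. f x \<noteq> 0}"
  shows integrable_continuous_bounded_support: "integrable lborel f"
    and square_integrable_continuous_bounded_support: "square_integrable f"
proof -
  obtain B where B: "B > 0" "\<And>x. norm (f x) \<le> B" using continuous_bounded_support_bound[OF f S] by metis
  have m: "f \<in> borel_measurable lborel" using borel_measurable_continuous_onI[OF f] by simp
  show "integrable lborel f" using m S B(2) by (rule integrable_bounded_support)
  have "integrable lborel (\<lambda>x. (norm (f x))\<^sup>2)"
  proof (rule integrable_bounded_support)
    show "norm ((norm (f x))\<^sup>2) \<le> B\<^sup>2" for x using B(2)[of x] by (simp add: power_mono)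
    show "bounded {x. (norm (f x))\<^sup>2 \<noteq> 0}" using S by simp
  qed (use m in simp)
  then show "square_integrable f" using m by (simp add: square_integrable_def)
qed

section \<open>Directional derivatives\<close>

lemma pderiv_dir_eqI: "(f has_derivative f') (at x) \<Longrightarrow> pderiv_dir b f x = f' b"
  using frechet_derivative_at[of f f' x] by simp

lemma has_derivative_pderiv_dir:
  assumes "f differentiable (at x)"
  shows "(f has_derivative (\<lambda>h. \<Sum>b\<in>Basis. (h \<bullet> b) *\<^sub>R pderiv_dir b f x)) (at x)"
proof -
  have D: "(f has_derivative frechet_derivative f (at x)) (at x)" using assms frechet_derivative_works by blast
  then interpret linear "frechet_derivative f (at x)" using has_derivative_linear by blast
  have "frechet_derivative f (at x) = (\<lambda>h. \<Sum>b\<in>Basis. (h \<bullet> b) *\<^sub>R pderiv_dir b f x)"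
  proof
    fix h
    have "frechet_derivative f (at x) h = frechet_derivative f (at x) (\<Sum>b\<in>Basis. (h \<bullet> b) *\<^sub>R b)"
      by (simp add: euclidean_representation)
    then show "frechet_derivative f (at x) h = (\<Sum>b\<in>Basis. (h \<bullet> b) *\<^sub>R pderiv_dir b f x)"
      by (simp add: sum scale)
  qed
  then show ?thesis using D by simp
qed

lemma pderiv_dir_add:
  "f differentiable (at x) \<Longrightarrow> g differentiable (at x) \<Longrightarrow>
    pderiv_dir b (\<lambda>x. f x + g x) x = pderiv_dir b f x + pderiv_dir b g x"
  by (rule pderiv_dir_eqI) (auto intro!: derivative_intros simp: frechet_derivative_works[symmetric])

lemma pderiv_dir_mult:
  "f differentiable (at x) \<Longrightarrow> g differentiable (at x) \<Longrightarrow>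
    pderiv_dir b (\<lambda>x. f x * g x) x = f x * pderiv_dir b g x + pderiv_dir b f x * g x"
  by (rule pderiv_dir_eqI) (rule has_derivative_mult; simp add: frechet_derivative_works[symmetric])

lemma pderiv_dir_cmult:
  "f differentiable (at x) \<Longrightarrow> pderiv_dir b (\<lambda>x. c * f x) x = c * pderiv_dir b f x"
  by (rule pderiv_dir_eqI) (rule has_derivative_mult_right; simp add: frechet_derivative_works[symmetric])

lemma pderiv_dir_const [simp]: "pderiv_dir b (\<lambda>x. c) x = 0"
  by (rule pderiv_dir_eqI) (rule has_derivative_const)

section \<open>Closure properties of the differentiability classes and of the test functions\<close>

lemma C_class_SucD: "C_class (Suc k) f \<Longrightarrow> C_class k f"
proof (induction k arbitrary: f)
  case 0
  then have "f differentiable (at x)" for x by simp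
  then show ?case by (auto simp: continuous_on_eq_continuous_at dest: differentiable_imp_continuous_within)
next
  case (Suc k)
  then show ?case by (subst C_class.simps) (auto simp del: C_class.simps simp: C_class.simps(2)[of "Suc k"])
qed

lemma C_class_const: "C_class k (\<lambda>x. c)"
  by (induction k arbitrary: c) simp_all

lemma C_class_add: "C_class k f \<Longrightarrow> C_class k g \<Longrightarrow> C_class k (\<lambda>x. f x + g x)"
proof (induction k arbitrary: f g)
  case (Suc k)
  then show ?case by (auto simp: pderiv_dir_add)
qed (auto intro: continuous_intros)

lemma C_class_mult: "C_class k f \<Longrightarrow> C_class k g \<Longrightarrow> C_class k (\<lambda>x. f x * g x)"
proof (induction k arbitrary: f g)
  case (Suc k)
  have "C_class k f" "C_class k g" using Suc.prems C_class_SucD by blast+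
  then show ?case using Suc by (auto simp: pderiv_dir_mult intro!: C_class_add)
qed (auto intro: continuous_intros)

lemma C_class_prod: "(\<And>i. i \<in> I \<Longrightarrow> C_class k (f i)) \<Longrightarrow> C_class k (\<lambda>x. \<Prod>i\<in>I. f i x)"
  by (induction I rule: infinite_finite_induct) (auto intro: C_class_mult C_class_const)

text \<open>The regularity that one integration by parts needs, and all that the cut-off in
  \<open>exists_C1_extension_of_exp\<close> has.\<close>

definition C1_functions :: "('a::euclidean_space \<Rightarrow> complex) set" where
  "C1_functions = {f. C_class 1 f \<and> bounded {x. f x \<noteq> 0}}"

lemma test_functions_C1: "f \<in> test_functions S \<Longrightarrow> f \<in> C1_functions"
  unfolding test_functions_def C1_functions_def
  using bounded_subset[OF compact_imp_bounded closure_subset] by blast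


lemma test_functions_cmult: "f \<in> test_functions S \<Longrightarrow> (\<lambda>x. c * f x) \<in> test_functions S"
  by (cases "c = 0") (auto simp: test_functions_def intro: C_class_mult C_class_const)

lemma test_functions_zero: "(\<lambda>x. 0) \<in> test_functions S"
  by (auto simp: test_functions_def intro: C_class_const)

lemma test_functions_add:
  assumes "f \<in> test_functions S" "g \<in> test_functions S"
  shows "(\<lambda>x. f x + g x) \<in> test_functions S"
proof -
  let ?T = "\<lambda>f :: 'a \<Rightarrow> complex. closure {x. f x \<noteq> 0}"
  have "?T (\<lambda>x. f x + g x) \<subseteq> closure ({x. f x \<noteq> 0} \<union> {x. g x \<noteq> 0})" by (intro closure_mono) auto
  then have sub: "?T (\<lambda>x. f x + g x) \<subseteq> ?T f \<union> ?T g" by (simp add: closure_Un)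
  have "compact (?T f \<union> ?T g)" using assms by (auto simp: test_functions_def)
  then have "compact ((?T f \<union> ?T g) \<inter> ?T (\<lambda>x. f x + g x))" by (intro compact_Int_closed closed_closure)
  then have "compact (?T (\<lambda>x. f x + g x))" using sub by (simp add: Int_absorb1)
  then show ?thesis using assms sub by (auto simp: test_functions_def intro: C_class_add)
qed

lemma test_functions_eq_0: "f \<in> test_functions S \<Longrightarrow> x \<notin> S \<Longrightarrow> f x = 0"
  using closure_subset[of "{x. f x \<noteq> 0}"] by (auto simp: test_functions_def)

lemma C1_differentiable: "f \<in> C1_functions \<Longrightarrow> f differentiable (at x)"
  by (simp add: C1_functions_def)

lemma C1_continuous: "f \<in> C1_functions \<Longrightarrow> continuous_on UNIV f"
  using C_class_SucD[of 0 f] by (simp add: C1_functions_def)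

lemma C1_bounded_support: "f \<in> C1_functions \<Longrightarrow> bounded {x. f x \<noteq> 0}"
  by (simp add: C1_functions_def)

lemma C1_continuous_pderiv: "f \<in> C1_functions \<Longrightarrow> b \<in> Basis \<Longrightarrow> continuous_on UNIV (pderiv_dir b f)"
  by (simp add: C1_functions_def)

lemma pderiv_dir_eq_0:
  fixes f :: "'a::euclidean_space \<Rightarrow> complex"
  assumes "x \<notin> closure {x. f x \<noteq> 0}"
  shows "pderiv_dir b f x = 0"
proof -
  have "(f has_derivative (\<lambda>_. 0)) (at x)"
  proof (rule has_derivative_transform_within_open[OF has_derivative_const[of 0]])
    show "open (- closure {x. f x \<noteq> 0})" by (intro open_Compl closed_closure)
    show "x \<in> - closure {x. f x \<noteq> 0}" using assms by simp
    show "0 = f y" if "y \<in> - closure {x. f x \<noteq> 0}" for y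
      using that closure_subset[of "{x. f x \<noteq> 0}"] by auto
  qed
  then show ?thesis by (rule pderiv_dir_eqI)
qed

lemma C1_bounded_support_pderiv: "f \<in> C1_functions \<Longrightarrow> bounded {x. pderiv_dir b f x \<noteq> 0}"
  by (rule bounded_subset[OF bounded_closure[OF C1_bounded_support]]) (use pderiv_dir_eq_0 in blast)+

lemma C1_cmult: "f \<in> C1_functions \<Longrightarrow> (\<lambda>x. c * f x) \<in> C1_functions"
  by (auto simp: C1_functions_def simp del: C_class.simps One_nat_def intro: C_class_mult C_class_const
      elim: bounded_subset)

lemma C1_add: "f \<in> C1_functions \<Longrightarrow> g \<in> C1_functions \<Longrightarrow> (\<lambda>x. f x + g x) \<in> C1_functions"
proof -
  assume *: "f \<in> C1_functions" "g \<in> C1_functions"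
  have "bounded {x. f x + g x \<noteq> 0}"
    by (rule bounded_subset[of "{x. f x \<noteq> 0} \<union> {x. g x \<noteq> 0}"]) (use * in \<open>auto simp: C1_functions_def\<close>)
  then show ?thesis using * by (auto simp: C1_functions_def simp del: C_class.simps One_nat_def intro: C_class_add)
qed

lemma C1_mult: "f \<in> C1_functions \<Longrightarrow> C_class 1 g \<Longrightarrow> (\<lambda>x. f x * g x) \<in> C1_functions"
  by (auto simp: C1_functions_def simp del: C_class.simps One_nat_def intro: C_class_mult elim: bounded_subset)

lemma C1_lipschitz:
  assumes f: "f \<in> C1_functions"
  obtains B where "B > 0" "\<And>x y. norm (f x - f y) \<le> B * norm (x - y)"
proof -
  have "\<exists>B>0. \<forall>x. norm (pderiv_dir b f x) \<le> B" if "b \<in> Basis" for b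
    using continuous_bounded_support_bound[OF C1_continuous_pderiv[OF f that] C1_bounded_support_pderiv[OF f]] by metis
  then obtain B where B: "\<And>b. b \<in> Basis \<Longrightarrow> B b > 0" "\<And>b x. b \<in> Basis \<Longrightarrow> norm (pderiv_dir b f x) \<le> B b" by metis
  let ?B = "\<Sum>b\<in>Basis. B b"
  have "norm (f x - f y) \<le> ?B * norm (x - y)" for x y
  proof (rule differentiable_bound[of UNIV])
    fix x
    show "(f has_derivative (\<lambda>h. \<Sum>b\<in>Basis. (h \<bullet> b) *\<^sub>R pderiv_dir b f x)) (at x within UNIV)"
      using has_derivative_pderiv_dir[OF C1_differentiable[OF f]] .
    show "onorm (\<lambda>h. \<Sum>b\<in>Basis. (h \<bullet> b) *\<^sub>R pderiv_dir b f x) \<le> ?B"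
    proof (rule onorm_bound)
      fix h :: 'a
      have "norm (\<Sum>b\<in>Basis. (h \<bullet> b) *\<^sub>R pderiv_dir b f x) \<le> (\<Sum>b\<in>Basis. norm h * B b)"
        by (rule sum_norm_le) (auto intro!: mult_mono B Basis_le_norm)
      then show "norm (\<Sum>b\<in>Basis. (h \<bullet> b) *\<^sub>R pderiv_dir b f x) \<le> ?B * norm h"
        by (simp add: sum_distrib_left mult.commute)
    qed (rule sum_nonneg, use B(1) less_imp_le in blast)
  qed auto
  moreover have "?B > 0" by (rule sum_pos) (use B(1) in auto)
  ultimately show ?thesis using that by blast
qed

text \<open>The difference quotients have integral 0 by translation invariance, and dominated
  convergence passes this on to the derivative; no iterated integration over coordinates is
  involved.\<close>

lemma integral_pderiv_dir_eq_0:
  fixes f :: "'a::euclidean_space \<Rightarrow> complex"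
  assumes f: "f \<in> C1_functions" and b: "b \<in> Basis"
  shows "(\<integral>x. pderiv_dir b f x \<partial>lborel) = 0"
proof -
  obtain B where B: "B > 0" "\<And>x y. norm (f x - f y) \<le> B * norm (x - y)" using C1_lipschitz[OF f] by metis
  obtain R where R: "R > 0" "{x. f x \<noteq> 0} \<subseteq> ball 0 R"
    using bounded_subset_ball_radius[OF C1_bounded_support[OF f]] by metis
  have fint: "integrable lborel f"
    using integrable_continuous_bounded_support[OF C1_continuous[OF f] C1_bounded_support[OF f]] .
  then have fm: "f \<in> borel_measurable borel" by auto
  define h where "h n = 1 / real (Suc n)" for n
  have h: "h n > 0" "h n \<le> 1" for n by (auto simp: h_def)
  have h0: "h \<longlonglongrightarrow> 0" unfolding h_def using LIMSEQ_inverse_real_of_nat by (simp add: inverse_eq_divide)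
  define q where "q n x = (f (x + h n *\<^sub>R b) - f x) /\<^sub>R h n" for n x
  have q0: "(\<integral>x. q n x \<partial>lborel) = 0" for n
    unfolding q_def using integrable_translation[OF fint, of "h n *\<^sub>R b"] fint integral_translation[OF fm, of "h n *\<^sub>R b"]
    by simp
  have "(\<lambda>n. \<integral>x. q n x \<partial>lborel) \<longlonglongrightarrow> (\<integral>x. pderiv_dir b f x \<partial>lborel)"
  proof (rule integral_dominated_convergence)
    show "(\<lambda>x. pderiv_dir b f x) \<in> borel_measurable lborel"
      using borel_measurable_continuous_onI[OF C1_continuous_pderiv[OF f b]] by simp
    show "q n \<in> borel_measurable lborel" for n unfolding q_def using fm by measurable
    \<comment> \<open>Majorant of all difference quotients: the Lipschitz constant, on a ball
      enlarged by 1 since every step h n is at most 1.\<close>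
    show "integrable lborel (\<lambda>x. B * indicator (ball 0 (R + 1)) x :: real)"
      by (auto intro!: integrable_mult_right emeasure_lborel_ball_finite)
    show "AE x in lborel. norm (q n x) \<le> B * indicator (ball 0 (R + 1)) x" for n
    proof (rule AE_I2)
      fix x
      show "norm (q n x) \<le> B * indicator (ball 0 (R + 1)) x"
      proof (cases "x \<in> ball 0 (R + 1)")
        case True
        have "norm (f (x + h n *\<^sub>R b) - f x) \<le> B * norm (h n *\<^sub>R b)" using B(2)[of "x + h n *\<^sub>R b" x] by simp
        also have "\<dots> = B * h n" using b h(1)[of n] by simp
        finally show ?thesis using True h(1)[of n] by (simp add: q_def pos_divide_le_eq flip: divide_inverse_commute)
      next
        case False
        have "norm x \<le> norm (x + h n *\<^sub>R b) + norm (h n *\<^sub>R b)" using norm_triangle_ineq4[of "x + h n *\<^sub>R b" "h n *\<^sub>R b"] by simp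
        moreover have "norm (h n *\<^sub>R b) \<le> 1" using b h[of n] by simp
        ultimately have "x \<notin> ball 0 R" "x + h n *\<^sub>R b \<notin> ball 0 R" using False by auto
        then have "f x = 0" "f (x + h n *\<^sub>R b) = 0" using R(2) by auto
        then show ?thesis using False by (simp add: q_def)
      qed
    qed
    show "AE x in lborel. (\<lambda>n. q n x) \<longlonglongrightarrow> pderiv_dir b f x"
    proof (rule AE_I2)
      fix x
      have D: "(f has_derivative frechet_derivative f (at x)) (at x)"
        using C1_differentiable[OF f] frechet_derivative_works by blast
      have "((\<lambda>t. f (x + t *\<^sub>R b)) has_derivative (\<lambda>t. frechet_derivative f (at x) (t *\<^sub>R b))) (at 0)"
        by (rule has_derivative_compose[of "\<lambda>t. x + t *\<^sub>R b" _ 0 UNIV f, simplified])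
           (auto intro!: derivative_eq_intros D)
      moreover have "frechet_derivative f (at x) (t *\<^sub>R b) = t *\<^sub>R pderiv_dir b f x" for t
        using linear_cmul[OF has_derivative_linear[OF D]] .
      ultimately have "((\<lambda>t. f (x + t *\<^sub>R b)) has_vector_derivative pderiv_dir b f x) (at 0)"
        by (simp add: has_vector_derivative_def)
      then have "((\<lambda>t. norm (f (x + t *\<^sub>R b) - f x - t *\<^sub>R pderiv_dir b f x) / norm t) \<longlongrightarrow> 0) (at 0)"
        by (simp add: has_vector_derivative_def has_derivative_at)
      moreover have "filterlim h (at 0) sequentially"
        using h0 h(1) by (intro filterlim_atI) (auto simp: less_le)
      ultimately have "(\<lambda>n. norm (f (x + h n *\<^sub>R b) - f x - h n *\<^sub>R pderiv_dir b f x) / norm (h n)) \<longlonglongrightarrow> 0"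
        by (rule filterlim_compose)
      also have "(\<lambda>n. norm (f (x + h n *\<^sub>R b) - f x - h n *\<^sub>R pderiv_dir b f x) / norm (h n)) = (\<lambda>n. norm (q n x - pderiv_dir b f x))"
      proof
        fix n
        have "q n x - pderiv_dir b f x = (f (x + h n *\<^sub>R b) - f x - h n *\<^sub>R pderiv_dir b f x) /\<^sub>R h n"
          using h(1)[of n] unfolding q_def by (simp add: scaleR_diff_right)
        then show "norm (f (x + h n *\<^sub>R b) - f x - h n *\<^sub>R pderiv_dir b f x) / norm (h n) = norm (q n x - pderiv_dir b f x)"
          by (simp add: divide_inverse mult.commute)
      qed
      finally have "(\<lambda>n. q n x - pderiv_dir b f x) \<longlonglongrightarrow> 0" by (rule tendsto_norm_zero_cancel)
      then show "(\<lambda>n. q n x) \<longlonglongrightarrow> pderiv_dir b f x" by (rule LIM_zero_cancel)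
    qed
  qed
  then show ?thesis using q0 by (simp add: LIMSEQ_const_iff)
qed

section \<open>Bump functions\<close>

text \<open>The family p(1/y) exp(-1/y) is closed under differentiation, which reduces smoothness at
  0 to an induction; p = 1 gives the classical function that is flat at 0.\<close>

definition bump :: "real poly \<Rightarrow> real \<Rightarrow> real" where
  "bump p y = (if y > 0 then poly p (1 / y) * exp (- (1 / y)) else 0)"

lemma tendsto_poly_exp_minus: "((\<lambda>y. poly p y * exp (- y)) \<longlongrightarrow> (0::real)) at_top"
proof -
  have "((\<lambda>y. \<Sum>i\<le>degree p. coeff p i * (y ^ i / exp y)) \<longlongrightarrow> (\<Sum>i\<le>degree p. coeff p i * 0)) at_top"
    by (intro tendsto_intros tendsto_power_div_exp_0)
  then show ?thesis by (simp add: poly_altdef sum_distrib_right exp_minus divide_inverse mult.assoc)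
qed

text \<open>With w = 1/y one has d/dy = - w^2 d/dw, which sends p e^(-w) to (p - p') w^2 e^(-w); the
  factor w^2 is \<open>[:0, 0, 1:]\<close>. At y = 0 the exponential beats every polynomial in
  1/y.\<close>

lemma has_real_derivative_bump:
  "(bump p has_real_derivative bump ((p - pderiv p) * [:0, 0, 1:]) y) (at y)"
proof -
  consider "y > 0" | "y < 0" | "y = 0" by linarith
  then show ?thesis
  proof cases
    case 1
    have "((\<lambda>y. poly p (1 / y) * exp (- (1 / y))) has_real_derivative bump ((p - pderiv p) * [:0, 0, 1:]) y) (at y)"
      using 1 by (auto intro!: derivative_eq_intros DERIV_chain'[OF _ poly_DERIV] simp: bump_def power2_eq_square field_simps)
    then show ?thesis
      by (rule has_field_derivative_transform_within_open[of _ _ _ "{0<..}"]) (use 1 in \<open>auto simp: bump_def\<close>)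
  next
    case 2
    have "((\<lambda>y. 0) has_real_derivative bump ((p - pderiv p) * [:0, 0, 1:]) y) (at y)"
      using 2 by (simp add: bump_def)
    then show ?thesis
      by (rule has_field_derivative_transform_within_open[of _ _ _ "{..<0}"]) (use 2 in \<open>auto simp: bump_def\<close>)
  next
    case 3
    have "((\<lambda>h. bump p h / h) \<longlongrightarrow> 0) (at_right 0)"
    proof -
      \<comment> \<open>Dividing by h multiplies the polynomial in 1/h by its variable.\<close>
      have "((\<lambda>h. poly ([:0, 1:] * p) (inverse h) * exp (- inverse h)) \<longlongrightarrow> 0) (at_right (0::real))"
        by (rule filterlim_compose[OF tendsto_poly_exp_minus filterlim_inverse_at_top_right])
      then show ?thesis
        by (rule Lim_transform_eventually)
           (auto simp: bump_def eventually_at_filter field_simps)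
    qed
    moreover have "((\<lambda>h. bump p h / h) \<longlongrightarrow> 0) (at_left 0)"
      by (rule tendsto_eventually) (auto simp: bump_def eventually_at_filter)
    ultimately have "((\<lambda>h. bump p h / h) \<longlongrightarrow> 0) (at 0)" by (simp add: filterlim_split_at)
    then show ?thesis using 3 by (simp add: has_field_derivative_def DERIV_def[unfolded has_field_derivative_def] bump_def)
  qed
qed

text \<open>A derivative in direction b multiplies r by b \<bullet> a and replaces p by the
  polynomial of the derivative, so both vary in the induction.\<close>

lemma C_class_bump_affine:
  fixes a :: "'a::euclidean_space"
  shows "C_class k (\<lambda>x. complex_of_real (r * bump p (c + x \<bullet> a)))"
proof (induction k arbitrary: r p)
  case 0
  have "continuous_on UNIV (bump p)"
    by (intro continuous_at_imp_continuous_on ballI DERIV_isCont[OF has_real_derivative_bump])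
  then have "continuous_on UNIV (\<lambda>x. bump p (c + x \<bullet> a))"
    by (rule continuous_on_compose2) (auto intro!: continuous_intros)
  then show ?case by (auto intro!: continuous_intros)
next
  case (Suc k)
  let ?q = "(p - pderiv p) * [:0, 0, 1:]"
  have D: "((\<lambda>x. complex_of_real (r * bump p (c + x \<bullet> a))) has_derivative
      (\<lambda>h. complex_of_real (r * ((h \<bullet> a) * bump ?q (c + x \<bullet> a))))) (at x)" for x
  proof -
    have "((\<lambda>x. bump p (c + x \<bullet> a)) has_derivative (\<lambda>h. (h \<bullet> a) * bump ?q (c + x \<bullet> a))) (at x)"
      by (rule has_derivative_compose[of "\<lambda>x. c + x \<bullet> a" "\<lambda>h. h \<bullet> a" x UNIV "bump p", simplified])
         (auto intro!: derivative_eq_intros has_real_derivative_bump[unfolded has_field_derivative_def, THEN has_derivative_eq_rhs])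
    then show ?thesis by (auto intro!: derivative_eq_intros)
  qed
  then have pd: "pderiv_dir b (\<lambda>x. complex_of_real (r * bump p (c + x \<bullet> a)))
      = (\<lambda>x. complex_of_real ((r * (b \<bullet> a)) * bump ?q (c + x \<bullet> a)))" for b
    by (intro ext) (simp only: pderiv_dir_eqI[OF D] mult.assoc)
  show ?case unfolding C_class.simps pd
    using D Suc.IH by (blast intro: differentiableI)
qed

text \<open>A smooth approximation of the indicator of \<open>box a b\<close> from inside: in the
  box each factor is exp (- 1 / ((m + 1) d)), where d is the distance to a face, and tends to 1 with
  m. The explicit formula replaces mollification of indicators.\<close>

definition box_bump :: "nat \<Rightarrow> 'a::euclidean_space \<Rightarrow> 'a \<Rightarrow> 'a \<Rightarrow> real" where
  "box_bump m a b x = (\<Prod>i\<in>Basis. bump 1 (real (Suc m) * (x \<bullet> i - a \<bullet> i)) * bump 1 (real (Suc m) * (b \<bullet> i - x \<bullet> i)))"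

lemma bump_1: "bump 1 y = (if y > 0 then exp (- (1 / y)) else 0)"
  by (simp add: bump_def)

lemma C_class_box_bump: "C_class k (\<lambda>x. complex_of_real (box_bump m a b x))"
proof -
  have *: "C_class k (\<lambda>x. complex_of_real (bump 1 (real (Suc m) * (x \<bullet> i - a \<bullet> i))))"
    "C_class k (\<lambda>x. complex_of_real (bump 1 (real (Suc m) * (b \<bullet> i - x \<bullet> i))))" for i
    using C_class_bump_affine[of k 1 1 "- real (Suc m) * (a \<bullet> i)" "real (Suc m) *\<^sub>R i"]
      C_class_bump_affine[of k 1 1 "real (Suc m) * (b \<bullet> i)" "- real (Suc m) *\<^sub>R i"]
    by (simp_all add: algebra_simps)
  show ?thesis unfolding box_bump_def of_real_prod of_real_mult by (intro C_class_prod C_class_mult *)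
qed

lemma box_bump_outside: "x \<notin> box a b \<Longrightarrow> box_bump m a b x = 0"
proof -
  assume "x \<notin> box a b"
  then obtain i where i: "i \<in> Basis" "x \<bullet> i - a \<bullet> i \<le> 0 \<or> b \<bullet> i - x \<bullet> i \<le> 0" by (force simp: mem_box)
  then have "bump 1 (real (Suc m) * (x \<bullet> i - a \<bullet> i)) * bump 1 (real (Suc m) * (b \<bullet> i - x \<bullet> i)) = 0"
    by (auto simp: bump_1 zero_less_mult_iff)
  then show ?thesis unfolding box_bump_def using i(1) by (intro prod_zero) auto
qed

lemma box_bump_nonneg: "0 \<le> box_bump m a b x"
  unfolding box_bump_def by (intro prod_nonneg) (auto simp: bump_1)

lemma box_bump_le_1: "box_bump m a b x \<le> 1"
proof -
  have "bump 1 y \<le> 1" "0 \<le> bump 1 y" for y by (auto simp: bump_1)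
  then show ?thesis unfolding box_bump_def by (intro prod_le_1 conjI mult_nonneg_nonneg mult_le_one) auto
qed

lemma box_bump_tendsto: "(\<lambda>m. box_bump m a b x) \<longlonglongrightarrow> indicator (box a b) x"
proof (cases "x \<in> box a b")
  case True
  have lim: "(\<lambda>m. bump 1 (real (Suc m) * d)) \<longlonglongrightarrow> 1" if d: "d > 0" for d
  proof -
    have "(\<lambda>m. exp (- (1 / d * (1 / real (Suc m))))) \<longlonglongrightarrow> exp (- (1 / d * 0))"
      using LIMSEQ_inverse_real_of_nat by (intro tendsto_intros) (simp add: inverse_eq_divide)
    moreover have "bump 1 (real (Suc m) * d) = exp (- (1 / d * (1 / real (Suc m))))" for m
      using d by (simp add: bump_1 zero_less_mult_iff mult.commute)
    ultimately show ?thesis by simp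
  qed
  have "(\<lambda>m. box_bump m a b x) \<longlonglongrightarrow> (\<Prod>i\<in>(Basis::'a set). 1 * 1)"
    unfolding box_bump_def by (intro tendsto_prod tendsto_mult lim) (use True in \<open>auto simp: mem_box\<close>)
  then show ?thesis using True by simp
qed (simp add: box_bump_outside)

lemma box_bump_test_function:
  assumes "cbox a b \<subseteq> S"
  shows "(\<lambda>x. complex_of_real (box_bump m a b x)) \<in> test_functions S"
proof -
  have "{x. complex_of_real (box_bump m a b x) \<noteq> 0} \<subseteq> cbox a b"
  proof
    fix x assume "x \<in> {x. complex_of_real (box_bump m a b x) \<noteq> 0}"
    then have "x \<in> box a b" using box_bump_outside[of x a b m] by auto
    then show "x \<in> cbox a b" using box_subset_cbox by blast
  qed
  then have "closure {x. complex_of_real (box_bump m a b x) \<noteq> 0} \<subseteq> cbox a b"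
    by (rule closure_minimal) (rule closed_cbox)
  moreover from this have "compact (closure {x. complex_of_real (box_bump m a b x) \<noteq> 0})"
    using compact_cbox[of a b] by (metis closed_Int_compact closed_closure Int_absorb2)
  ultimately show ?thesis using assms C_class_box_bump by (auto simp: test_functions_def)
qed

lemma continuous_box_bump: "continuous_on UNIV (box_bump m a b)"
proof -
  have "continuous_on UNIV (\<lambda>x. complex_of_real (box_bump m a b x))" using C_class_box_bump[of 0] by simp
  from continuous_on_Re[OF this] show ?thesis by simp
qed

text \<open>Boxes are stable under intersection and generate the Borel sets, and the sets over which
  u integrates to 0 form a Dynkin system; a density whose integral over every Borel set is 0
  vanishes almost everywhere.\<close>

lemma AE_zero_if_box_integrals_zero_real:
  fixes u :: "'a::euclidean_space \<Rightarrow> real"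
  assumes u: "integrable lborel u"
    and box: "\<And>a b. (LINT x:box a b|lborel. u x) = 0"
  shows "AE x in lborel. u x = 0"
proof -
  have si: "set_integrable lborel A u" if "A \<in> sets borel" for A
    unfolding set_integrable_def using that by (intro integrable_mult_indicator u) auto
  \<comment> \<open>The whole space is not a box, yet the complement step of the Dynkin argument
    needs its integral; it is exhausted by growing boxes.\<close>
  have tot: "(\<integral>x. u x \<partial>lborel) = 0"
  proof -
    have "(\<lambda>n. LINT x:box (- (real n *\<^sub>R One)) (real n *\<^sub>R One)|lborel. u x) \<longlonglongrightarrow> (LINT x:(\<Union>n. box (- (real n *\<^sub>R One)) (real n *\<^sub>R One))|lborel. u x)"
    proof (rule set_integral_cont_up)
      show "incseq (\<lambda>n. box (- (real n *\<^sub>R One)) (real n *\<^sub>R One) :: 'a set)"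
        by (auto simp: incseq_def mem_box) (smt (verit, best) of_nat_le_iff)+
    qed (auto intro: si)
    moreover have "(\<Union>n. box (- (real n *\<^sub>R One)) (real n *\<^sub>R One)) = (UNIV :: 'a set)"
      by (rule UN_box_eq_UNIV)
    ultimately show ?thesis using box by (simp add: LIMSEQ_const_iff set_lebesgue_integral_def)
  qed
  have "(LINT x:A|lborel. u x) = 0" if "A \<in> sets borel" for A
  proof -
    have "Int_stable (range (\<lambda>(a, b). box a b :: 'a set))"
      by (auto simp: Int_stable_def box_Int_box)
    moreover have "range (\<lambda>(a, b). box a b :: 'a set) \<subseteq> Pow UNIV" by simp
    moreover have "A \<in> sigma_sets UNIV (range (\<lambda>(a, b). box a b))" using that by (simp add: borel_eq_box)
    ultimately show ?thesis
    proof (induction rule: sigma_sets_induct_disjoint)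
      case (basic A) then show ?case using box by auto
    next
      case empty show ?case by (simp add: set_lebesgue_integral_def)
    next
      case (compl A)
      have A: "A \<in> sets borel" using compl by (simp add: borel_eq_box)
      have "(\<integral>x. u x \<partial>lborel) = (LINT x:A|lborel. u x) + (LINT x:(UNIV - A)|lborel. u x)"
        using set_integral_Un[OF _ si[OF A] si[of "UNIV - A"]] A by (auto simp: set_lebesgue_integral_def)
      then show ?case using tot compl by simp
    next
      case (union A)
      have A: "A i \<in> sets borel" for i using union by (auto simp: borel_eq_box)
      have "(LINT x:(\<Union>i. A i)|lborel. u x) = (\<Sum>i. (LINT x:(A i)|lborel. u x))"
        using A union(1) by (intro lebesgue_integral_countable_add si) (auto simp: disjoint_family_on_def)
      then show ?case using union by simp
    qed
  qed
  then have "AE x in lborel. u x = (0::real)"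
    by (intro density_unique_real u) (auto simp: set_lebesgue_integral_def)
  then show ?thesis .
qed

text \<open>The fundamental lemma of the calculus of variations. Box bumps converge to the indicator
  of their box, and dominated convergence carries orthogonality over; the rest is localisation,
  because the available boxes are those whose closed box lies in S.\<close>

lemma AE_zero_if_orthogonal_to_box_bumps:
  fixes u :: "'a::euclidean_space \<Rightarrow> complex"
  assumes u: "integrable lborel u" and S: "open S" and out: "AE x in lborel. x \<notin> S \<longrightarrow> u x = 0"
    and orth: "\<And>m a b. cbox a b \<subseteq> S \<Longrightarrow> (\<integral>x. u x * of_real (box_bump m a b x) \<partial>lborel) = 0"
  shows "AE x in lborel. u x = 0"
proof -
  have um[measurable]: "u \<in> borel_measurable borel" using u by auto
  have box0: "(LINT x:box a b|lborel. u x) = 0" if "cbox a b \<subseteq> S" for a b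
  proof -
    have "(\<lambda>m. \<integral>x. u x * of_real (box_bump m a b x) \<partial>lborel) \<longlonglongrightarrow> (\<integral>x. u x * of_real (indicator (box a b) x) \<partial>lborel)"
    proof (rule integral_dominated_convergence[where w="\<lambda>x. norm (u x)"])
      show "(\<lambda>x. u x * of_real (box_bump m a b x)) \<in> borel_measurable lborel" for m
        using borel_measurable_continuous_onI[OF continuous_box_bump[of m a b]] by measurable
      show "AE x in lborel. (\<lambda>m. u x * of_real (box_bump m a b x)) \<longlonglongrightarrow> u x * of_real (indicator (box a b) x)"
        by (intro AE_I2 tendsto_intros box_bump_tendsto)
      show "AE x in lborel. norm (u x * of_real (box_bump m a b x)) \<le> norm (u x)" for m
        using box_bump_le_1[of m a b] box_bump_nonneg[of m a b] by (auto simp: norm_mult mult_left_le)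
    qed (use u in auto)
    then have "(\<integral>x. u x * of_real (indicator (box a b) x) \<partial>lborel) = 0" by (simp add: orth that LIMSEQ_const_iff)
    then show ?thesis unfolding set_lebesgue_integral_def scaleR_conv_of_real by (simp add: mult.commute)
  qed
  have part: "AE x in lborel. x \<in> box a b \<longrightarrow> u x = 0" if ab: "cbox a b \<subseteq> S" for a b
  proof -
    \<comment> \<open>Cut off to a box inside S, u integrates to 0 over every box whatsoever, since
      two boxes meet in a box that again lies in S.\<close>
    have *: "(LINT x:box c d|lborel. indicator (box a b) x *\<^sub>R u x) = 0" for c d
    proof -
      define e where "e = (\<Sum>i\<in>Basis. max (a \<bullet> i) (c \<bullet> i) *\<^sub>R i)"
      define f where "f = (\<Sum>i\<in>Basis. min (b \<bullet> i) (d \<bullet> i) *\<^sub>R i)"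
      have ef: "box a b \<inter> box c d = box e f" unfolding e_def f_def by (rule box_Int_box)
      have "cbox e f \<subseteq> cbox a b" by (auto simp: mem_box e_def f_def)
      then have "(LINT x:box e f|lborel. u x) = 0" using ab box0 by blast
      then show ?thesis unfolding ef[symmetric] set_lebesgue_integral_def
        by (simp add: indicator_inter_arith mult.commute)
    qed
    have int: "integrable lborel (\<lambda>x. indicator (box a b) x *\<^sub>R u x)" by (intro integrable_mult_indicator u) simp
    have sint: "integrable lborel (\<lambda>x. indicator (box c d) x *\<^sub>R (indicator (box a b) x *\<^sub>R u x))" for c d
      by (intro integrable_mult_indicator int) simp
    have "AE x in lborel. Re (indicator (box a b) x *\<^sub>R u x) = 0"
    proof (rule AE_zero_if_box_integrals_zero_real)
      show "(LINT x:box c d|lborel. Re (indicator (box a b) x *\<^sub>R u x)) = 0" for c d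
        using integral_Re[OF sint[of c d]] *[of c d] by (simp add: set_lebesgue_integral_def mult.assoc)
    qed (use int in \<open>rule integrable_Re\<close>)
    moreover have "AE x in lborel. Im (indicator (box a b) x *\<^sub>R u x) = 0"
    proof (rule AE_zero_if_box_integrals_zero_real)
      show "(LINT x:box c d|lborel. Im (indicator (box a b) x *\<^sub>R u x)) = 0" for c d
        using integral_Im[OF sint[of c d]] *[of c d] by (simp add: set_lebesgue_integral_def mult.assoc)
    qed (use int in \<open>rule integrable_Im\<close>)
    ultimately show ?thesis by eventually_elim (auto simp: indicator_def complex_eq_iff)
  qed
  \<comment> \<open>Countably many of these boxes cover S, so their exceptional null sets can be
    united.\<close>
  define \<F> where "\<F> = {box a b | a b. cbox a b \<subseteq> S}"
  have "\<And>X. X \<in> \<F> \<Longrightarrow> open X" by (auto simp: \<F>_def open_box)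
  then obtain D' where D': "D' \<subseteq> \<F>" "countable D'" "\<Union>D' = \<Union>\<F>" by (rule Lindelof)
  have "S \<subseteq> \<Union>\<F>"
  proof
    fix x assume "x \<in> S"
    then obtain e where e: "e > 0" "cball x e \<subseteq> S" using S open_contains_cball by metis
    obtain a b where ab: "x \<in> box a b" "box a b \<subseteq> ball x e" using rational_boxes[OF e(1)] by metis
    have "cbox a b = closure (box a b)" using ab(1) by (intro closure_box[symmetric]) auto
    also have "\<dots> \<subseteq> cball x e" using ab(2) ball_subset_cball by (intro closure_minimal) auto
    finally have "box a b \<in> \<F>" using e(2) by (auto simp: \<F>_def)
    then show "x \<in> \<Union>\<F>" using ab(1) by blast
  qed
  have "AE x in lborel. \<forall>X\<in>D'. x \<in> X \<longrightarrow> u x = 0"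
    using part D'(1) by (subst AE_ball_countable[OF D'(2)]) (auto simp: \<F>_def)
  then show ?thesis using out
  proof eventually_elim
    case (elim x)
    show ?case
    proof (cases "x \<in> S")
      case True
      then have "x \<in> \<Union>D'" using D'(3) \<open>S \<subseteq> \<Union>\<F>\<close> by auto
      then show ?thesis using elim(1) by auto
    qed (use elim(2) in simp)
  qed
qed

section \<open>The Fourier transform on \<open>L\<^sub>1 \<inter> L\<^sub>2\<close>\<close>

lemma
  fixes f :: "'a::euclidean_space \<Rightarrow> real \<Rightarrow> complex"
  assumes f: "\<And>b. b \<in> Basis \<Longrightarrow> integrable lborel (f b)"
  shows integrable_prod_coordinates: "integrable lborel (\<lambda>x::'a. \<Prod>b\<in>Basis. f b (x \<bullet> b))"
    and integral_prod_coordinates: "(\<integral>x. (\<Prod>b\<in>Basis. f b (x \<bullet> b)) \<partial>(lborel :: 'a measure)) = (\<Prod>b\<in>Basis. \<integral>y. f b y \<partial>lborel)"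
proof -
  interpret P: product_sigma_finite "\<lambda>_::'a. lborel :: real measure" ..
  have [measurable]: "f b \<in> borel_measurable borel" if "b \<in> Basis" for b using f[OF that] by auto
  have m: "(\<lambda>x::'a. \<Prod>b\<in>Basis. f b (x \<bullet> b)) \<in> borel_measurable borel" by measurable
  have m2: "(\<lambda>f::'a \<Rightarrow> real. \<Sum>b\<in>Basis. f b *\<^sub>R b) \<in> measurable (\<Pi>\<^sub>M b\<in>Basis. lborel) borel" by measurable
  have eq: "(\<Prod>b\<in>Basis. f b ((\<Sum>b\<in>Basis. y b *\<^sub>R b) \<bullet> b)) = (\<Prod>b\<in>Basis. f b (y b))" for y :: "'a \<Rightarrow> real"
    by (intro prod.cong) auto
  show "integrable lborel (\<lambda>x::'a. \<Prod>b\<in>Basis. f b (x \<bullet> b))"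
    by (subst lborel_eq, subst integrable_distr_eq[OF m2 m]) (simp only: eq, rule P.product_integrable_prod[OF finite_Basis f])
  show "(\<integral>x. (\<Prod>b\<in>Basis. f b (x \<bullet> b)) \<partial>(lborel :: 'a measure)) = (\<Prod>b\<in>Basis. \<integral>y. f b y \<partial>lborel)"
    by (subst lborel_eq, subst integral_distr[OF m2 m]) (simp only: eq, rule P.product_integral_prod[OF finite_Basis f])
qed

text \<open>After rescaling by e the integral is, up to its normalisation, the characteristic
  function of the standard normal law at z / e.\<close>

lemma
  fixes z e :: real
  assumes e: "e > 0"
  shows integrable_exp_gaussian_real: "integrable lborel (\<lambda>s. exp (\<i> * of_real (s * z)) * of_real (exp (- (e\<^sup>2 * s\<^sup>2 / 2))))"
    and integral_exp_gaussian_real: "(\<integral>s. exp (\<i> * of_real (s * z)) * of_real (exp (- (e\<^sup>2 * s\<^sup>2 / 2))) \<partial>lborel)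
      = of_real (sqrt (2 * pi) / e * exp (- (z\<^sup>2 / (2 * e\<^sup>2))))"
proof -
  have i0: "integrable lborel (\<lambda>x. exp (\<i> * of_real (t * x)) * of_real (exp (- (x\<^sup>2 / 2))))" for t
  proof (rule Bochner_Integration.integrable_bound)
    show "integrable lborel (\<lambda>x. sqrt (2 * pi) * std_normal_density x)"
      by (intro integrable_mult_right integrable_normal_density) simp
    show "AE x in lborel. norm (exp (\<i> * of_real (t * x)) * of_real (exp (- (x\<^sup>2 / 2)))) \<le> norm (sqrt (2 * pi) * std_normal_density x)"
      by (rule AE_I2) (simp add: norm_mult norm_exp_i_times std_normal_density_def)
  qed measurable
  have c: "(\<integral>x. exp (\<i> * of_real (t * x)) * of_real (exp (- (x\<^sup>2 / 2))) \<partial>lborel) = of_real (sqrt (2 * pi) * exp (- (t\<^sup>2 / 2)))" for t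
  proof -
    have "complex_of_real (exp (- (t\<^sup>2) / 2)) = char std_normal_distribution t"
      by (simp add: char_std_normal_distribution)
    also have "\<dots> = (\<integral>x. std_normal_density x *\<^sub>R exp (\<i> * of_real (t * x)) \<partial>lborel)"
      unfolding char_def by (subst integral_density) auto
    also have "\<dots> = (\<integral>x. (1 / of_real (sqrt (2 * pi))) * (exp (\<i> * of_real (t * x)) * of_real (exp (- (x\<^sup>2 / 2)))) \<partial>lborel)"
      by (intro Bochner_Integration.integral_cong) (auto simp: std_normal_density_def scaleR_conv_of_real)
    also have "\<dots> = (1 / of_real (sqrt (2 * pi))) * (\<integral>x. exp (\<i> * of_real (t * x)) * of_real (exp (- (x\<^sup>2 / 2))) \<partial>lborel)"
      by (rule integral_mult_right_zero)
    finally show ?thesis by (simp add: field_simps)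
  qed
  let ?F = "\<lambda>x. exp (\<i> * of_real ((z / e) * x)) * complex_of_real (exp (- (x\<^sup>2 / 2)))"
  have eq: "?F (0 + e * s) = exp (\<i> * of_real (s * z)) * of_real (exp (- (e\<^sup>2 * s\<^sup>2 / 2)))" for s
    using e by (simp add: power_mult_distrib mult.commute)
  show "integrable lborel (\<lambda>s. exp (\<i> * of_real (s * z)) * of_real (exp (- (e\<^sup>2 * s\<^sup>2 / 2))))"
    using lborel_integrable_real_affine[OF i0[of "z / e"], of e 0] e unfolding eq by simp
  have "of_real (sqrt (2 * pi) * exp (- ((z / e)\<^sup>2 / 2))) = \<bar>e\<bar> *\<^sub>R (\<integral>s. ?F (0 + e * s) \<partial>lborel)"
    using lborel_integral_real_affine[of e ?F 0] e c[of "z / e"] by simp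
  then show "(\<integral>s. exp (\<i> * of_real (s * z)) * of_real (exp (- (e\<^sup>2 * s\<^sup>2 / 2))) \<partial>lborel)
      = of_real (sqrt (2 * pi) / e * exp (- (z\<^sup>2 / (2 * e\<^sup>2))))"
    unfolding eq using e by (simp add: scaleR_conv_of_real field_simps)
qed

lemma
  fixes z :: "'a::euclidean_space" and e :: real
  assumes e: "e > 0"
  shows integrable_exp_gaussian: "integrable lborel (\<lambda>\<xi>. exp (\<i> * of_real (\<xi> \<bullet> z)) * of_real (exp (- (e\<^sup>2 * (norm \<xi>)\<^sup>2 / 2))))"
    and integral_exp_gaussian: "(\<integral>\<xi>. exp (\<i> * of_real (\<xi> \<bullet> z)) * of_real (exp (- (e\<^sup>2 * (norm \<xi>)\<^sup>2 / 2))) \<partial>lborel)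
      = of_real ((sqrt (2 * pi) / e) ^ DIM('a) * exp (- ((norm z)\<^sup>2 / (2 * e\<^sup>2))))"
proof -
  let ?f = "\<lambda>b s. exp (\<i> * of_real (s * (z \<bullet> b))) * complex_of_real (exp (- (e\<^sup>2 * s\<^sup>2 / 2)))"
  have n2: "(norm x)\<^sup>2 = (\<Sum>b\<in>Basis. (x \<bullet> b)\<^sup>2)" for x :: 'a
    unfolding power2_norm_eq_inner by (subst euclidean_inner) (simp add: power2_eq_square)
  have eq: "(\<Prod>b\<in>Basis. ?f b (\<xi> \<bullet> b)) = exp (\<i> * of_real (\<xi> \<bullet> z)) * of_real (exp (- (e\<^sup>2 * (norm \<xi>)\<^sup>2 / 2)))" for \<xi> :: 'a
  proof -
    have "\<i> * complex_of_real (\<xi> \<bullet> z) = (\<Sum>b\<in>Basis. \<i> * of_real (\<xi> \<bullet> b * (z \<bullet> b)))"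
      by (subst euclidean_inner) (simp add: sum_distrib_left)
    moreover have "- (e\<^sup>2 * (norm \<xi>)\<^sup>2 / 2) = (\<Sum>b\<in>Basis. - (e\<^sup>2 * (\<xi> \<bullet> b)\<^sup>2 / 2))"
      by (simp add: n2 sum_distrib_left sum_divide_distrib sum_negf)
    ultimately show ?thesis by (simp only: exp_sum[OF finite_Basis] prod.distrib of_real_prod)
  qed
  show "integrable lborel (\<lambda>\<xi>. exp (\<i> * of_real (\<xi> \<bullet> z)) * of_real (exp (- (e\<^sup>2 * (norm \<xi>)\<^sup>2 / 2))))"
    using integrable_prod_coordinates[of ?f] integrable_exp_gaussian_real[OF e] unfolding eq by blast
  have "(\<integral>\<xi>. exp (\<i> * of_real (\<xi> \<bullet> z)) * of_real (exp (- (e\<^sup>2 * (norm \<xi>)\<^sup>2 / 2))) \<partial>lborel)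
      = (\<Prod>b\<in>Basis. of_real (sqrt (2 * pi) / e * exp (- ((z \<bullet> b)\<^sup>2 / (2 * e\<^sup>2)))))"
    using integral_prod_coordinates[of ?f] integrable_exp_gaussian_real[OF e] unfolding eq integral_exp_gaussian_real[OF e] by blast
  also have "\<dots> = of_real ((sqrt (2 * pi) / e) ^ DIM('a) * exp (- ((norm z)\<^sup>2 / (2 * e\<^sup>2))))"
  proof -
    have "- ((norm z)\<^sup>2 / (2 * e\<^sup>2)) = (\<Sum>b\<in>Basis. - ((z \<bullet> b)\<^sup>2 / (2 * e\<^sup>2)))"
      by (simp add: n2 sum_divide_distrib sum_negf)
    then show ?thesis
      unfolding of_real_prod[symmetric] prod.distrib by (simp only: exp_sum[OF finite_Basis] prod_constant)
  qed
  finally show "(\<integral>\<xi>. exp (\<i> * of_real (\<xi> \<bullet> z)) * of_real (exp (- (e\<^sup>2 * (norm \<xi>)\<^sup>2 / 2))) \<partial>lborel)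
      = of_real ((sqrt (2 * pi) / e) ^ DIM('a) * exp (- ((norm z)\<^sup>2 / (2 * e\<^sup>2))))" .
qed

lemma gaussian_integrable:
  assumes e: "e > 0"
  shows "integrable lborel (\<lambda>\<xi>::'a::euclidean_space. exp (- (e\<^sup>2 * (norm \<xi>)\<^sup>2 / 2)))"
  using integrable_Re[OF integrable_exp_gaussian[OF e, of 0]] by simp

lemma nn_integral_gaussian:
  assumes e: "e > 0"
  shows "(\<integral>\<^sup>+z. ennreal (exp (- ((norm z)\<^sup>2 / (2 * e\<^sup>2)))) \<partial>(lborel :: 'a::euclidean_space measure)) = ennreal ((sqrt (2 * pi) * e) ^ DIM('a))"
proof -
  have e': "1 / e > 0" using e by simp
  have eq: "(1 / e)\<^sup>2 * r / 2 = r / (2 * e\<^sup>2)" for r by (simp add: power_divide)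
  have "(\<integral>z. exp (- ((norm z)\<^sup>2 / (2 * e\<^sup>2))) \<partial>(lborel :: 'a measure)) = (sqrt (2 * pi) * e) ^ DIM('a)"
    using integral_exp_gaussian[OF e', of "0::'a"] by (simp add: eq of_real_eq_iff flip: of_real_power of_real_mult)
  then show ?thesis
    using gaussian_integrable[OF e', where 'a='a] by (subst nn_integral_eq_integral) (auto simp: eq)
qed

text \<open>Supplies the majorants that justify Fubini's theorem in
  \<open>gaussian_fourier_bound\<close>.\<close>

lemma integrable_pair_mult:
  fixes f :: "'a::euclidean_space \<Rightarrow> real" and g :: "'b::euclidean_space \<Rightarrow> real"
  assumes f: "integrable lborel f" and g: "integrable lborel g"
  shows "integrable (lborel \<Otimes>\<^sub>M lborel) (\<lambda>(x, y). f x * g y)"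
proof (rule integrableI_bounded)
  have [measurable]: "f \<in> borel_measurable borel" "g \<in> borel_measurable borel" using f g by auto
  show "(\<lambda>(x, y). f x * g y) \<in> borel_measurable (lborel \<Otimes>\<^sub>M lborel)" by measurable
  have "(\<integral>\<^sup>+z. ennreal (norm (case z of (x, y) \<Rightarrow> f x * g y)) \<partial>(lborel \<Otimes>\<^sub>M lborel))
      = (\<integral>\<^sup>+x. \<integral>\<^sup>+y. ennreal (norm (f x * g y)) \<partial>lborel \<partial>lborel)"
    by (subst lborel.nn_integral_fst[symmetric]) (auto simp: split_beta')
  also have "\<dots> = (\<integral>\<^sup>+x. ennreal (norm (f x)) \<partial>lborel) * (\<integral>\<^sup>+y. ennreal (norm (g y)) \<partial>lborel)"
    by (simp add: abs_mult ennreal_mult nn_integral_cmult nn_integral_multc)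
  also have "\<dots> < \<infinity>" using f g by (simp add: integrable_iff_bounded ennreal_mult_less_top)
  finally show "(\<integral>\<^sup>+z. ennreal (norm (case z of (x, y) \<Rightarrow> f x * g y)) \<partial>(lborel \<Otimes>\<^sub>M lborel)) < \<infinity>" .
qed

lemma borel_measurable_fourier [measurable]:
  fixes u :: "'a::euclidean_space \<Rightarrow> complex"
  assumes [measurable]: "u \<in> borel_measurable borel"
  shows "fourier u \<in> borel_measurable borel"
  unfolding fourier_def[abs_def] by measurable

lemma integrable_fourier_integrand:
  fixes u :: "'a::euclidean_space \<Rightarrow> complex"
  assumes u: "integrable lborel u"
  shows "integrable lborel (\<lambda>x. exp (- \<i> * of_real (\<xi> \<bullet> x)) * u x)"
proof (rule Bochner_Integration.integrable_bound[OF u])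
  have [measurable]: "u \<in> borel_measurable borel" using u by auto
  show "(\<lambda>x. exp (- \<i> * of_real (\<xi> \<bullet> x)) * u x) \<in> borel_measurable lborel" by measurable
  show "AE x in lborel. norm (exp (- \<i> * of_real (\<xi> \<bullet> x)) * u x) \<le> norm (u x)"
    by (rule AE_I2) (simp add: norm_mult)
qed

lemma fourier_diff:
  assumes "integrable lborel u" "integrable lborel v"
  shows "fourier (\<lambda>x. u x - v x) \<xi> = fourier u \<xi> - fourier v \<xi>"
  unfolding fourier_def right_diff_distrib
  by (simp only: Bochner_Integration.integral_diff[OF integrable_fourier_integrand[OF assms(1)] integrable_fourier_integrand[OF assms(2)]] right_diff_distrib)

text \<open>Regularising with a Gaussian turns \<open>\<integral>|\<F>g|\<^sup>2\<close> into \<open>\<integral>\<integral> g(x) cnj(g(y)) k(x - y) dx dy\<close> with a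
  positive kernel \<open>k\<close> of mass \<open>(2\<pi>)\<^sup>n\<close>, which is bounded through
  \<open>2 |g(x)| |g(y)| \<le> |g(x)|\<^sup>2 + |g(y)|\<^sup>2\<close>. This half of Plancherel's theorem is all that is needed.\<close>

lemma gaussian_fourier_bound:
  fixes g :: "'a::euclidean_space \<Rightarrow> complex"
  assumes g: "integrable lborel g" and e: "e > 0"
  shows "(\<integral>\<^sup>+\<xi>. ennreal (exp (- (e\<^sup>2 * (norm \<xi>)\<^sup>2 / 2)) * (cmod (fourier g \<xi>))\<^sup>2) \<partial>lborel)
    \<le> (\<integral>\<^sup>+x. ennreal ((cmod (g x))\<^sup>2) \<partial>lborel)"
proof -
  define \<gamma> where "\<gamma> \<xi> = exp (- (e\<^sup>2 * (norm \<xi>)\<^sup>2 / 2))" for \<xi> :: 'a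
  define G where "G \<xi> = (\<integral>x. exp (- \<i> * of_real (\<xi> \<bullet> x)) * g x \<partial>lborel)" for \<xi>
  define c where "c = (2 * pi) powr (- real DIM('a) / 2)"
  define K where "K = (sqrt (2 * pi) / e) ^ DIM('a)"
  \<comment> \<open>k is the Fourier integral of the Gaussian weight \<gamma>. It is nonnegative
    with a mass independent of e, which is why the regularisation is Gaussian.\<close>
  define k where "k z = K * exp (- ((norm z)\<^sup>2 / (2 * e\<^sup>2)))" for z :: 'a
  have k0: "k z \<ge> 0" for z using e by (simp add: k_def K_def)
  have fG: "fourier g \<xi> = of_real c * G \<xi>" for \<xi> by (simp add: fourier_def c_def G_def)
  have [measurable]: "g \<in> borel_measurable borel" "\<gamma> \<in> borel_measurable borel" "k \<in> borel_measurable borel"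
    using g by (auto simp: \<gamma>_def[abs_def] k_def[abs_def])
  have [measurable]: "G \<in> borel_measurable borel" unfolding G_def[abs_def] by measurable
  have [measurable]: "cnj \<in> borel_measurable borel"
    by (intro borel_measurable_continuous_onI continuous_intros)
  define B where "B = (\<integral>x. cmod (g x) \<partial>lborel)"
  have GB: "cmod (G \<xi>) \<le> B" for \<xi>
    unfolding G_def B_def
    by (rule order_trans[OF integral_norm_bound]) (simp add: norm_mult)
  have \<gamma>i: "integrable lborel \<gamma>" unfolding \<gamma>_def[abs_def] by (rule gaussian_integrable[OF e])
  have ni: "integrable lborel (\<lambda>x. cmod (g x))" using g by simp
  have kern: "(\<integral>\<xi>. exp (\<i> * of_real (\<xi> \<bullet> z)) * of_real (\<gamma> \<xi>) \<partial>lborel) = of_real (k z)" for z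
    unfolding \<gamma>_def k_def K_def by (rule integral_exp_gaussian[OF e])
  \<comment> \<open>Fubini's theorem integrates \<xi> out and leaves the convolution of g with k;
    the weight \<gamma> makes the double integral absolutely convergent.\<close>
  have inner: "(\<integral>\<xi>. of_real (\<gamma> \<xi>) * G \<xi> * exp (\<i> * of_real (\<xi> \<bullet> y)) \<partial>lborel) = (\<integral>x. g x * of_real (k (y - x)) \<partial>lborel)" for y
  proof -
    let ?h = "\<lambda>\<xi> x. of_real (\<gamma> \<xi>) * exp (\<i> * of_real (\<xi> \<bullet> (y - x))) * g x"
    have int: "integrable (lborel \<Otimes>\<^sub>M lborel) (\<lambda>(\<xi>, x). ?h \<xi> x)"
    proof (rule Bochner_Integration.integrable_bound[OF integrable_pair_mult[OF \<gamma>i ni]])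
      show "(\<lambda>(\<xi>, x). ?h \<xi> x) \<in> borel_measurable (lborel \<Otimes>\<^sub>M lborel)" by measurable
    qed (auto simp: norm_mult split_beta' \<gamma>_def)
    have "(\<integral>\<xi>. of_real (\<gamma> \<xi>) * G \<xi> * exp (\<i> * of_real (\<xi> \<bullet> y)) \<partial>lborel) = (\<integral>\<xi>. \<integral>x. ?h \<xi> x \<partial>lborel \<partial>lborel)"
    proof (rule Bochner_Integration.integral_cong[OF refl])
      fix \<xi> :: 'a
      have "of_real (\<gamma> \<xi>) * G \<xi> * exp (\<i> * of_real (\<xi> \<bullet> y)) = (of_real (\<gamma> \<xi>) * exp (\<i> * of_real (\<xi> \<bullet> y))) * G \<xi>" by simp
      also have "\<dots> = (\<integral>x. (of_real (\<gamma> \<xi>) * exp (\<i> * of_real (\<xi> \<bullet> y))) * (exp (- \<i> * of_real (\<xi> \<bullet> x)) * g x) \<partial>lborel)"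
        unfolding G_def by (simp only: integral_mult_right_zero)
      also have "\<dots> = (\<integral>x. ?h \<xi> x \<partial>lborel)"
        by (intro Bochner_Integration.integral_cong)
           (auto simp: inner_diff_right algebra_simps exp_diff exp_minus divide_inverse)
      finally show "of_real (\<gamma> \<xi>) * G \<xi> * exp (\<i> * of_real (\<xi> \<bullet> y)) = (\<integral>x. ?h \<xi> x \<partial>lborel)" .
    qed
    also have "\<dots> = (\<integral>x. \<integral>\<xi>. ?h \<xi> x \<partial>lborel \<partial>lborel)"
      by (rule lborel_pair.Fubini_integral[symmetric]) (rule int)
    also have "\<dots> = (\<integral>x. g x * of_real (k (y - x)) \<partial>lborel)"
    proof (rule Bochner_Integration.integral_cong[OF refl])
      fix x
      have "(\<integral>\<xi>. ?h \<xi> x \<partial>lborel) = (\<integral>\<xi>. g x * (exp (\<i> * of_real (\<xi> \<bullet> (y - x))) * of_real (\<gamma> \<xi>)) \<partial>lborel)"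
        by (intro Bochner_Integration.integral_cong) auto
      also have "\<dots> = g x * of_real (k (y - x))"
        unfolding kern[symmetric] unfolding \<gamma>_def
        by (rule integral_mult_right_zero)
      finally show "(\<integral>\<xi>. ?h \<xi> x \<partial>lborel) = g x * of_real (k (y - x))" .
    qed
    finally show ?thesis .
  qed
  let ?H = "\<lambda>\<xi> y. of_real (\<gamma> \<xi>) * G \<xi> * exp (\<i> * of_real (\<xi> \<bullet> y)) * cnj (g y)"
  have int: "integrable (lborel \<Otimes>\<^sub>M lborel) (\<lambda>(\<xi>, y). ?H \<xi> y)"
  proof (rule Bochner_Integration.integrable_bound[OF integrable_pair_mult[OF integrable_mult_right[OF \<gamma>i, of B] ni]])
    show "(\<lambda>(\<xi>, y). ?H \<xi> y) \<in> borel_measurable (lborel \<Otimes>\<^sub>M lborel)" by measurable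
    have "norm (?H \<xi> y) \<le> norm (B * \<gamma> \<xi> * cmod (g y))" for \<xi> y
    proof -
      have "norm (?H \<xi> y) = \<gamma> \<xi> * cmod (G \<xi>) * cmod (g y)" by (simp add: norm_mult \<gamma>_def)
      also have "\<dots> \<le> \<gamma> \<xi> * B * cmod (g y)" by (intro mult_right_mono mult_left_mono GB) (auto simp: \<gamma>_def)
      also have "\<dots> = norm (B * \<gamma> \<xi> * cmod (g y))"
      proof -
        have "0 \<le> B" "0 \<le> \<gamma> \<xi>" by (auto simp: B_def \<gamma>_def)
        then show ?thesis by (simp add: abs_mult)
      qed
      finally show ?thesis .
    qed
    then show "AE x in lborel \<Otimes>\<^sub>M lborel. norm (case x of (\<xi>, y) \<Rightarrow> ?H \<xi> y) \<le> norm (case x of (x, y) \<Rightarrow> B * \<gamma> x * cmod (g y))"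
      by (auto simp: split_beta')
  qed
  have G2: "(\<integral>y. ?H \<xi> y \<partial>lborel) = of_real (\<gamma> \<xi> * (cmod (G \<xi>))\<^sup>2)" for \<xi>
  proof -
    have "(\<integral>y. ?H \<xi> y \<partial>lborel) = (\<integral>y. (of_real (\<gamma> \<xi>) * G \<xi>) * cnj (exp (- \<i> * of_real (\<xi> \<bullet> y)) * g y) \<partial>lborel)"
      by (intro Bochner_Integration.integral_cong) (auto simp: exp_cnj)
    also have "\<dots> = (of_real (\<gamma> \<xi>) * G \<xi>) * (\<integral>y. cnj (exp (- \<i> * of_real (\<xi> \<bullet> y)) * g y) \<partial>lborel)"
      by (rule integral_mult_right_zero)
    also have "(\<integral>y. cnj (exp (- \<i> * of_real (\<xi> \<bullet> y)) * g y) \<partial>lborel) = cnj (G \<xi>)"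
      unfolding G_def by (rule Bochner_Integration.integral_cnj)
    finally show ?thesis by (simp add: complex_norm_square[symmetric] mult.assoc)
  qed
  have intg: "integrable lborel (\<lambda>\<xi>. \<gamma> \<xi> * (cmod (G \<xi>))\<^sup>2)"
    using integrable_Re[OF lborel_pair.integrable_fst'[OF int]] by (simp add: G2)
  have int': "integrable lborel (\<lambda>y. \<integral>\<xi>. ?H \<xi> y \<partial>lborel)"
    using lborel_pair.integrable_snd[of ?H] int by simp
  have y_int: "(\<integral>\<xi>. ?H \<xi> y \<partial>lborel) = (\<integral>x. g x * of_real (k (y - x)) \<partial>lborel) * cnj (g y)" for y
    unfolding inner[symmetric] by simp
  have "(\<integral>\<xi>. complex_of_real (\<gamma> \<xi> * (cmod (G \<xi>))\<^sup>2) \<partial>lborel) = (\<integral>y. \<integral>\<xi>. ?H \<xi> y \<partial>lborel \<partial>lborel)"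
    unfolding G2[symmetric] by (rule lborel_pair.Fubini_integral[symmetric, OF int])
  then have eq: "complex_of_real (\<integral>\<xi>. \<gamma> \<xi> * (cmod (G \<xi>))\<^sup>2 \<partial>lborel) = (\<integral>y. \<integral>\<xi>. ?H \<xi> y \<partial>lborel \<partial>lborel)"
    by (simp only: integral_complex_of_real)
  have "(\<integral>\<^sup>+\<xi>. ennreal (\<gamma> \<xi> * (cmod (G \<xi>))\<^sup>2) \<partial>lborel) = ennreal (\<integral>\<xi>. \<gamma> \<xi> * (cmod (G \<xi>))\<^sup>2 \<partial>lborel)"
    by (rule nn_integral_eq_integral[OF intg]) (auto simp: \<gamma>_def)
  also have "\<dots> = ennreal (cmod (\<integral>y. \<integral>\<xi>. ?H \<xi> y \<partial>lborel \<partial>lborel))"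
    unfolding eq[symmetric] by (simp add: \<gamma>_def)
  also have "\<dots> \<le> (\<integral>\<^sup>+y. ennreal (cmod (\<integral>\<xi>. ?H \<xi> y \<partial>lborel)) \<partial>lborel)"
    by (rule integral_norm_bound_ennreal[OF int'])
  also have "\<dots> \<le> (\<integral>\<^sup>+y. \<integral>\<^sup>+x. ennreal (1/2) * (ennreal ((cmod (g x))\<^sup>2) * ennreal (k (y - x)) + ennreal ((cmod (g y))\<^sup>2) * ennreal (k (y - x))) \<partial>lborel \<partial>lborel)"
  proof (rule nn_integral_mono)
    fix y
    have "ennreal (cmod (\<integral>\<xi>. ?H \<xi> y \<partial>lborel)) = ennreal (cmod (\<integral>x. g x * of_real (k (y - x)) * cnj (g y) \<partial>lborel))"
      unfolding y_int by simp
    also have "\<dots> \<le> (\<integral>\<^sup>+x. ennreal (cmod (g x * of_real (k (y - x)) * cnj (g y))) \<partial>lborel)"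
    \<comment> \<open>The norm bound asks for integrability; without it the Bochner integral is 0 by
      convention and the estimate is trivial.\<close>
    proof (cases "integrable lborel (\<lambda>x. g x * of_real (k (y - x)) * cnj (g y))")
      case False then show ?thesis by (subst not_integrable_integral_eq) auto
    qed (rule integral_norm_bound_ennreal)
    also have "\<dots> \<le> (\<integral>\<^sup>+x. ennreal (1/2) * (ennreal ((cmod (g x))\<^sup>2) * ennreal (k (y - x)) + ennreal ((cmod (g y))\<^sup>2) * ennreal (k (y - x))) \<partial>lborel)"
    proof (rule nn_integral_mono)
      fix x
      have "cmod (g x * of_real (k (y - x)) * cnj (g y)) = (cmod (g x) * cmod (g y)) * k (y - x)"
        using k0 by (simp add: norm_mult)
      also have "\<dots> \<le> (1/2 * ((cmod (g x))\<^sup>2 + (cmod (g y))\<^sup>2)) * k (y - x)"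
        using sum_squares_bound[of "cmod (g x)" "cmod (g y)"] by (intro mult_right_mono k0) (simp add: field_simps)
      also have "\<dots> = 1/2 * ((cmod (g x))\<^sup>2 * k (y - x) + (cmod (g y))\<^sup>2 * k (y - x))" by (simp add: algebra_simps)
      finally have "ennreal (cmod (g x * of_real (k (y - x)) * cnj (g y))) \<le> ennreal (1/2 * ((cmod (g x))\<^sup>2 * k (y - x) + (cmod (g y))\<^sup>2 * k (y - x)))"
        by (rule ennreal_leI)
      then show "ennreal (cmod (g x * of_real (k (y - x)) * cnj (g y))) \<le> ennreal (1/2) * (ennreal ((cmod (g x))\<^sup>2) * ennreal (k (y - x)) + ennreal ((cmod (g y))\<^sup>2) * ennreal (k (y - x)))"
        using k0 by (simp only: ennreal_mult' ennreal_plus mult_nonneg_nonneg zero_le_power2 zero_le_divide_1_iff zero_le_numeral)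
    qed
    finally show "ennreal (cmod (\<integral>\<xi>. ?H \<xi> y \<partial>lborel)) \<le> \<dots>" .
  qed
  also have "\<dots> = ennreal (1/2) * ((\<integral>\<^sup>+y. \<integral>\<^sup>+x. ennreal ((cmod (g x))\<^sup>2) * ennreal (k (y - x)) \<partial>lborel \<partial>lborel)
       + (\<integral>\<^sup>+y. \<integral>\<^sup>+x. ennreal ((cmod (g y))\<^sup>2) * ennreal (k (y - x)) \<partial>lborel \<partial>lborel))"
    by (simp add: nn_integral_cmult nn_integral_add)
  also have "(\<integral>\<^sup>+y. \<integral>\<^sup>+x. ennreal ((cmod (g x))\<^sup>2) * ennreal (k (y - x)) \<partial>lborel \<partial>lborel)
      = (\<integral>\<^sup>+x. \<integral>\<^sup>+y. ennreal ((cmod (g x))\<^sup>2) * ennreal (k (y - x)) \<partial>lborel \<partial>lborel)"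
    by (rule lborel_pair.Fubini') measurable
  also have "\<dots> = (\<integral>\<^sup>+x. ennreal ((cmod (g x))\<^sup>2) * (\<integral>\<^sup>+z. ennreal (k z) \<partial>lborel) \<partial>lborel)"
  proof (rule nn_integral_cong)
    fix x
    have "(\<integral>\<^sup>+y. ennreal ((cmod (g x))\<^sup>2) * ennreal (k (y - x)) \<partial>lborel) = ennreal ((cmod (g x))\<^sup>2) * (\<integral>\<^sup>+y. ennreal (k (y - x)) \<partial>lborel)"
      by (rule nn_integral_cmult) measurable
    then show "(\<integral>\<^sup>+y. ennreal ((cmod (g x))\<^sup>2) * ennreal (k (y - x)) \<partial>lborel) = ennreal ((cmod (g x))\<^sup>2) * (\<integral>\<^sup>+z. ennreal (k z) \<partial>lborel)"
      using nn_integral_translation[of "\<lambda>z. ennreal (k z)" "- x"] by simp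
  qed
  also have "(\<integral>\<^sup>+y. \<integral>\<^sup>+x. ennreal ((cmod (g y))\<^sup>2) * ennreal (k (y - x)) \<partial>lborel \<partial>lborel)
     = (\<integral>\<^sup>+x. ennreal ((cmod (g x))\<^sup>2) * (\<integral>\<^sup>+z. ennreal (k z) \<partial>lborel) \<partial>lborel)"
  proof (rule nn_integral_cong)
    fix y
    have "(\<integral>\<^sup>+x. ennreal ((cmod (g y))\<^sup>2) * ennreal (k (y - x)) \<partial>lborel) = ennreal ((cmod (g y))\<^sup>2) * (\<integral>\<^sup>+x. ennreal (k (y - x)) \<partial>lborel)"
      by (rule nn_integral_cmult) measurable
    moreover have "k (y - x) = k (x - y)" for x by (simp add: k_def norm_minus_commute)
    ultimately show "(\<integral>\<^sup>+x. ennreal ((cmod (g y))\<^sup>2) * ennreal (k (y - x)) \<partial>lborel) = ennreal ((cmod (g y))\<^sup>2) * (\<integral>\<^sup>+z. ennreal (k z) \<partial>lborel)"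
      using nn_integral_translation[of "\<lambda>z. ennreal (k z)" "- y"] by simp
  qed
  also have "(\<integral>\<^sup>+x. ennreal ((cmod (g x))\<^sup>2) * (\<integral>\<^sup>+z. ennreal (k z) \<partial>lborel) \<partial>lborel)
      = (\<integral>\<^sup>+x. ennreal ((cmod (g x))\<^sup>2) \<partial>lborel) * (\<integral>\<^sup>+z. ennreal (k z) \<partial>lborel)"
    by (rule nn_integral_multc) measurable
  also have "(\<integral>\<^sup>+z. ennreal (k z) \<partial>lborel) = ennreal ((2 * pi) ^ DIM('a))"
  proof -
    have K0: "K \<ge> 0" using e by (simp add: K_def)
    have "(\<integral>\<^sup>+z. ennreal (k z) \<partial>lborel) = ennreal K * ennreal ((sqrt (2 * pi) * e) ^ DIM('a))"
      unfolding k_def[abs_def] using K0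
      by (simp add: ennreal_mult nn_integral_cmult nn_integral_gaussian[OF e])
    also have "\<dots> = ennreal (K * (sqrt (2 * pi) * e) ^ DIM('a))" using K0 e by (simp add: ennreal_mult)
    also have "K * (sqrt (2 * pi) * e) ^ DIM('a) = (2 * pi) ^ DIM('a)"
      unfolding K_def power_mult_distrib[symmetric] using e by simp
    finally show ?thesis .
  qed
  also have "ennreal (1/2) * ((\<integral>\<^sup>+x. ennreal ((cmod (g x))\<^sup>2) \<partial>lborel) * ennreal ((2 * pi) ^ DIM('a)) + (\<integral>\<^sup>+x. ennreal ((cmod (g x))\<^sup>2) \<partial>lborel) * ennreal ((2 * pi) ^ DIM('a)))
     = ennreal ((2 * pi) ^ DIM('a)) * (\<integral>\<^sup>+x. ennreal ((cmod (g x))\<^sup>2) \<partial>lborel)"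
  proof -
    have half: "ennreal (1/2) * (x + x) = x" for x
    proof -
      have "ennreal (1/2) * (x + x) = (ennreal (1/2) + ennreal (1/2)) * x" by (simp only: distrib_left distrib_right)
      also have "ennreal (1/2) + ennreal (1/2) = ennreal (1/2 + 1/2)" by (rule ennreal_plus[symmetric]) auto
      also have "\<dots> = 1" by simp
      finally show ?thesis by simp
    qed
    show ?thesis by (simp only: half mult.commute[of "ennreal ((2 * pi) ^ DIM('a))"])
  qed
  finally have main: "(\<integral>\<^sup>+\<xi>. ennreal (\<gamma> \<xi> * (cmod (G \<xi>))\<^sup>2) \<partial>lborel) \<le> ennreal ((2 * pi) ^ DIM('a)) * (\<integral>\<^sup>+x. ennreal ((cmod (g x))\<^sup>2) \<partial>lborel)" .
  \<comment> \<open>The mass (2 pi)^n of k cancels exactly against the squared normalisation of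
    \<open>fourier\<close>.\<close>
  have c2: "c\<^sup>2 * (2 * pi) ^ DIM('a) = 1"
  proof -
    have "c\<^sup>2 = (2 * pi) powr (- real DIM('a))" unfolding c_def by (simp add: powr_power)
    also have "\<dots> = inverse ((2 * pi) ^ DIM('a))" by (simp only: powr_minus) (simp add: powr_realpow)
    finally have "c\<^sup>2 = inverse ((2 * pi) ^ DIM('a))" .
    then show ?thesis by (simp only:) (rule left_inverse, simp)
  qed
  have "(\<integral>\<^sup>+\<xi>. ennreal (\<gamma> \<xi> * (cmod (fourier g \<xi>))\<^sup>2) \<partial>lborel) = (\<integral>\<^sup>+\<xi>. ennreal (c\<^sup>2) * ennreal (\<gamma> \<xi> * (cmod (G \<xi>))\<^sup>2) \<partial>lborel)"
    by (intro nn_integral_cong) (simp add: fG norm_mult power_mult_distrib mult.left_commute \<gamma>_def flip: ennreal_mult)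
  also have "\<dots> = ennreal (c\<^sup>2) * (\<integral>\<^sup>+\<xi>. ennreal (\<gamma> \<xi> * (cmod (G \<xi>))\<^sup>2) \<partial>lborel)"
    by (rule nn_integral_cmult) measurable
  also have "\<dots> \<le> ennreal (c\<^sup>2) * (ennreal ((2 * pi) ^ DIM('a)) * (\<integral>\<^sup>+x. ennreal ((cmod (g x))\<^sup>2) \<partial>lborel))"
    by (intro mult_left_mono main) simp
  also have "\<dots> = (\<integral>\<^sup>+x. ennreal ((cmod (g x))\<^sup>2) \<partial>lborel)"
    using c2 by (simp add: mult.assoc[symmetric] ennreal_mult[symmetric])
  finally show ?thesis unfolding \<gamma>_def .
qed

text \<open>Fatou's lemma along e = 1 / (n + 1), as the Gaussian weights tend to 1.\<close>

lemma fourier_norm_le: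
  fixes g :: "'a::euclidean_space \<Rightarrow> complex"
  assumes g: "integrable lborel g"
  shows "(\<integral>\<^sup>+\<xi>. ennreal ((cmod (fourier g \<xi>))\<^sup>2) \<partial>lborel) \<le> (\<integral>\<^sup>+x. ennreal ((cmod (g x))\<^sup>2) \<partial>lborel)"
proof -
  have [measurable]: "g \<in> borel_measurable borel" using g by auto
  let ?f = "\<lambda>n \<xi>. ennreal (exp (- ((1 / real (Suc n))\<^sup>2 * (norm \<xi>)\<^sup>2 / 2)) * (cmod (fourier g \<xi>))\<^sup>2)"
  have lim: "(\<lambda>n. ?f n \<xi>) \<longlonglongrightarrow> ennreal ((cmod (fourier g \<xi>))\<^sup>2)" for \<xi>
  proof -
    have "(\<lambda>n. exp (- ((1 / real (Suc n))\<^sup>2 * (norm \<xi>)\<^sup>2 / 2)) * (cmod (fourier g \<xi>))\<^sup>2)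
        \<longlonglongrightarrow> exp (- (0\<^sup>2 * (norm \<xi>)\<^sup>2 / 2)) * (cmod (fourier g \<xi>))\<^sup>2"
      using LIMSEQ_inverse_real_of_nat by (intro tendsto_intros) (simp_all add: inverse_eq_divide)
    then show ?thesis by (intro tendsto_ennrealI) simp
  qed
  have "(\<integral>\<^sup>+\<xi>. ennreal ((cmod (fourier g \<xi>))\<^sup>2) \<partial>lborel) = (\<integral>\<^sup>+\<xi>. liminf (\<lambda>n. ?f n \<xi>) \<partial>lborel)"
    using lim by (intro nn_integral_cong lim_imp_Liminf[symmetric]) auto
  also have "\<dots> \<le> liminf (\<lambda>n. \<integral>\<^sup>+\<xi>. ?f n \<xi> \<partial>lborel)"
    by (rule nn_integral_liminf) measurable
  also have "\<dots> \<le> (\<integral>\<^sup>+x. ennreal ((cmod (g x))\<^sup>2) \<partial>lborel)"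
    by (rule order_trans[OF Liminf_le_Limsup Limsup_bounded]) (auto intro!: always_eventually gaussian_fourier_bound[OF g])
  finally show ?thesis .
qed

section \<open>Exponentials and integration by parts against them\<close>

lemma has_derivative_exp_inner:
  fixes \<eta> :: "'a::euclidean_space" and c z :: complex
  shows "((\<lambda>x. c * exp (z * of_real (\<eta> \<bullet> x))) has_derivative (\<lambda>h. (c * (z * of_real (\<eta> \<bullet> h))) * exp (z * of_real (\<eta> \<bullet> x)))) (at x)"
proof -
  have "((\<lambda>x. z * complex_of_real (\<eta> \<bullet> x)) has_derivative (\<lambda>h. z * of_real (\<eta> \<bullet> h))) (at x)"
    by (auto intro!: derivative_eq_intros)
  then have "((\<lambda>x. exp (z * complex_of_real (\<eta> \<bullet> x))) has_derivative (\<lambda>h. exp (z * of_real (\<eta> \<bullet> x)) * (z * of_real (\<eta> \<bullet> h)))) (at x)"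
    using has_derivative_compose[of "\<lambda>x. z * complex_of_real (\<eta> \<bullet> x)" _ x UNIV exp] DERIV_exp[of "z * complex_of_real (\<eta> \<bullet> x)"]
    by (fastforce simp: has_field_derivative_def)
  from has_derivative_mult_right[OF this, of c] show ?thesis by (simp add: mult.commute mult.left_commute)
qed

lemma pderiv_dir_exp_inner:
  fixes \<eta> :: "'a::euclidean_space" and c z :: complex
  shows "pderiv_dir b (\<lambda>x. c * exp (z * of_real (\<eta> \<bullet> x))) = (\<lambda>x. (c * (z * of_real (\<eta> \<bullet> b))) * exp (z * of_real (\<eta> \<bullet> x)))"
  by (rule ext) (rule pderiv_dir_eqI[OF has_derivative_exp_inner])

lemma C_class_exp_inner:
  fixes \<eta> :: "'a::euclidean_space" and c z :: complex
  shows "C_class k (\<lambda>x. c * exp (z * of_real (\<eta> \<bullet> x)))"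
proof (induction k arbitrary: c)
  case (Suc k)
  show ?case unfolding C_class.simps pderiv_dir_exp_inner
    using has_derivative_exp_inner Suc by (blast intro: differentiableI)
qed (auto intro!: continuous_intros)

text \<open>One integration by parts for both uses of exponentials: z = - \<i> gives the Fourier
  transform of a derivative, z = 1 the test against exp (\<eta> \<bullet> x).\<close>

lemma integral_exp_pderiv_dir:
  fixes f :: "'a::euclidean_space \<Rightarrow> complex" and z :: complex
  assumes f: "f \<in> C1_functions" and b: "b \<in> Basis"
  shows "(\<integral>x. exp (z * of_real (\<eta> \<bullet> x)) * pderiv_dir b f x \<partial>lborel)
     = - (z * of_real (\<eta> \<bullet> b)) * (\<integral>x. exp (z * of_real (\<eta> \<bullet> x)) * f x \<partial>lborel)"
proof -
  let ?e = "\<lambda>x. exp (z * of_real (\<eta> \<bullet> x))"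
  have e1: "C_class 1 ?e" using C_class_exp_inner[where k=1 and c=1 and z=z and \<eta>=\<eta>] by (simp del: One_nat_def)
  have d: "?e differentiable (at x)" for x using e1 by simp
  have pe: "pderiv_dir b ?e x = z * of_real (\<eta> \<bullet> b) * ?e x" for x
    using fun_cong[OF pderiv_dir_exp_inner[where b=b and c=1 and z=z and \<eta>=\<eta>], of x] by simp
  have ec: "continuous_on UNIV ?e" by (intro continuous_intros)
  have "(\<integral>x. pderiv_dir b (\<lambda>x. f x * ?e x) x \<partial>lborel) = 0"
    by (rule integral_pderiv_dir_eq_0[OF C1_mult[OF f e1] b])
  moreover have "pderiv_dir b (\<lambda>x. f x * ?e x) x = ?e x * pderiv_dir b f x + (z * of_real (\<eta> \<bullet> b)) * (?e x * f x)" for x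
    by (simp add: pderiv_dir_mult[OF C1_differentiable[OF f] d] pe)
  moreover have i1: "integrable lborel (\<lambda>x. ?e x * pderiv_dir b f x)"
    by (rule integrable_continuous_bounded_support)
       (auto intro!: continuous_on_mult ec C1_continuous_pderiv[OF f b] C1_bounded_support_pderiv[OF f])
  moreover have i2: "integrable lborel (\<lambda>x. ?e x * f x)"
    by (rule integrable_continuous_bounded_support)
       (auto intro!: continuous_on_mult ec C1_continuous[OF f] C1_bounded_support[OF f])
  ultimately have "(\<integral>x. ?e x * pderiv_dir b f x \<partial>lborel) + (z * of_real (\<eta> \<bullet> b)) * (\<integral>x. ?e x * f x \<partial>lborel) = 0"
    by (simp add: Bochner_Integration.integral_add integrable_mult_right)
  then show ?thesis by (simp add: add_eq_0_iff)
qed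

lemma fourier_pderiv_dir:
  assumes "f \<in> C1_functions" "b \<in> Basis"
  shows "fourier (pderiv_dir b f) \<xi> = \<i> * of_real (\<xi> \<bullet> b) * fourier f \<xi>"
  unfolding fourier_def integral_exp_pderiv_dir[OF assms] by simp

lemma
  assumes "f \<in> C1_functions"
  shows C1_integrable: "integrable lborel f" and C1_square_integrable: "square_integrable f"
  using integrable_continuous_bounded_support[OF C1_continuous C1_bounded_support]
    square_integrable_continuous_bounded_support[OF C1_continuous C1_bounded_support] assms by blast+

lemma
  assumes "f \<in> C1_functions" "b \<in> Basis"
  shows C1_pderiv_integrable: "integrable lborel (pderiv_dir b f)"
    and C1_pderiv_square_integrable: "square_integrable (pderiv_dir b f)"
  using integrable_continuous_bounded_support[OF C1_continuous_pderiv C1_bounded_support_pderiv]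
    square_integrable_continuous_bounded_support[OF C1_continuous_pderiv C1_bounded_support_pderiv] assms by blast+

section \<open>Gradients as functions into \<open>\<real>\<^sup>n \<times> \<real>\<^sup>n\<close>\<close>

text \<open>Turns n complex numbers into an element of a Euclidean space type, so that complex
  gradients fit into \<open>L2\<close>; the norm is that of C^n, the scalar product the real part of
  the Hermitian one.\<close>

definition real_imag_vector :: "('a::euclidean_space \<Rightarrow> complex) \<Rightarrow> 'a \<times> 'a" where
  "real_imag_vector g = (\<Sum>b\<in>Basis. Re (g b) *\<^sub>R b, \<Sum>b\<in>Basis. Im (g b) *\<^sub>R b)"

definition gradient :: "('a::euclidean_space \<Rightarrow> complex) \<Rightarrow> 'a \<Rightarrow> 'a \<times> 'a" where
  "gradient f x = real_imag_vector (\<lambda>b. pderiv_dir b f x)"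

lemma inner_real_imag_vector: "real_imag_vector g \<bullet> real_imag_vector h = (\<Sum>b\<in>Basis. g b \<bullet> h b)"
proof -
  have "(\<Sum>b\<in>Basis. r b *\<^sub>R b) \<bullet> (\<Sum>b\<in>Basis. s b *\<^sub>R b) = (\<Sum>b\<in>Basis. r b * s b)" for r s :: "'a \<Rightarrow> real"
    by (simp add: inner_sum_right mult.commute)
  then show ?thesis by (simp add: real_imag_vector_def inner_prod_def inner_complex_def sum.distrib)
qed

lemma norm_real_imag_vector: "(norm (real_imag_vector g))\<^sup>2 = (\<Sum>b\<in>Basis. (cmod (g b))\<^sup>2)"
  unfolding power2_norm_eq_inner inner_real_imag_vector ..

lemma real_imag_vector_diff: "real_imag_vector g - real_imag_vector h = real_imag_vector (\<lambda>b. g b - h b)"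
  by (simp add: real_imag_vector_def sum_subtractf scaleR_diff_left)

lemma real_imag_vector_add: "real_imag_vector g + real_imag_vector h = real_imag_vector (\<lambda>b. g b + h b)"
  by (simp add: real_imag_vector_def sum.distrib scaleR_add_left)

lemma real_imag_vector_scaleR: "c *\<^sub>R real_imag_vector g = real_imag_vector (\<lambda>b. c *\<^sub>R g b)"
  by (simp add: real_imag_vector_def scaleR_sum_right)

lemma square_integrable_real_imag_vector:
  fixes G :: "'a::euclidean_space \<Rightarrow> 'a \<Rightarrow> complex"
  assumes "\<And>b. b \<in> Basis \<Longrightarrow> square_integrable (G b)"
  shows "square_integrable (\<lambda>x. real_imag_vector (\<lambda>b. G b x))"
proof -
  have [measurable]: "b \<in> Basis \<Longrightarrow> G b \<in> borel_measurable borel" for b using assms[of b] by (simp add: square_integrable_def)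
  have "(\<lambda>x. real_imag_vector (\<lambda>b. G b x)) \<in> borel_measurable borel"
    unfolding real_imag_vector_def by (intro borel_measurable_Pair borel_measurable_sum) auto
  moreover have "integrable lborel (\<lambda>x. \<Sum>b\<in>Basis. (cmod (G b x))\<^sup>2)"
    using assms by (intro Bochner_Integration.integrable_sum) (simp add: square_integrable_def)
  ultimately show ?thesis by (simp add: square_integrable_def norm_real_imag_vector)
qed

lemma C1_gradient_square_integrable: "f \<in> C1_functions \<Longrightarrow> square_integrable (gradient f)"
  unfolding gradient_def[abs_def] by (intro square_integrable_real_imag_vector C1_pderiv_square_integrable)

lemma inner_L2_gradient:
  assumes "f \<in> C1_functions" "g \<in> C1_functions"
  shows "L2 (gradient f) \<bullet> L2 (gradient g) = (\<Sum>b\<in>Basis. \<integral>x. pderiv_dir b f x \<bullet> pderiv_dir b g x \<partial>lborel)"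
proof -
  have "L2 (gradient f) \<bullet> L2 (gradient g) = (\<integral>x. (\<Sum>b\<in>Basis. pderiv_dir b f x \<bullet> pderiv_dir b g x) \<partial>lborel)"
    using assms by (simp add: L2_inner_eq C1_gradient_square_integrable) (simp add: gradient_def inner_real_imag_vector)
  also have "\<dots> = (\<Sum>b\<in>Basis. \<integral>x. pderiv_dir b f x \<bullet> pderiv_dir b g x \<partial>lborel)"
    by (intro Bochner_Integration.integral_sum integrable_inner_square C1_pderiv_square_integrable assms)
  finally show ?thesis .
qed

text \<open>\<open>fourier_norm_le\<close> for each partial derivative, summed: the factors |\<xi>
  \<bullet> b|^2 add up to |\<xi>|^2.\<close>

lemma fourier_gradient_bound:
  assumes f: "f \<in> C1_functions"
  shows "(\<integral>\<^sup>+\<xi>. ennreal ((norm \<xi>)\<^sup>2 * (cmod (fourier f \<xi>))\<^sup>2) \<partial>lborel) \<le> ennreal ((norm (L2 (gradient f)))\<^sup>2)"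
proof -
  have [measurable]: "f \<in> borel_measurable borel" using C1_integrable[OF f] by auto
  have n2: "(norm x)\<^sup>2 = (\<Sum>b\<in>Basis. (x \<bullet> b)\<^sup>2)" for x :: 'a
    unfolding power2_norm_eq_inner by (subst euclidean_inner) (simp add: power2_eq_square)
  have "(\<integral>\<^sup>+\<xi>. ennreal ((norm \<xi>)\<^sup>2 * (cmod (fourier f \<xi>))\<^sup>2) \<partial>lborel)
     = (\<integral>\<^sup>+\<xi>. (\<Sum>b\<in>Basis. ennreal ((cmod (fourier (pderiv_dir b f) \<xi>))\<^sup>2)) \<partial>lborel)"
    by (intro nn_integral_cong)
       (simp add: n2 fourier_pderiv_dir[OF f] norm_mult power_mult_distrib sum_distrib_right sum_ennreal)
  also have "\<dots> = (\<Sum>b\<in>Basis. \<integral>\<^sup>+\<xi>. ennreal ((cmod (fourier (pderiv_dir b f) \<xi>))\<^sup>2) \<partial>lborel)"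
  proof (rule nn_integral_sum)
    fix b :: 'a assume "b \<in> Basis"
    then have [measurable]: "pderiv_dir b f \<in> borel_measurable borel" using C1_pderiv_integrable[OF f] by auto
    show "(\<lambda>\<xi>. ennreal ((cmod (fourier (pderiv_dir b f) \<xi>))\<^sup>2)) \<in> borel_measurable lborel" by measurable
  qed
  also have "\<dots> \<le> (\<Sum>b\<in>Basis. \<integral>\<^sup>+x. ennreal ((cmod (pderiv_dir b f x))\<^sup>2) \<partial>lborel)"
    by (intro sum_mono fourier_norm_le C1_pderiv_integrable f)
  also have "\<dots> = (\<integral>\<^sup>+x. (\<Sum>b\<in>Basis. ennreal ((cmod (pderiv_dir b f x))\<^sup>2)) \<partial>lborel)"
  proof (rule nn_integral_sum[symmetric])
    fix b :: 'a assume "b \<in> Basis"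
    then have [measurable]: "pderiv_dir b f \<in> borel_measurable borel" using C1_pderiv_integrable[OF f] by auto
    show "(\<lambda>x. ennreal ((cmod (pderiv_dir b f x))\<^sup>2)) \<in> borel_measurable lborel" by measurable
  qed
  also have "\<dots> = ennreal ((norm (L2 (gradient f)))\<^sup>2)"
    unfolding ennreal_norm_L2_square[OF C1_gradient_square_integrable[OF f]]
    by (simp add: gradient_def norm_real_imag_vector sum_ennreal)
  finally show ?thesis .
qed

text \<open>Pointwise in \<open>\<xi>\<close> this is \<open>min\<^sub>w (|\<xi>|\<^sup>2 |w|\<^sup>2 + t |v - w|\<^sup>2) = t |\<xi>|\<^sup>2 / (t + |\<xi>|\<^sup>2) |v|\<^sup>2\<close>.\<close>

lemma resolvent_form_le_energy:
  fixes u f :: "'a::euclidean_space \<Rightarrow> complex"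
  assumes f: "f \<in> C1_functions" and u: "integrable lborel u" "square_integrable u" and t: "t > 0"
  shows "(\<integral>\<^sup>+\<xi>. ennreal (t * (norm \<xi>)\<^sup>2 / (t + (norm \<xi>)\<^sup>2) * (cmod (fourier u \<xi>))\<^sup>2) \<partial>lborel)
    \<le> ennreal ((norm (L2 (gradient f)))\<^sup>2 + t * (norm (L2 u - L2 f))\<^sup>2)"
proof -
  have fi: "integrable lborel f" "square_integrable f" using C1_integrable[OF f] C1_square_integrable[OF f] by auto
  have [measurable]: "f \<in> borel_measurable borel" "u \<in> borel_measurable borel" using fi u by auto
  have pw: "t * r / (t + r) * (cmod v)\<^sup>2 \<le> r * (cmod w)\<^sup>2 + t * (cmod (v - w))\<^sup>2" if r: "r \<ge> 0" for r :: real and v w :: complex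
  proof -
    have tr: "t + r > 0" using t r by linarith
    \<comment> \<open>Completing the square: t + r times the difference of the two sides is |(t + r)
      w - t v|^2, zero at the minimiser w = t v / (t + r).\<close>
    have "(t + r) * (r * (cmod w)\<^sup>2 + t * (cmod (v - w))\<^sup>2) - t * r * (cmod v)\<^sup>2 = (cmod ((t + r) *\<^sub>R w - t *\<^sub>R v))\<^sup>2"
      by (simp add: power2_norm_eq_inner inner_complex_def) (simp add: algebra_simps power2_eq_square)
    also have "\<dots> \<ge> 0" by simp
    finally show ?thesis using tr by (simp add: pos_divide_le_eq mult.commute)
  qed
  have "(\<integral>\<^sup>+\<xi>. ennreal (t * (norm \<xi>)\<^sup>2 / (t + (norm \<xi>)\<^sup>2) * (cmod (fourier u \<xi>))\<^sup>2) \<partial>lborel)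
    \<le> (\<integral>\<^sup>+\<xi>. ennreal ((norm \<xi>)\<^sup>2 * (cmod (fourier f \<xi>))\<^sup>2) + ennreal t * ennreal ((cmod (fourier (\<lambda>x. u x - f x) \<xi>))\<^sup>2) \<partial>lborel)"
  proof (rule nn_integral_mono)
    fix \<xi> :: 'a
    have "ennreal (t * (norm \<xi>)\<^sup>2 / (t + (norm \<xi>)\<^sup>2) * (cmod (fourier u \<xi>))\<^sup>2)
      \<le> ennreal ((norm \<xi>)\<^sup>2 * (cmod (fourier f \<xi>))\<^sup>2 + t * (cmod (fourier (\<lambda>x. u x - f x) \<xi>))\<^sup>2)"
      unfolding fourier_diff[OF u(1) fi(1)] by (intro ennreal_leI pw) simp
    then show "ennreal (t * (norm \<xi>)\<^sup>2 / (t + (norm \<xi>)\<^sup>2) * (cmod (fourier u \<xi>))\<^sup>2)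
      \<le> ennreal ((norm \<xi>)\<^sup>2 * (cmod (fourier f \<xi>))\<^sup>2) + ennreal t * ennreal ((cmod (fourier (\<lambda>x. u x - f x) \<xi>))\<^sup>2)"
      using t by (simp add: ennreal_plus ennreal_mult)
  qed
  also have "\<dots> = (\<integral>\<^sup>+\<xi>. ennreal ((norm \<xi>)\<^sup>2 * (cmod (fourier f \<xi>))\<^sup>2) \<partial>lborel)
      + ennreal t * (\<integral>\<^sup>+\<xi>. ennreal ((cmod (fourier (\<lambda>x. u x - f x) \<xi>))\<^sup>2) \<partial>lborel)"
    by (subst nn_integral_add) (auto simp: nn_integral_cmult)
  also have "\<dots> \<le> ennreal ((norm (L2 (gradient f)))\<^sup>2) + ennreal t * (\<integral>\<^sup>+x. ennreal ((cmod (u x - f x))\<^sup>2) \<partial>lborel)"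
    using fi u by (intro add_mono mult_left_mono fourier_gradient_bound f fourier_norm_le) auto
  also have "(\<integral>\<^sup>+x. ennreal ((cmod (u x - f x))\<^sup>2) \<partial>lborel) = ennreal ((norm (L2 u - L2 f))\<^sup>2)"
    using fi u by (simp add: L2_minus ennreal_norm_L2_square square_integrable_diff)
  finally show ?thesis using t by (simp add: ennreal_plus ennreal_mult)
qed

text \<open>The exponential has unbounded support, so it cannot serve in a competitor for
  \<open>D_form_le_energy\<close> and is cut off far out. The cross terms computed later pair it
  with functions vanishing outside S and do not see the cut-off.\<close>

lemma exists_C1_extension_of_exp:
  fixes \<eta> :: "'a::euclidean_space"
  assumes "bounded S"
  obtains \<psi> where "\<psi> \<in> C1_functions"
    "\<And>x. x \<in> S \<Longrightarrow> \<psi> x = exp (of_real (\<eta> \<bullet> x))"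
    "\<And>x b. x \<in> S \<Longrightarrow> pderiv_dir b \<psi> x = of_real (\<eta> \<bullet> b) * exp (of_real (\<eta> \<bullet> x))"
proof -
  obtain R where R: "R > 0" "S \<subseteq> ball 0 R" using bounded_subset_ball_radius[OF assms] by metis
  \<comment> \<open>A C^1 function that vanishes exactly for y \<le> 0; membership in
    \<open>C1_functions\<close> asks for no more smoothness.\<close>
  define q where "q y = (max 0 y)\<^sup>2" for y :: real
  have q': "(q has_real_derivative 2 * max 0 y) (at y)" for y
  proof -
    consider "y > 0" | "y < 0" | "y = 0" by linarith
    then show ?thesis
    proof cases
      case 1
      have "((\<lambda>y. y\<^sup>2) has_real_derivative 2 * max 0 y) (at y)" using 1 by (auto intro!: derivative_eq_intros)
      then show ?thesis
        by (rule has_field_derivative_transform_within_open[of _ _ _ "{0<..}"]) (use 1 in \<open>auto simp: q_def\<close>)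
    next
      case 2
      have "((\<lambda>y. 0) has_real_derivative 2 * max 0 y) (at y)" using 2 by simp
      then show ?thesis
        by (rule has_field_derivative_transform_within_open[of _ _ _ "{..<0}"]) (use 2 in \<open>auto simp: q_def\<close>)
    next
      case 3
      have "((\<lambda>h. (q (0 + h) - q 0) / h) \<longlongrightarrow> 0) (at 0)"
      proof (rule Lim_null_comparison)
        show "\<forall>\<^sub>F h in at 0. norm ((q (0 + h) - q 0) / h) \<le> \<bar>h\<bar>"
          by (rule always_eventually) (auto simp: q_def max_def power2_eq_square)
        show "((\<lambda>h. \<bar>h\<bar>) \<longlongrightarrow> 0) (at (0::real))" by (auto intro!: tendsto_eq_intros)
      qed
      then show ?thesis using 3 by (simp add: DERIV_def)
    qed
  qed
  \<comment> \<open>For |x| \<le> R the inner q vanishes and \<open>cut\<close> is q 1 = 1; beyond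
    radius R + 1 one has |x|^2 - R^2 \<ge> 1, so r x \<le> 0 and \<open>cut\<close> is 0.\<close>
  define r where "r x = 1 - q (x \<bullet> x - R\<^sup>2)" for x :: 'a
  define cut where "cut x = q (r x)" for x
  define D where "D b x = 2 * max 0 (r x) * (- (2 * max 0 (x \<bullet> x - R\<^sup>2)) * (2 * (x \<bullet> b)))" for b x :: 'a
  have dcut: "(cut has_derivative (\<lambda>h. D h x)) (at x)" for x
  proof -
    have 1: "((\<lambda>x. x \<bullet> x - R\<^sup>2) has_derivative (\<lambda>h. 2 * (x \<bullet> h))) (at x)"
      by (auto intro!: derivative_eq_intros simp: inner_commute)
    have 2: "((\<lambda>x. q (x \<bullet> x - R\<^sup>2)) has_derivative (\<lambda>h. 2 * max 0 (x \<bullet> x - R\<^sup>2) * (2 * (x \<bullet> h)))) (at x)"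
      using has_derivative_compose[OF 1] q'[of "x \<bullet> x - R\<^sup>2"] unfolding has_field_derivative_def by blast
    have 3: "(r has_derivative (\<lambda>h. - (2 * max 0 (x \<bullet> x - R\<^sup>2) * (2 * (x \<bullet> h))))) (at x)"
      unfolding r_def[abs_def] using has_derivative_diff[OF has_derivative_const[of 1] 2] by simp
    have "(cut has_derivative (\<lambda>h. 2 * max 0 (r x) * (- (2 * max 0 (x \<bullet> x - R\<^sup>2) * (2 * (x \<bullet> h)))))) (at x)"
      unfolding cut_def[abs_def] using has_derivative_compose[OF 3] q'[of "r x"] unfolding has_field_derivative_def by blast
    then show ?thesis by (simp add: D_def)
  qed
  let ?cut = "\<lambda>x. complex_of_real (cut x)"
  have dc: "(?cut has_derivative (\<lambda>h. complex_of_real (D h x))) (at x)" for x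
    using has_derivative_of_real[OF dcut] .
  have pc: "pderiv_dir b ?cut = (\<lambda>x. complex_of_real (D b x))" for b
    by (rule ext) (rule pderiv_dir_eqI[OF dc])
  have Dc: "continuous_on UNIV (D b)" for b unfolding D_def r_def q_def by (intro continuous_intros)
  have out: "cut x = 0" if "x \<notin> cball 0 (R + 1)" for x
  proof -
    have "norm x > R + 1" using that by simp
    then have "(norm x)\<^sup>2 > (R + 1)\<^sup>2" using R(1) by (intro power_strict_mono) auto
    moreover have "(R + 1)\<^sup>2 \<ge> R\<^sup>2 + 1" using R(1) by (simp add: power2_eq_square algebra_simps)
    ultimately have gt: "x \<bullet> x - R\<^sup>2 \<ge> 1" by (simp add: power2_norm_eq_inner)
    then have "1 \<le> (x \<bullet> x - R\<^sup>2)\<^sup>2" by simp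
    then have "r x \<le> 0" using gt by (simp add: r_def q_def)
    then show ?thesis by (simp add: cut_def q_def)
  qed
  have "C_class 1 ?cut"
    unfolding One_nat_def C_class.simps pc using Dc dc by (auto intro!: continuous_intros differentiableI)
  moreover have "bounded {x. ?cut x \<noteq> 0}"
    by (rule bounded_subset[OF bounded_cball[of 0 "R + 1"]]) (use out in fastforce)
  ultimately have cutC: "?cut \<in> C1_functions" by (simp add: C1_functions_def)
  let ?e = "\<lambda>x. exp (1 * complex_of_real (\<eta> \<bullet> x))"
  have e1: "C_class 1 ?e" using C_class_exp_inner[where k=1 and c=1 and z=1 and \<eta>=\<eta>] by (simp del: One_nat_def)
  have in1: "cut x = 1" "D b x = 0" if "x \<in> S" for x b
  proof -
    have "norm x < R" using that R by auto
    then have "(norm x)\<^sup>2 \<le> R\<^sup>2" by (intro power_mono) auto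
    then have "x \<bullet> x - R\<^sup>2 \<le> 0" by (simp add: power2_norm_eq_inner)
    then show "cut x = 1" "D b x = 0" by (simp_all add: cut_def r_def q_def D_def)
  qed
  show ?thesis
  proof (rule that)
    show "(\<lambda>x. ?cut x * ?e x) \<in> C1_functions" by (rule C1_mult[OF cutC e1])
    show "?cut x * ?e x = exp (of_real (\<eta> \<bullet> x))" if "x \<in> S" for x using in1[OF that] by simp
    fix x b assume x: "x \<in> S"
    have ed: "?e differentiable (at x)" using e1 by simp
    have pe: "pderiv_dir b ?e x = of_real (\<eta> \<bullet> b) * exp (of_real (\<eta> \<bullet> x))"
      using fun_cong[OF pderiv_dir_exp_inner[where b=b and c=1 and z=1 and \<eta>=\<eta>], of x] by simp
    have pcx: "pderiv_dir b ?cut x = 0" using in1(2)[OF x, of b] fun_cong[OF pc[of b], of x] by simp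
    show "pderiv_dir b (\<lambda>x. ?cut x * ?e x) x = of_real (\<eta> \<bullet> b) * exp (of_real (\<eta> \<bullet> x))"
      unfolding pderiv_dir_mult[OF C1_differentiable[OF cutC] ed] pe pcx using in1(1)[OF x] by simp
  qed
qed

section \<open>Rellich's theorem\<close>

text \<open>The variance of F under the probability density w is nonnegative.\<close>

lemma jensen_norm_square:
  fixes F :: "'b \<Rightarrow> 'c::euclidean_space" and w :: "'b \<Rightarrow> real"
  assumes w: "integrable M w" "(\<integral>x. w x \<partial>M) = 1" "\<And>x. w x \<ge> 0"
    and F: "integrable M (\<lambda>x. w x *\<^sub>R F x)" "integrable M (\<lambda>x. w x * (norm (F x))\<^sup>2)"
  shows "(norm (\<integral>x. w x *\<^sub>R F x \<partial>M))\<^sup>2 \<le> (\<integral>x. w x * (norm (F x))\<^sup>2 \<partial>M)"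
proof -
  define m where "m = (\<integral>x. w x *\<^sub>R F x \<partial>M)"
  have eq: "w x * (norm (F x - m))\<^sup>2 = w x * (norm (F x))\<^sup>2 - 2 * (w x *\<^sub>R F x \<bullet> m) + w x * (norm m)\<^sup>2" for x
    unfolding power2_norm_eq_inner by (simp add: inner_diff inner_commute algebra_simps)
  have "0 \<le> (\<integral>x. w x * (norm (F x - m))\<^sup>2 \<partial>M)" by (rule Bochner_Integration.integral_nonneg) (simp add: w)
  also have "\<dots> = (\<integral>x. w x * (norm (F x))\<^sup>2 \<partial>M) - 2 * (m \<bullet> m) + (norm m)\<^sup>2"
    unfolding eq using w F
    by (simp add: m_def Bochner_Integration.integral_add Bochner_Integration.integral_diff del: inner_scaleR_left)
  finally show ?thesis by (simp add: m_def power2_norm_eq_inner)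
qed

text \<open>The fundamental theorem of calculus writes f (x + h) - f x as an average of directional
  derivatives over a segment; Jensen's inequality squares it, and Fubini with translation invariance
  integrates over x.\<close>

lemma L2_translation_bound:
  fixes f :: "'a::euclidean_space \<Rightarrow> complex"
  assumes f: "f \<in> C1_functions"
  shows "(\<integral>\<^sup>+x. ennreal ((norm (f x - f (x + h)))\<^sup>2) \<partial>lborel) \<le> ennreal ((norm h)\<^sup>2 * (norm (L2 (gradient f)))\<^sup>2)"
proof -
  let ?D = "\<lambda>x. \<Sum>b\<in>Basis. (h \<bullet> b) *\<^sub>R pderiv_dir b f x"
  have Dc: "continuous_on UNIV ?D"
    by (intro continuous_intros C1_continuous_pderiv f)
  have gm[measurable]: "gradient f \<in> borel_measurable borel"
    using C1_gradient_square_integrable[OF f] by (simp add: square_integrable_def)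
  have CS: "(norm (?D x))\<^sup>2 \<le> (norm h)\<^sup>2 * (norm (gradient f x))\<^sup>2" for x
  proof -
    have "(norm (?D x))\<^sup>2 \<le> (\<Sum>b\<in>Basis. \<bar>h \<bullet> b\<bar> * cmod (pderiv_dir b f x))\<^sup>2"
      by (intro power_mono order_trans[OF norm_sum]) auto
    also have "\<dots> \<le> (\<Sum>b\<in>Basis. \<bar>h \<bullet> b\<bar>\<^sup>2) * (\<Sum>b\<in>Basis. (cmod (pderiv_dir b f x))\<^sup>2)"
      by (rule Cauchy_Schwarz_ineq_sum)
    also have "(\<Sum>b\<in>Basis. \<bar>h \<bullet> b\<bar>\<^sup>2) = (norm h)\<^sup>2"
      unfolding power2_norm_eq_inner by (subst euclidean_inner) (simp add: power2_eq_square)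
    also have "(\<Sum>b\<in>Basis. (cmod (pderiv_dir b f x))\<^sup>2) = (norm (gradient f x))\<^sup>2"
      by (simp add: gradient_def norm_real_imag_vector)
    finally show ?thesis .
  qed
  have line: "ennreal ((norm (f x - f (x + h)))\<^sup>2)
      \<le> (\<integral>\<^sup>+s. ennreal (indicator {0..1} s * ((norm h)\<^sup>2 * (norm (gradient f (x + s *\<^sub>R h)))\<^sup>2)) \<partial>lborel)" for x
  proof -
    have dv: "((\<lambda>s. f (x + s *\<^sub>R h)) has_vector_derivative ?D (x + s *\<^sub>R h)) (at s within {0..1})" for s
    proof -
      have 1: "((\<lambda>s. x + s *\<^sub>R h) has_derivative (\<lambda>s. s *\<^sub>R h)) (at s)"
        by (auto intro!: derivative_eq_intros)
      have "((\<lambda>s. f (x + s *\<^sub>R h)) has_derivative (\<lambda>t. \<Sum>b\<in>Basis. ((t *\<^sub>R h) \<bullet> b) *\<^sub>R pderiv_dir b f (x + s *\<^sub>R h))) (at s)"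
        by (rule has_derivative_compose[OF 1 has_derivative_pderiv_dir[OF C1_differentiable[OF f]]])
      then have "((\<lambda>s. f (x + s *\<^sub>R h)) has_vector_derivative ?D (x + s *\<^sub>R h)) (at s)"
        by (simp add: has_vector_derivative_def scaleR_sum_right)
      then show ?thesis by (rule has_vector_derivative_at_within)
    qed
    have cs: "continuous_on {0..1} (\<lambda>s. ?D (x + s *\<^sub>R h))"
      by (rule continuous_on_compose2[OF Dc]) (auto intro!: continuous_intros)
    have ftc: "(\<integral>s. indicator {0..1} s *\<^sub>R ?D (x + s *\<^sub>R h) \<partial>lborel) = f (x + h) - f x"
      using integral_FTC_Icc[of 0 1 "\<lambda>s. f (x + s *\<^sub>R h)" "\<lambda>s. ?D (x + s *\<^sub>R h)"] dv cs by simp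
    have i1: "integrable lborel (\<lambda>s. indicator {0..1::real} s *\<^sub>R ?D (x + s *\<^sub>R h))"
      using borel_integrable_atLeastAtMost'[OF cs] by (simp add: set_integrable_def)
    have i2: "integrable lborel (\<lambda>s. indicator {0..1::real} s * (norm (?D (x + s *\<^sub>R h)))\<^sup>2)"
      using borel_integrable_atLeastAtMost'[of 0 1 "\<lambda>s. (norm (?D (x + s *\<^sub>R h)))\<^sup>2"] cs
      by (simp add: set_integrable_def continuous_on_norm continuous_on_power)
    have "(norm (f x - f (x + h)))\<^sup>2 = (norm (\<integral>s. indicator {0..1} s *\<^sub>R ?D (x + s *\<^sub>R h) \<partial>lborel))\<^sup>2"
      unfolding ftc by (simp add: norm_minus_commute)
    also have "\<dots> \<le> (\<integral>s. indicator {0..1::real} s * (norm (?D (x + s *\<^sub>R h)))\<^sup>2 \<partial>lborel)"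
      by (rule jensen_norm_square[OF _ _ _ i1 i2]) auto
    finally have "ennreal ((norm (f x - f (x + h)))\<^sup>2) \<le> ennreal (\<integral>s. indicator {0..1::real} s * (norm (?D (x + s *\<^sub>R h)))\<^sup>2 \<partial>lborel)"
      by (rule ennreal_leI)
    also have "\<dots> = (\<integral>\<^sup>+s. ennreal (indicator {0..1::real} s * (norm (?D (x + s *\<^sub>R h)))\<^sup>2) \<partial>lborel)"
      by (rule nn_integral_eq_integral[symmetric, OF i2]) simp
    also have "\<dots> \<le> (\<integral>\<^sup>+s. ennreal (indicator {0..1} s * ((norm h)\<^sup>2 * (norm (gradient f (x + s *\<^sub>R h)))\<^sup>2)) \<partial>lborel)"
      by (intro nn_integral_mono ennreal_leI mult_left_mono CS) simp
    finally show ?thesis .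
  qed
  have "(\<integral>\<^sup>+x. ennreal ((norm (f x - f (x + h)))\<^sup>2) \<partial>lborel)
      \<le> (\<integral>\<^sup>+x. \<integral>\<^sup>+s. ennreal (indicator {0..1} s * ((norm h)\<^sup>2 * (norm (gradient f (x + s *\<^sub>R h)))\<^sup>2)) \<partial>lborel \<partial>lborel)"
    by (rule nn_integral_mono) (rule line)
  also have "\<dots> = (\<integral>\<^sup>+s. \<integral>\<^sup>+x. ennreal (indicator {0..1} s * ((norm h)\<^sup>2 * (norm (gradient f (x + s *\<^sub>R h)))\<^sup>2)) \<partial>lborel \<partial>lborel)"
    by (rule lborel_pair.Fubini'[symmetric]) measurable
  also have "\<dots> = (\<integral>\<^sup>+s. indicator {0..1::real} s * ennreal ((norm h)\<^sup>2 * (norm (L2 (gradient f)))\<^sup>2) \<partial>lborel)"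
  proof (rule nn_integral_cong)
    fix s :: real
    have "(\<integral>\<^sup>+x. ennreal (indicator {0..1} s * ((norm h)\<^sup>2 * (norm (gradient f (x + s *\<^sub>R h)))\<^sup>2)) \<partial>lborel)
      = (\<integral>\<^sup>+x. ennreal (indicator {0..1} s * (norm h)\<^sup>2) * ennreal ((norm (gradient f (x + s *\<^sub>R h)))\<^sup>2) \<partial>lborel)"
      by (intro nn_integral_cong) (simp add: ennreal_mult[symmetric] mult.assoc)
    also have "\<dots> = ennreal (indicator {0..1} s * (norm h)\<^sup>2) * (\<integral>\<^sup>+x. ennreal ((norm (gradient f (x + s *\<^sub>R h)))\<^sup>2) \<partial>lborel)"
      by (rule nn_integral_cmult) measurable
    also have "(\<integral>\<^sup>+x. ennreal ((norm (gradient f (x + s *\<^sub>R h)))\<^sup>2) \<partial>lborel) = ennreal ((norm (L2 (gradient f)))\<^sup>2)"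
      unfolding ennreal_norm_L2_square[OF C1_gradient_square_integrable[OF f]]
      by (rule nn_integral_translation[of "\<lambda>x. ennreal ((norm (gradient f x))\<^sup>2)"]) measurable
    finally show "(\<integral>\<^sup>+x. ennreal (indicator {0..1} s * ((norm h)\<^sup>2 * (norm (gradient f (x + s *\<^sub>R h)))\<^sup>2)) \<partial>lborel)
      = indicator {0..1} s * ennreal ((norm h)\<^sup>2 * (norm (L2 (gradient f)))\<^sup>2)"
      by (cases "s \<in> {0..1}") (simp_all add: ennreal_mult)
  qed
  also have "\<dots> = ennreal ((norm h)\<^sup>2 * (norm (L2 (gradient f)))\<^sup>2)"
    by (subst nn_integral_multc) auto
  finally show ?thesis .
qed

text \<open>A normalised cone: equicontinuity will need a Lipschitz kernel and no further
  smoothness. One constant L bounds both its size and its Lipschitz constant.\<close>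

lemma mollifier_exists:
  fixes e :: real
  assumes e: "e > 0"
  obtains \<kappa> :: "'a::euclidean_space \<Rightarrow> real" and L :: real where
    "integrable lborel \<kappa>" "(\<integral>z. \<kappa> z \<partial>lborel) = 1" "\<And>z. \<kappa> z \<ge> 0" "\<And>z. \<kappa> z \<noteq> 0 \<Longrightarrow> norm z < e"
    "continuous_on UNIV \<kappa>" "L > 0" "\<And>z. \<kappa> z \<le> L" "\<And>z w. \<bar>\<kappa> z - \<kappa> w\<bar> \<le> L * norm (z - w)"
proof -
  define k where "k z = max 0 (e - norm z)" for z :: 'a
  have kc: "continuous_on UNIV k" unfolding k_def by (intro continuous_intros)
  have kb: "bounded {z. k z \<noteq> 0}"
    by (rule bounded_subset[OF bounded_ball[of 0 e]]) (auto simp: k_def max_def split: if_splits)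
  have ki: "integrable lborel k" by (rule integrable_continuous_bounded_support[OF kc kb])
  define I where "I = (\<integral>z. k z \<partial>lborel)"
  have "I \<noteq> 0"
  proof
    assume "I = 0"
    then have "AE z in lborel. k z = 0"
      unfolding I_def by (subst (asm) integral_nonneg_eq_0_iff_AE[OF ki]) (auto simp: k_def)
    then have "AE z in lborel. z \<notin> ball (0::'a) e" by eventually_elim (auto simp: k_def)
    then have "emeasure lborel (ball (0::'a) e) = 0" by (subst (asm) AE_iff_measurable[OF _ refl]) (auto simp: ball_def)
    then show False using content_ball_pos[OF e, of "0::'a"] by (simp add: measure_def)
  qed
  moreover have "I \<ge> 0" unfolding I_def by (rule Bochner_Integration.integral_nonneg) (simp add: k_def)
  ultimately have I: "I > 0" by simp
  define L where "L = max (e / I) (1 / I)"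
  show ?thesis
  proof (rule that[of "\<lambda>z. k z / I" L])
    show "(\<integral>z. k z / I \<partial>lborel) = 1" using I by (simp add: I_def[symmetric])
    show "norm z < e" if "k z / I \<noteq> 0" for z using that by (auto simp: k_def max_def split: if_splits)
    show "continuous_on UNIV (\<lambda>z. k z / I)" using I by (intro continuous_intros kc) auto
    show "k z / I \<le> L" for z
    proof -
      have "k z / I \<le> e / I" using I e by (intro divide_right_mono) (auto simp: k_def)
      then show ?thesis by (simp add: L_def)
    qed
    show "\<bar>k z / I - k w / I\<bar> \<le> L * norm (z - w)" for z w
    proof -
      have "\<bar>k z - k w\<bar> \<le> norm (z - w)" using norm_triangle_ineq3[of z w] by (auto simp: k_def max_def)
      then have "\<bar>k z / I - k w / I\<bar> \<le> 1 / I * norm (z - w)"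
        using I by (simp add: diff_divide_distrib[symmetric] divide_right_mono)
      also have "\<dots> \<le> L * norm (z - w)" by (intro mult_right_mono) (auto simp: L_def)
      finally show ?thesis .
    qed
    show "integrable lborel (\<lambda>z. k z / I)" using ki by simp
    show "L > 0" using I by (simp add: L_def less_max_iff_disj)
    show "k z / I \<ge> 0" for z using I by (simp add: k_def)
  qed
qed

text \<open>Jensen's inequality for the density \<kappa> moves the square inside the average, and
  each translate with \<kappa> z \<noteq> 0 costs at most e times the gradient norm by
  \<open>L2_translation_bound\<close>.\<close>

lemma mollification_error:
  fixes f :: "'a::euclidean_space \<Rightarrow> complex"
  assumes f: "f \<in> C1_functions" and e: "e > 0"
    and k: "integrable lborel \<kappa>" "(\<integral>z. \<kappa> z \<partial>lborel) = 1" "\<And>z. \<kappa> z \<ge> 0" "\<And>z. \<kappa> z \<noteq> 0 \<Longrightarrow> norm z < e"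
      "continuous_on UNIV \<kappa>"
  shows "(\<integral>\<^sup>+x. ennreal ((norm (f x - (\<integral>z. \<kappa> z *\<^sub>R f (x + z) \<partial>lborel)))\<^sup>2) \<partial>lborel) \<le> ennreal (e\<^sup>2 * (norm (L2 (gradient f)))\<^sup>2)"
proof -
  have [measurable]: "\<kappa> \<in> borel_measurable borel" using k(1) by auto
  have [measurable]: "f \<in> borel_measurable borel" using C1_integrable[OF f] by auto
  have fc: "continuous_on UNIV (\<lambda>z. f (x + z))" for x
    by (rule continuous_on_compose2[OF C1_continuous[OF f]]) (auto intro!: continuous_intros)
  have kb: "bounded {z. \<kappa> z \<noteq> 0}" by (rule bounded_subset[OF bounded_ball[of 0 e]]) (use k(4) in auto)
  have pw: "ennreal ((norm (f x - (\<integral>z. \<kappa> z *\<^sub>R f (x + z) \<partial>lborel)))\<^sup>2)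
     \<le> (\<integral>\<^sup>+z. ennreal (\<kappa> z) * ennreal ((norm (f x - f (x + z)))\<^sup>2) \<partial>lborel)" for x
  proof -
    have i1: "integrable lborel (\<lambda>z. \<kappa> z *\<^sub>R (f x - f (x + z)))"
      by (rule integrable_continuous_bounded_support)
         (auto intro!: continuous_intros fc k bounded_subset[OF kb])
    have i2: "integrable lborel (\<lambda>z. \<kappa> z * (norm (f x - f (x + z)))\<^sup>2)"
      by (rule integrable_continuous_bounded_support)
         (auto intro!: continuous_intros fc k bounded_subset[OF kb])
    have i3: "integrable lborel (\<lambda>z. \<kappa> z *\<^sub>R f (x + z))"
      by (rule integrable_continuous_bounded_support)
         (auto intro!: continuous_intros fc k bounded_subset[OF kb])
    have "f x - (\<integral>z. \<kappa> z *\<^sub>R f (x + z) \<partial>lborel) = (\<integral>z. \<kappa> z *\<^sub>R f x \<partial>lborel) - (\<integral>z. \<kappa> z *\<^sub>R f (x + z) \<partial>lborel)"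
      using k by simp
    also have "\<dots> = (\<integral>z. \<kappa> z *\<^sub>R (f x - f (x + z)) \<partial>lborel)"
      using k i3 by (simp add: scaleR_diff_right)
    finally have "(norm (f x - (\<integral>z. \<kappa> z *\<^sub>R f (x + z) \<partial>lborel)))\<^sup>2 \<le> (\<integral>z. \<kappa> z * (norm (f x - f (x + z)))\<^sup>2 \<partial>lborel)"
      using jensen_norm_square[OF k(1-3) i1 i2] by simp
    then have "ennreal ((norm (f x - (\<integral>z. \<kappa> z *\<^sub>R f (x + z) \<partial>lborel)))\<^sup>2) \<le> ennreal (\<integral>z. \<kappa> z * (norm (f x - f (x + z)))\<^sup>2 \<partial>lborel)"
      by (rule ennreal_leI)
    also have "\<dots> = (\<integral>\<^sup>+z. ennreal (\<kappa> z * (norm (f x - f (x + z)))\<^sup>2) \<partial>lborel)"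
      by (rule nn_integral_eq_integral[symmetric, OF i2]) (simp add: k)
    finally show ?thesis using k by (simp add: ennreal_mult)
  qed
  have "(\<integral>\<^sup>+x. ennreal ((norm (f x - (\<integral>z. \<kappa> z *\<^sub>R f (x + z) \<partial>lborel)))\<^sup>2) \<partial>lborel)
     \<le> (\<integral>\<^sup>+x. \<integral>\<^sup>+z. ennreal (\<kappa> z) * ennreal ((norm (f x - f (x + z)))\<^sup>2) \<partial>lborel \<partial>lborel)"
    by (rule nn_integral_mono) (rule pw)
  also have "\<dots> = (\<integral>\<^sup>+z. \<integral>\<^sup>+x. ennreal (\<kappa> z) * ennreal ((norm (f x - f (x + z)))\<^sup>2) \<partial>lborel \<partial>lborel)"
    by (rule lborel_pair.Fubini'[symmetric]) measurable
  also have "\<dots> \<le> (\<integral>\<^sup>+z. ennreal (\<kappa> z) * ennreal (e\<^sup>2 * (norm (L2 (gradient f)))\<^sup>2) \<partial>lborel)"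
  proof (rule nn_integral_mono)
    fix z
    have "(\<integral>\<^sup>+x. ennreal (\<kappa> z) * ennreal ((norm (f x - f (x + z)))\<^sup>2) \<partial>lborel)
       = ennreal (\<kappa> z) * (\<integral>\<^sup>+x. ennreal ((norm (f x - f (x + z)))\<^sup>2) \<partial>lborel)"
      by (rule nn_integral_cmult) measurable
    also have "\<dots> \<le> ennreal (\<kappa> z) * ennreal (e\<^sup>2 * (norm (L2 (gradient f)))\<^sup>2)"
    proof (cases "\<kappa> z = 0")
      case False
      then have "(norm z)\<^sup>2 \<le> e\<^sup>2" using k(4)[of z] by (intro power_mono) auto
      then have "ennreal ((norm z)\<^sup>2 * (norm (L2 (gradient f)))\<^sup>2) \<le> ennreal (e\<^sup>2 * (norm (L2 (gradient f)))\<^sup>2)"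
        by (intro ennreal_leI mult_right_mono) auto
      then show ?thesis by (intro mult_left_mono order_trans[OF L2_translation_bound[OF f]]) auto
    qed simp
    finally show "(\<integral>\<^sup>+x. ennreal (\<kappa> z) * ennreal ((norm (f x - f (x + z)))\<^sup>2) \<partial>lborel) \<le> ennreal (\<kappa> z) * ennreal (e\<^sup>2 * (norm (L2 (gradient f)))\<^sup>2)" .
  qed
  also have "\<dots> = (\<integral>\<^sup>+z. ennreal (\<kappa> z) \<partial>lborel) * ennreal (e\<^sup>2 * (norm (L2 (gradient f)))\<^sup>2)"
    by (rule nn_integral_multc) measurable
  also have "(\<integral>\<^sup>+z. ennreal (\<kappa> z) \<partial>lborel) = 1"
    using k by (subst nn_integral_eq_integral) auto
  finally show ?thesis by simp
qed

text \<open>For accuracy d, mollify at one fixed scale: the mollified functions are uniformly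
  bounded and equi-Lipschitz, so Arzela-Ascoli gives a uniformly convergent subsequence on the
  closure of \<Omega>, while the gradient bound controls the mollification error uniformly. Finite
  measure of \<Omega> turns uniform closeness into closeness in L2.\<close>

lemma rellich_epsilon:
  fixes f :: "nat \<Rightarrow> 'a::euclidean_space \<Rightarrow> complex"
  assumes bd: "bounded \<Omega>" and op: "open \<Omega>" and f: "\<And>k. f k \<in> test_functions \<Omega>"
    and M: "\<And>k. norm (L2 (f k)) \<le> M" "\<And>k. norm (L2 (gradient (f k))) \<le> M" and d: "d > 0"
  shows "\<exists>r :: nat \<Rightarrow> nat. strict_mono r \<and> (\<forall>i j. dist (L2 (f (r i))) (L2 (f (r j))) \<le> d)"
proof -
  have C1: "f k \<in> C1_functions" for k using f test_functions_C1 by blast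
  have M0: "M \<ge> 0" using M(1)[of 0] norm_ge_zero order_trans by blast
  have [measurable]: "\<Omega> \<in> sets borel" using op by simp
  define V where "V = measure lborel \<Omega>"
  have fin: "emeasure lborel \<Omega> < \<infinity>" using emeasure_bounded_finite[OF bd] by simp
  have emV: "emeasure lborel \<Omega> = ennreal V" unfolding V_def using fin by (intro emeasure_eq_ennreal_measure) auto
  have V0: "V \<ge> 0" by (simp add: V_def)
  \<comment> \<open>Makes the mollification error at most d / 4 in norm; M may be 0, hence M +
    1.\<close>
  define e where "e = d / (4 * (M + 1))"
  have e: "e > 0" using d M0 by (simp add: e_def)
  obtain \<kappa> :: "'a \<Rightarrow> real" and L :: real where
    k: "integrable lborel \<kappa>" "(\<integral>z. \<kappa> z \<partial>lborel) = 1" "\<And>z. \<kappa> z \<ge> 0" "\<And>z. \<kappa> z \<noteq> 0 \<Longrightarrow> norm z < e"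
      "continuous_on UNIV \<kappa>" and L: "L > 0" "\<And>z. \<kappa> z \<le> L" "\<And>z w. \<bar>\<kappa> z - \<kappa> w\<bar> \<le> L * norm (z - w)"
    using mollifier_exists[OF e] by metis
  define g where "g n x = (\<integral>z. \<kappa> z *\<^sub>R f n (x + z) \<partial>lborel)" for n x
  \<comment> \<open>A bound for the L1 norms, from |f| \<le> 1 + |f|^2 on \<Omega>.\<close>
  define N where "N = V + M\<^sup>2"
  have [measurable]: "\<kappa> \<in> borel_measurable borel" "\<And>k. f k \<in> borel_measurable borel"
    using k(1) C1_integrable[OF C1] by auto
  \<comment> \<open>The substitution y = x + z moves the dependence on x into \<kappa>, so bounds
    for \<kappa> and for the L1 norm of f n control g n.\<close>
  have gz: "g n x = (\<integral>y. \<kappa> (y - x) *\<^sub>R f n y \<partial>lborel)" for n x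
    using integral_translation[of "\<lambda>y. \<kappa> (y - x) *\<^sub>R f n y" x] by (simp add: g_def add.commute)
  have L1: "(\<integral>x. norm (f n x) \<partial>lborel) \<le> N" for n
  proof -
    have sq: "integrable lborel (\<lambda>x. (norm (f n x))\<^sup>2)" using C1_square_integrable[OF C1[of n]] by (simp add: square_integrable_def)
    have io: "integrable lborel (indicator \<Omega> :: 'a \<Rightarrow> real)" using fin by auto
    have "(\<integral>x. norm (f n x) \<partial>lborel) \<le> (\<integral>x. indicator \<Omega> x + (norm (f n x))\<^sup>2 \<partial>lborel)"
    proof (rule integral_mono)
      show "norm (f n x) \<le> indicator \<Omega> x + (norm (f n x))\<^sup>2" for x
      proof (cases "x \<in> \<Omega>")
        case True
        have "0 \<le> (norm (f n x) - 1/2)\<^sup>2" by simp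
        then show ?thesis using True by (simp add: power2_eq_square algebra_simps)
      qed (simp add: test_functions_eq_0[OF f])
    qed (use sq io C1_integrable[OF C1] in auto)
    also have "\<dots> = V + (norm (L2 (f n)))\<^sup>2"
      using sq io C1_square_integrable[OF C1[of n]] by (simp add: norm_L2_square V_def)
    also have "\<dots> \<le> N" unfolding N_def using M(1)[of n] by (simp add: power_mono)
    finally show ?thesis .
  qed
  have N0: "N \<ge> 0" using V0 by (simp add: N_def)
  have fi: "integrable lborel (\<lambda>y. c *\<^sub>R f n y)" "integrable lborel (\<lambda>y. norm (f n y))" for n c using C1_integrable[OF C1] by auto
  have ki: "integrable lborel (\<lambda>y. \<kappa> (y - x) *\<^sub>R f n y)" for n x
  proof (rule Bochner_Integration.integrable_bound[OF fi(1)[of L n]])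
    show "AE y in lborel. norm (\<kappa> (y - x) *\<^sub>R f n y) \<le> norm (L *\<^sub>R f n y)"
      using L k(3) by (intro AE_I2) (auto intro!: mult_right_mono)
  qed measurable
  have gb: "norm (g n x) \<le> L * N" for n x
  proof -
    have "norm (g n x) \<le> (\<integral>y. norm (\<kappa> (y - x) *\<^sub>R f n y) \<partial>lborel)" unfolding gz by (rule integral_norm_bound)
    also have "\<dots> \<le> (\<integral>y. L * norm (f n y) \<partial>lborel)"
      using L(2) k(3) ki[of x n] fi(2)[of n] C1_integrable[OF C1]
      by (intro integral_mono integrable_norm integrable_mult_right) (auto intro!: mult_right_mono)
    also have "\<dots> \<le> L * N" using L1[of n] L(1) by simp
    finally show ?thesis .
  qed
  have gl: "norm (g n x - g n y) \<le> L * N * norm (x - y)" for n x y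
  proof -
    have "g n x - g n y = (\<integral>z. (\<kappa> (z - x) - \<kappa> (z - y)) *\<^sub>R f n z \<partial>lborel)"
      unfolding gz by (simp add: scaleR_diff_left ki)
    also have "norm \<dots> \<le> (\<integral>z. norm ((\<kappa> (z - x) - \<kappa> (z - y)) *\<^sub>R f n z) \<partial>lborel)" by (rule integral_norm_bound)
    also have "\<dots> \<le> (\<integral>z. (L * norm (x - y)) * norm (f n z) \<partial>lborel)"
    proof (rule integral_mono)
      show "integrable lborel (\<lambda>z. norm ((\<kappa> (z - x) - \<kappa> (z - y)) *\<^sub>R f n z))"
        by (intro integrable_norm) (simp add: scaleR_diff_left ki)
      show "norm ((\<kappa> (z - x) - \<kappa> (z - y)) *\<^sub>R f n z) \<le> (L * norm (x - y)) * norm (f n z)" for z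
        using L(3)[of "z - x" "z - y"] by (auto intro!: mult_right_mono simp: norm_minus_commute)
    qed (use fi(2)[of n] in auto)
    also have "\<dots> \<le> L * N * norm (x - y)"
      using mult_left_mono[OF L1[of n], of "L * norm (x - y)"] L(1) by (simp add: mult_ac)
    finally show ?thesis .
  qed
  have comp: "compact (closure \<Omega>)" using bd by (simp add: compact_closure)
  obtain h r where hr: "continuous_on (closure \<Omega>) h" "strict_mono (r :: nat \<Rightarrow> nat)"
    "\<And>e. 0 < e \<Longrightarrow> \<exists>N. \<forall>n x. n \<ge> N \<and> x \<in> closure \<Omega> \<longrightarrow> norm (g (r n) x - h x) < e"
  proof (rule Arzela_Ascoli[OF comp, of g "L * N"])
    fix x and \<epsilon> :: real assume "x \<in> closure \<Omega>" "0 < \<epsilon>"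
    have pos: "L * N + 1 > 0" using L N0 by (simp add: add_nonneg_pos)
    show "\<exists>d>0. \<forall>n y. y \<in> closure \<Omega> \<and> norm (x - y) < d \<longrightarrow> norm (g n x - g n y) < \<epsilon>"
    proof (intro exI[of _ "\<epsilon> / (L * N + 1)"] conjI allI impI)
      fix n y assume "y \<in> closure \<Omega> \<and> norm (x - y) < \<epsilon> / (L * N + 1)"
      then have "(L * N + 1) * norm (x - y) < \<epsilon>" using pos by (simp add: field_simps)
      moreover have "norm (g n x - g n y) \<le> (L * N + 1) * norm (x - y)"
        using gl[of n x y] norm_ge_zero[of "x - y"] by (simp add: algebra_simps del: norm_ge_zero)
      ultimately show "norm (g n x - g n y) < \<epsilon>" by linarith
    qed (use \<open>0 < \<epsilon>\<close> pos in simp)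
  qed (use gb in auto)
  \<comment> \<open>The estimate below ends with 3 (d^2/16 + d^2/16 + 4 \<delta>^2 V); with 12
    \<delta>^2 V \<le> d^2/2 this is at most 7/8 of d^2.\<close>
  obtain \<delta> where \<delta>: "\<delta> > 0" "12 * \<delta>\<^sup>2 * V \<le> d\<^sup>2 / 2"
  proof
    define q where "q = d / (5 * sqrt (V + 1))"
    show "q > 0" using d V0 by (simp add: q_def)
    have "12 * q\<^sup>2 * V = 12 / 25 * d\<^sup>2 * (V / (V + 1))" using V0 by (simp add: q_def power_divide power_mult_distrib)
    also have "\<dots> \<le> 12 / 25 * d\<^sup>2 * 1" using V0 by (intro mult_left_mono) auto
    also have "\<dots> \<le> d\<^sup>2 / 2" by simp
    finally show "12 * q\<^sup>2 * V \<le> d\<^sup>2 / 2" .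
  qed
  obtain n0 where n0: "\<And>n x. n \<ge> n0 \<Longrightarrow> x \<in> closure \<Omega> \<Longrightarrow> norm (g (r n) x - h x) < \<delta>" using hr(3)[OF \<delta>(1)] by metis
  have err: "(\<integral>\<^sup>+x. ennreal ((norm (f n x - g n x))\<^sup>2) \<partial>lborel) \<le> ennreal (d\<^sup>2 / 16)" for n
  proof -
    have "(\<integral>\<^sup>+x. ennreal ((norm (f n x - g n x))\<^sup>2) \<partial>lborel) \<le> ennreal (e\<^sup>2 * (norm (L2 (gradient (f n))))\<^sup>2)"
      unfolding g_def by (rule mollification_error[OF C1 e k])
    also have "\<dots> \<le> ennreal (d\<^sup>2 / 16)"
    proof (rule ennreal_leI)
      have "e * norm (L2 (gradient (f n))) \<le> e * (M + 1)" using M(2)[of n] e by (intro mult_left_mono) auto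
      also have "e * (M + 1) = d / 4"
      proof -
        have "d / (4 * p) * p = d / 4" if "p \<noteq> 0" for p :: real using that by simp
        moreover have "M + 1 \<noteq> 0" using M0 by linarith
        ultimately show ?thesis unfolding e_def by blast
      qed
      finally have "(e * norm (L2 (gradient (f n))))\<^sup>2 \<le> (d / 4)\<^sup>2" using e by (intro power_mono) auto
      then show "e\<^sup>2 * (norm (L2 (gradient (f n))))\<^sup>2 \<le> d\<^sup>2 / 16" by (simp add: power_mult_distrib power_divide)
    qed
    finally show ?thesis .
  qed
  have [measurable]: "g n \<in> borel_measurable borel" for n unfolding g_def[abs_def] by measurable
  have main: "dist (L2 (f (r i))) (L2 (f (r j))) \<le> d" if ij: "i \<ge> n0" "j \<ge> n0" for i j
  proof -
    let ?a = "\<lambda>x. f (r i) x - g (r i) x" and ?c = "\<lambda>x. f (r j) x - g (r j) x"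
    \<comment> \<open>Outside \<Omega> both functions vanish. On \<Omega> both mollifications are
      within \<delta> of h, and (p + q + s)^2 \<le> 3 (p^2 + q^2 + s^2).\<close>
    have pw: "(norm (f (r i) x - f (r j) x))\<^sup>2 \<le> 3 * ((norm (?a x))\<^sup>2 + (norm (?c x))\<^sup>2 + indicator \<Omega> x * (4 * \<delta>\<^sup>2))" for x
    proof (cases "x \<in> \<Omega>")
      case True
      then have x: "x \<in> closure \<Omega>" using closure_subset by blast
      have "norm (g (r i) x - g (r j) x) \<le> 2 * \<delta>"
        using norm_triangle_ineq4[of "g (r i) x - h x" "g (r j) x - h x"] n0[OF ij(1) x] n0[OF ij(2) x] by simp
      moreover have "norm (f (r i) x - f (r j) x) \<le> norm (?a x) + norm (?c x) + norm (g (r i) x - g (r j) x)"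
        using norm_triangle_ineq[of "?a x - ?c x" "g (r i) x - g (r j) x"] norm_triangle_ineq4[of "?a x" "?c x"] by simp
      ultimately have "norm (f (r i) x - f (r j) x) \<le> norm (?a x) + norm (?c x) + 2 * \<delta>" by simp
      then have "(norm (f (r i) x - f (r j) x))\<^sup>2 \<le> (norm (?a x) + norm (?c x) + 2 * \<delta>)\<^sup>2" by (intro power_mono) auto
      also have "(p + q + s)\<^sup>2 \<le> 3 * (p\<^sup>2 + q\<^sup>2 + s\<^sup>2)" for p q s :: real
      proof -
        have "0 \<le> (p - q)\<^sup>2 + (p - s)\<^sup>2 + (q - s)\<^sup>2" by simp
        then show ?thesis by (simp add: power2_eq_square algebra_simps)
      qed
      then have "(norm (?a x) + norm (?c x) + 2 * \<delta>)\<^sup>2 \<le> 3 * ((norm (?a x))\<^sup>2 + (norm (?c x))\<^sup>2 + (2 * \<delta>)\<^sup>2)" .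
      finally show ?thesis using True by (simp add: power_mult_distrib)
    qed (simp add: test_functions_eq_0[OF f])
    have "ennreal ((dist (L2 (f (r i))) (L2 (f (r j))))\<^sup>2) = (\<integral>\<^sup>+x. ennreal ((norm (f (r i) x - f (r j) x))\<^sup>2) \<partial>lborel)"
      by (intro ennreal_dist_L2_square C1_square_integrable C1)
    also have "\<dots> \<le> (\<integral>\<^sup>+x. 3 * (ennreal ((norm (?a x))\<^sup>2) + ennreal ((norm (?c x))\<^sup>2) + indicator \<Omega> x * ennreal (4 * \<delta>\<^sup>2)) \<partial>lborel)"
    proof (rule nn_integral_mono)
      fix x
      have "ennreal ((norm (f (r i) x - f (r j) x))\<^sup>2) \<le> ennreal (3 * ((norm (?a x))\<^sup>2 + (norm (?c x))\<^sup>2 + indicator \<Omega> x * (4 * \<delta>\<^sup>2)))"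
        by (rule ennreal_leI[OF pw])
      then show "ennreal ((norm (f (r i) x - f (r j) x))\<^sup>2) \<le> 3 * (ennreal ((norm (?a x))\<^sup>2) + ennreal ((norm (?c x))\<^sup>2) + indicator \<Omega> x * ennreal (4 * \<delta>\<^sup>2))"
        by (cases "x \<in> \<Omega>") (simp_all add: ennreal_plus ennreal_mult)
    qed
    also have "\<dots> = 3 * ((\<integral>\<^sup>+x. ennreal ((norm (?a x))\<^sup>2) \<partial>lborel) + (\<integral>\<^sup>+x. ennreal ((norm (?c x))\<^sup>2) \<partial>lborel) + ennreal V * ennreal (4 * \<delta>\<^sup>2))"
      by (simp add: nn_integral_cmult nn_integral_add nn_integral_multc emV)
    also have "\<dots> \<le> 3 * (ennreal (d\<^sup>2 / 16) + ennreal (d\<^sup>2 / 16) + ennreal V * ennreal (4 * \<delta>\<^sup>2))"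
      by (intro mult_left_mono add_mono err) auto
    also have "\<dots> = ennreal (3 * (d\<^sup>2 / 16 + d\<^sup>2 / 16 + V * (4 * \<delta>\<^sup>2)))"
    proof -
      have three: "ennreal (3 * (a + b + c)) = 3 * (ennreal a + ennreal b + ennreal c)" if "a \<ge> 0" "b \<ge> 0" "c \<ge> 0" for a b c
        using that by (simp add: ennreal_plus ennreal_mult)
      have V4: "ennreal V * ennreal (4 * \<delta>\<^sup>2) = ennreal (V * (4 * \<delta>\<^sup>2))" using V0 by (rule ennreal_mult[symmetric]) simp
      show ?thesis unfolding V4 by (rule three[symmetric]) (use V0 in auto)
    qed
    also have "\<dots> \<le> ennreal (d\<^sup>2)"
    proof (rule ennreal_leI)
      have "12 * \<delta>\<^sup>2 * V = 3 * (V * (4 * \<delta>\<^sup>2))" by simp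
      moreover have "0 \<le> d\<^sup>2" by simp
      moreover have "x \<le> y / 2 \<Longrightarrow> x = 3 * c \<Longrightarrow> 0 \<le> y \<Longrightarrow> 3 * (y / 16 + y / 16 + c) \<le> y" for x y c :: real
        by (simp add: field_simps)
      ultimately show "3 * (d\<^sup>2 / 16 + d\<^sup>2 / 16 + V * (4 * \<delta>\<^sup>2)) \<le> d\<^sup>2" using \<delta>(2) by blast
    qed
    finally have "(dist (L2 (f (r i))) (L2 (f (r j))))\<^sup>2 \<le> d\<^sup>2" by simp
    then show ?thesis using d by (rule power2_le_imp_le[OF _ less_imp_le])
  qed
  \<comment> \<open>Dropping the first n0 terms makes the bound hold for all pairs of
    indices.\<close>
  have "strict_mono (\<lambda>i. r (i + n0))" using hr(2) by (simp add: strict_mono_def)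
  then show ?thesis using main by (intro exI[of _ "\<lambda>i. r (i + n0)"]) auto
qed

text \<open>Diagonal argument over the accuracies 1 / (n + 1). Since \<open>P\<close> bounds all
  pairs of indices, not just late ones, it passes to further subsequences, as the diagonal sequence
  requires.\<close>

lemma rellich:
  fixes f :: "nat \<Rightarrow> 'a::euclidean_space \<Rightarrow> complex"
  assumes "bounded \<Omega>" "open \<Omega>" and f: "\<And>k. f k \<in> test_functions \<Omega>"
    and M: "\<And>k. norm (L2 (f k)) \<le> M" "\<And>k. norm (L2 (gradient (f k))) \<le> M"
  shows "\<exists>r :: nat \<Rightarrow> nat. strict_mono r \<and> Cauchy (\<lambda>k. L2 (f (r k)))"
proof -
  define P where "P n s \<longleftrightarrow> (\<forall>i j. dist (L2 (f (s i))) (L2 (f (s j))) \<le> 1 / real (Suc n))" for n and s :: "nat \<Rightarrow> nat"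
  interpret subseqs P
  proof
    fix n and s :: "nat \<Rightarrow> nat" assume "strict_mono s"
    show "\<exists>r'. strict_mono r' \<and> P n (s \<circ> r')"
      using rellich_epsilon[OF assms(1,2), of "\<lambda>k. f (s k)" M "1 / real (Suc n)"] f M by (auto simp: P_def)
  qed
  have P: "P n (diagseq \<circ> ((+) (Suc n)))" for n
    by (rule diagseq_holds) (auto simp: P_def)
  have "Cauchy (\<lambda>k. L2 (f (diagseq k)))"
  proof (rule metric_CauchyI)
    fix e :: real assume "e > 0"
    then obtain n where n: "1 / real (Suc n) < e" using reals_Archimedean by (metis inverse_eq_divide)
    have "dist (L2 (f (diagseq i))) (L2 (f (diagseq j))) < e" if "i \<ge> Suc n" "j \<ge> Suc n" for i j
    proof -
      have "dist (L2 (f (diagseq (Suc n + (i - Suc n))))) (L2 (f (diagseq (Suc n + (j - Suc n))))) \<le> 1 / real (Suc n)"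
        using P[of n] unfolding P_def o_def by blast
      then show ?thesis using that n by simp
    qed
    then show "\<exists>M. \<forall>m\<ge>M. \<forall>n\<ge>M. dist (L2 (f (diagseq m))) (L2 (f (diagseq n))) < e" by blast
  qed
  then show ?thesis using subseq_diagseq by blast
qed

section \<open>The form domain and the Dirichlet eigenfunctions\<close>

definition graph :: "('a::euclidean_space \<Rightarrow> complex) \<Rightarrow> ('a, complex) L2 \<times> ('a, 'a \<times> 'a) L2" where
  "graph f = (L2 f, L2 (gradient f))"

text \<open>\<open>H\<^sub>0\<^sup>1(\<Omega>)\<close> as the closed graph of the gradient in a
  product of two L2 spaces. The product norm is the first order Sobolev norm, so the form domain is
  a closed subspace of a Hilbert space and \<open>fst\<close> is its embedding into L2.\<close>

definition H10_graph :: "'a::euclidean_space set \<Rightarrow> (('a, complex) L2 \<times> ('a, 'a \<times> 'a) L2) set" where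
  "H10_graph \<Omega> = closure (graph ` test_functions \<Omega>)"

lemma test_function_square_integrable: "f \<in> test_functions \<Omega> \<Longrightarrow> square_integrable f"
  using C1_square_integrable test_functions_C1 by blast

lemma gradient_add:
  "f \<in> C1_functions \<Longrightarrow> g \<in> C1_functions \<Longrightarrow> gradient (\<lambda>x. f x + g x) = (\<lambda>x. gradient f x + gradient g x)"
  unfolding gradient_def[abs_def] real_imag_vector_add
  by (intro ext arg_cong[where f=real_imag_vector] pderiv_dir_add C1_differentiable)

lemma gradient_scaleR:
  "f \<in> C1_functions \<Longrightarrow> gradient (\<lambda>x. of_real c * f x) = (\<lambda>x. c *\<^sub>R gradient f x)"
  unfolding gradient_def[abs_def] real_imag_vector_scaleR scaleR_conv_of_real
  by (intro ext arg_cong[where f=real_imag_vector] pderiv_dir_cmult C1_differentiable)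

lemma graph_add:
  "f \<in> C1_functions \<Longrightarrow> g \<in> C1_functions \<Longrightarrow> graph (\<lambda>x. f x + g x) = graph f + graph g"
  by (simp add: graph_def L2_plus C1_square_integrable C1_gradient_square_integrable gradient_add)

lemma graph_scaleR: "f \<in> C1_functions \<Longrightarrow> graph (\<lambda>x. of_real c * f x) = c *\<^sub>R graph f"
  by (simp add: graph_def L2_scaleR C1_square_integrable C1_gradient_square_integrable gradient_scaleR scaleR_conv_of_real)

lemma subspace_H10_graph: "subspace (H10_graph \<Omega>)"
proof -
  let ?S = "graph ` test_functions \<Omega> :: (('a, complex) L2 \<times> ('a, 'a \<times> 'a) L2) set"
  have add: "x + y \<in> ?S" if "x \<in> ?S" "y \<in> ?S" for x y
  proof -
    from that obtain f g where *: "f \<in> test_functions \<Omega>" "g \<in> test_functions \<Omega>" "x = graph f" "y = graph g" by auto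
    then have "x + y = graph (\<lambda>z. f z + g z)" by (simp add: graph_add test_functions_C1)
    then show ?thesis using test_functions_add[OF *(1,2)] by blast
  qed
  have scale: "c *\<^sub>R x \<in> ?S" if "x \<in> ?S" for x c
  proof -
    from that obtain f where *: "f \<in> test_functions \<Omega>" "x = graph f" by auto
    then have "c *\<^sub>R x = graph (\<lambda>z. of_real c * f z)" by (simp add: graph_scaleR test_functions_C1)
    then show ?thesis using test_functions_cmult[OF *(1)] by blast
  qed
  have "graph (\<lambda>x. 0) \<in> ?S" using test_functions_zero by blast
  from scale[OF this, of 0] have zero: "0 \<in> ?S" by simp
  show ?thesis unfolding subspace_def H10_graph_def
  proof (intro conjI ballI allI)
    show "0 \<in> closure ?S" by (rule subsetD[OF closure_subset zero])
    fix x y assume "x \<in> closure ?S" "y \<in> closure ?S"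
    then have "\<exists>a. (\<forall>n. a n \<in> ?S) \<and> a \<longlonglongrightarrow> x" "\<exists>b. (\<forall>n. b n \<in> ?S) \<and> b \<longlonglongrightarrow> y"
      unfolding closure_sequential .
    then obtain a b where ab: "\<forall>n. a n \<in> ?S" "a \<longlonglongrightarrow> x" "\<forall>n. b n \<in> ?S" "b \<longlonglongrightarrow> y" by (elim exE conjE)
    have "(\<forall>n. a n + b n \<in> ?S) \<and> (\<lambda>n. a n + b n) \<longlonglongrightarrow> x + y"
      using ab(1,3) tendsto_add[OF ab(2,4)] add by simp
    then show "x + y \<in> closure ?S" unfolding closure_sequential by (rule exI[of _ "\<lambda>n. a n + b n"])
  next
    fix x c assume "x \<in> closure ?S"
    then have "\<exists>a. (\<forall>n. a n \<in> ?S) \<and> a \<longlonglongrightarrow> x" unfolding closure_sequential .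
    then obtain a where a: "\<forall>n. a n \<in> ?S" "a \<longlonglongrightarrow> x" by (elim exE conjE)
    have "(\<forall>n. c *\<^sub>R a n \<in> ?S) \<and> (\<lambda>n. c *\<^sub>R a n) \<longlonglongrightarrow> c *\<^sub>R x"
      using a(1) tendsto_scaleR[OF tendsto_const a(2)] scale by simp
    then show "c *\<^sub>R x \<in> closure ?S" unfolding closure_sequential by (rule exI[of _ "\<lambda>n. c *\<^sub>R a n"])
  qed
qed

lemma closed_H10_graph: "closed (H10_graph \<Omega>)"
  by (simp add: H10_graph_def)

lemma graph_mem: "f \<in> test_functions \<Omega> \<Longrightarrow> graph f \<in> H10_graph \<Omega>"
  unfolding H10_graph_def using closure_subset[of "graph ` test_functions \<Omega>"] by blast

section \<open>Weak gradients and elements of the closed graph\<close>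

lemma dist_real_imag_vector_square:
  fixes F G :: "'a::euclidean_space \<Rightarrow> 'a \<Rightarrow> complex"
  assumes F: "\<And>b. b \<in> Basis \<Longrightarrow> square_integrable (F b)" and G: "\<And>b. b \<in> Basis \<Longrightarrow> square_integrable (G b)"
  shows "(dist (L2 (\<lambda>x. real_imag_vector (\<lambda>b. F b x))) (L2 (\<lambda>x. real_imag_vector (\<lambda>b. G b x))))\<^sup>2
    = (\<Sum>b\<in>Basis. (dist (L2 (F b)) (L2 (G b)))\<^sup>2)"
proof -
  have sF: "square_integrable (\<lambda>x. real_imag_vector (\<lambda>b. F b x))" by (rule square_integrable_real_imag_vector) (rule F)
  have sG: "square_integrable (\<lambda>x. real_imag_vector (\<lambda>b. G b x))" by (rule square_integrable_real_imag_vector) (rule G)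
  have d: "square_integrable (\<lambda>x. F b x - G b x)" if "b \<in> Basis" for b using that F G square_integrable_diff by blast
  have "(dist (L2 (\<lambda>x. real_imag_vector (\<lambda>b. F b x))) (L2 (\<lambda>x. real_imag_vector (\<lambda>b. G b x))))\<^sup>2
     = (norm (L2 (\<lambda>x. real_imag_vector (\<lambda>b. F b x - G b x))))\<^sup>2"
    unfolding dist_norm L2_minus[OF sF sG] real_imag_vector_diff ..
  also have "\<dots> = (\<integral>x. (\<Sum>b\<in>Basis. (cmod (F b x - G b x))\<^sup>2) \<partial>lborel)"
    using square_integrable_real_imag_vector[of "\<lambda>b x. F b x - G b x"] d by (simp add: norm_L2_square norm_real_imag_vector)
  also have "\<dots> = (\<Sum>b\<in>Basis. \<integral>x. (cmod (F b x - G b x))\<^sup>2 \<partial>lborel)"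
    using d by (intro Bochner_Integration.integral_sum) (simp add: square_integrable_def)
  also have "\<dots> = (\<Sum>b\<in>Basis. (dist (L2 (F b)) (L2 (G b)))\<^sup>2)"
    using F G d by (intro sum.cong) (simp_all add: dist_norm L2_minus norm_L2_square)
  finally show ?thesis .
qed

lemma tendsto_real_imag_vector_iff:
  fixes F :: "nat \<Rightarrow> 'a::euclidean_space \<Rightarrow> 'a \<Rightarrow> complex" and G :: "'a \<Rightarrow> 'a \<Rightarrow> complex"
  assumes F: "\<And>k b. b \<in> Basis \<Longrightarrow> square_integrable (F k b)" and G: "\<And>b. b \<in> Basis \<Longrightarrow> square_integrable (G b)"
  shows "(\<lambda>k. L2 (\<lambda>x. real_imag_vector (\<lambda>b. F k b x))) \<longlonglongrightarrow> L2 (\<lambda>x. real_imag_vector (\<lambda>b. G b x))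
    \<longleftrightarrow> (\<forall>b\<in>Basis. (\<lambda>k. L2 (F k b)) \<longlonglongrightarrow> L2 (G b))"
proof
  have sq: "X \<longlonglongrightarrow> l \<longleftrightarrow> (\<lambda>k. (dist (X k) l)\<^sup>2) \<longlonglongrightarrow> 0" for X :: "nat \<Rightarrow> 'z::metric_space" and l
    unfolding tendsto_dist_iff[of X] by simp
  have deq: "(dist (L2 (\<lambda>x. real_imag_vector (\<lambda>b. F k b x))) (L2 (\<lambda>x. real_imag_vector (\<lambda>b. G b x))))\<^sup>2
      = (\<Sum>b\<in>Basis. (dist (L2 (F k b)) (L2 (G b)))\<^sup>2)" for k
    by (rule dist_real_imag_vector_square) (fact F, fact G)
  have sqv: "(\<lambda>k. L2 (\<lambda>x. real_imag_vector (\<lambda>b. F k b x))) \<longlonglongrightarrow> L2 (\<lambda>x. real_imag_vector (\<lambda>b. G b x))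
      \<longleftrightarrow> (\<lambda>k. \<Sum>b\<in>Basis. (dist (L2 (F k b)) (L2 (G b)))\<^sup>2) \<longlonglongrightarrow> 0"
    unfolding sq[of "\<lambda>k. L2 (\<lambda>x. real_imag_vector (\<lambda>b. F k b x))"] deq ..
  {
    assume lim: "(\<lambda>k. L2 (\<lambda>x. real_imag_vector (\<lambda>b. F k b x))) \<longlonglongrightarrow> L2 (\<lambda>x. real_imag_vector (\<lambda>b. G b x))"
    show "\<forall>b\<in>Basis. (\<lambda>k. L2 (F k b)) \<longlonglongrightarrow> L2 (G b)"
    proof
      fix b :: 'a assume b: "b \<in> Basis"
      have "(\<lambda>k. (dist (L2 (F k b)) (L2 (G b)))\<^sup>2) \<longlonglongrightarrow> 0"
      proof (rule Lim_null_comparison[OF _ lim[unfolded sqv]])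
        have "norm ((dist (L2 (F k b)) (L2 (G b)))\<^sup>2) \<le> (\<Sum>b\<in>Basis. (dist (L2 (F k b)) (L2 (G b)))\<^sup>2)" for k
          using member_le_sum[OF b, of "\<lambda>b. (dist (L2 (F k b)) (L2 (G b)))\<^sup>2"] by simp
        then show "\<forall>\<^sub>F k in sequentially. norm ((dist (L2 (F k b)) (L2 (G b)))\<^sup>2) \<le> (\<Sum>b\<in>Basis. (dist (L2 (F k b)) (L2 (G b)))\<^sup>2)"
          by (intro always_eventually allI)
      qed
      then show "(\<lambda>k. L2 (F k b)) \<longlonglongrightarrow> L2 (G b)" unfolding sq[of "\<lambda>k. L2 (F k b)"] .
    qed
  next
    assume l: "\<forall>b\<in>Basis. (\<lambda>k. L2 (F k b)) \<longlonglongrightarrow> L2 (G b)"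
    have "(\<lambda>k. (dist (L2 (F k b)) (L2 (G b)))\<^sup>2) \<longlonglongrightarrow> 0" if "b \<in> Basis" for b
      using l that sq[of "\<lambda>k. L2 (F k b)" "L2 (G b)"] by blast
    then have "(\<lambda>k. \<Sum>b\<in>Basis. (dist (L2 (F k b)) (L2 (G b)))\<^sup>2) \<longlonglongrightarrow> (\<Sum>b\<in>(Basis::'a set). 0)"
      by (rule tendsto_sum)
    then show "(\<lambda>k. L2 (\<lambda>x. real_imag_vector (\<lambda>b. F k b x))) \<longlonglongrightarrow> L2 (\<lambda>x. real_imag_vector (\<lambda>b. G b x))"
      unfolding sqv by simp
  }
qed

lemma H10_grad_D:
  assumes "H10_grad \<Omega> v G"
  shows "square_integrable v" "\<And>b. b \<in> Basis \<Longrightarrow> square_integrable (G b)"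
    "(L2 v, L2 (\<lambda>x. real_imag_vector (\<lambda>b. G b x))) \<in> H10_graph \<Omega>"
proof -
  from assms obtain f where f: "\<And>k. f k \<in> test_functions \<Omega>" "L2_tendsto f v"
    "\<And>b. b \<in> Basis \<Longrightarrow> L2_tendsto (\<lambda>k. pderiv_dir b (f k)) (G b)"
    and m: "v \<in> borel_measurable lborel" "\<And>b. b \<in> Basis \<Longrightarrow> G b \<in> borel_measurable lborel"
    unfolding H10_grad_def by auto
  have C1: "f k \<in> C1_functions" for k using f(1) test_functions_C1 by blast
  show v: "square_integrable v" by (rule L2_tendsto_square_integrable[OF C1_square_integrable[OF C1] m(1) f(2)])
  show G: "square_integrable (G b)" if "b \<in> Basis" for b
    by (rule L2_tendsto_square_integrable[OF C1_pderiv_square_integrable[OF C1 that] m(2)[OF that] f(3)[OF that]])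
  have "(\<lambda>k. L2 (f k)) \<longlonglongrightarrow> L2 v"
    using f(2) L2_tendsto_iff[of f v] C1_square_integrable[OF C1] v by blast
  moreover have "(\<lambda>k. L2 (gradient (f k))) \<longlonglongrightarrow> L2 (\<lambda>x. real_imag_vector (\<lambda>b. G b x))"
    unfolding gradient_def[abs_def]
  proof (subst tendsto_real_imag_vector_iff)
    show "\<forall>b\<in>Basis. (\<lambda>k. L2 (pderiv_dir b (f k))) \<longlonglongrightarrow> L2 (G b)"
    proof
      fix b :: 'a assume b: "b \<in> Basis"
      show "(\<lambda>k. L2 (pderiv_dir b (f k))) \<longlonglongrightarrow> L2 (G b)"
        using f(3)[OF b] L2_tendsto_iff[of "\<lambda>k. pderiv_dir b (f k)" "G b", OF C1_pderiv_square_integrable[OF C1 b] G[OF b]] by simp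
    qed
  qed (auto intro: C1_pderiv_square_integrable C1 G)
  ultimately have "(\<lambda>k. graph (f k)) \<longlonglongrightarrow> (L2 v, L2 (\<lambda>x. real_imag_vector (\<lambda>b. G b x)))"
    unfolding graph_def by (rule tendsto_Pair)
  then show "(L2 v, L2 (\<lambda>x. real_imag_vector (\<lambda>b. G b x))) \<in> H10_graph \<Omega>"
    unfolding H10_graph_def closure_sequential using f(1) by (intro exI[of _ "\<lambda>k. graph (f k)"] conjI) auto
qed

lemma H10_graph_cases:
  fixes p :: "('a::euclidean_space, complex) L2 \<times> ('a, 'a \<times> 'a) L2"
  assumes "p \<in> H10_graph \<Omega>"
  obtains v G where "H10_grad \<Omega> v G" "p = (L2 v, L2 (\<lambda>x. real_imag_vector (\<lambda>b. G b x)))"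
proof -
  from assms obtain F where F: "\<And>k. F k \<in> graph ` test_functions \<Omega>" "F \<longlonglongrightarrow> p"
    unfolding H10_graph_def closure_sequential by blast
  then have "\<forall>k. \<exists>f\<in>test_functions \<Omega>. F k = graph f" by blast
  then obtain f where f: "\<And>k. f k \<in> test_functions \<Omega>" "\<And>k. F k = graph (f k)" by metis
  have C1: "f k \<in> C1_functions" for k using f(1) test_functions_C1 by blast
  obtain v where v: "square_integrable v" "fst p = L2 v" by (rule L2_cases)
  obtain w where w: "square_integrable w" "snd p = L2 w" by (rule L2_cases)
  \<comment> \<open>Undoes \<open>real_imag_vector\<close>: the weak derivative in direction b from
    the b-th coordinates of the two halves of w.\<close>
  define G where "G b x = Complex (fst (w x) \<bullet> b) (snd (w x) \<bullet> b)" for b x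
  have wG: "w x = real_imag_vector (\<lambda>b. G b x)" for x
    by (simp add: real_imag_vector_def G_def euclidean_representation)
  have [measurable]: "w \<in> borel_measurable borel" "v \<in> borel_measurable borel"
    using v w by (auto simp: square_integrable_def)
  have "fst \<in> borel_measurable (borel :: ('a \<times> 'a) measure)" "snd \<in> borel_measurable (borel :: ('a \<times> 'a) measure)"
    by (intro borel_measurable_continuous_onI continuous_intros)+
  note [measurable] = this[THEN measurable_compose[OF \<open>w \<in> borel_measurable borel\<close>]]
  have Gm[measurable]: "G b \<in> borel_measurable borel" for b
    unfolding G_def[abs_def] Complex_eq by measurable
  have G: "square_integrable (G b)" if b: "b \<in> Basis" for b
  proof -
    have "integrable lborel (\<lambda>x. (norm (G b x))\<^sup>2)"
    proof (rule Bochner_Integration.integrable_bound)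
      show "integrable lborel (\<lambda>x. (norm (w x))\<^sup>2)" using w by (simp add: square_integrable_def)
      have "(norm (G b x))\<^sup>2 \<le> (norm (w x))\<^sup>2" for x
        unfolding wG norm_real_imag_vector using b by (intro member_le_sum) auto
      then show "AE x in lborel. norm ((norm (G b x))\<^sup>2) \<le> norm ((norm (w x))\<^sup>2)" by simp
    qed measurable
    then show ?thesis by (simp add: square_integrable_def)
  qed
  have p: "p = (L2 v, L2 (\<lambda>x. real_imag_vector (\<lambda>b. G b x)))" using v w wG by (simp add: prod_eq_iff flip: wG)
  have lim: "(\<lambda>k. L2 (f k)) \<longlonglongrightarrow> L2 v" "(\<lambda>k. L2 (gradient (f k))) \<longlonglongrightarrow> L2 (\<lambda>x. real_imag_vector (\<lambda>b. G b x))"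
    using tendsto_fst[OF F(2)] tendsto_snd[OF F(2)] unfolding f(2) graph_def p by simp_all
  have "\<forall>b\<in>Basis. (\<lambda>k. L2 (pderiv_dir b (f k))) \<longlonglongrightarrow> L2 (G b)"
    using lim(2) unfolding gradient_def[abs_def]
    by (subst (asm) tendsto_real_imag_vector_iff) (auto intro: C1_pderiv_square_integrable C1 G)
  then have gl: "\<forall>b\<in>Basis. L2_tendsto (\<lambda>k. pderiv_dir b (f k)) (G b)"
    using L2_tendsto_iff[of "\<lambda>k. pderiv_dir b (f k)" "G b" for b, OF C1_pderiv_square_integrable[OF C1] G] by simp
  have vl: "L2_tendsto f v" using L2_tendsto_iff[of f v] C1_square_integrable[OF C1] v lim(1) by blast
  have "H10_grad \<Omega> v G" unfolding H10_grad_def using f(1) vl gl by auto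
  then show ?thesis using p that by blast
qed

lemma fst_H10_graph_zero_outside:
  assumes \<Omega>: "open \<Omega>" and p: "p \<in> H10_graph \<Omega>"
  shows "fst p \<in> zero_outside \<Omega>"
proof -
  from p obtain F where F: "\<And>k. F k \<in> graph ` test_functions \<Omega>" "F \<longlonglongrightarrow> p"
    unfolding H10_graph_def closure_sequential by blast
  have "fst (F k) \<in> zero_outside \<Omega>" for k
    using F(1)[of k] by (auto simp: graph_def L2_mem_zero_outside test_function_square_integrable test_functions_eq_0)
  moreover have "closed (zero_outside \<Omega> :: ('a, complex) L2 set)" using \<Omega> by (intro closed_zero_outside) simp
  ultimately show ?thesis using closed_sequentially[OF _ _ tendsto_fst[OF F(2)]] by blast
qed

text \<open>Rellich's theorem speaks of test functions; x k is replaced by the graph of one at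
  distance below 1 / (k + 1), which preserves boundedness and the convergence of first
  components.\<close>

lemma H10_graph_compact:
  fixes x :: "nat \<Rightarrow> ('a::euclidean_space, complex) L2 \<times> ('a, 'a \<times> 'a) L2"
  assumes \<Omega>: "bounded \<Omega>" "open \<Omega>" and x: "\<And>k. x k \<in> H10_graph \<Omega>" "bounded (range x)"
  shows "\<exists>r :: nat \<Rightarrow> nat. strict_mono r \<and> Cauchy (\<lambda>k. fst (x (r k)))"
proof -
  have "\<exists>f\<in>test_functions \<Omega>. dist (graph f) (x k) < 1 / real (Suc k)" for k
    using x(1)[of k] unfolding H10_graph_def closure_approachable by simp
  then obtain f where f: "\<And>k. f k \<in> test_functions \<Omega>" "\<And>k. dist (graph (f k)) (x k) < 1 / real (Suc k)" by metis
  obtain B where B: "\<And>k. norm (x k) \<le> B" using x(2) by (auto simp: bounded_iff)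
  have nb: "norm (graph (f k)) \<le> B + 1" for k
  proof -
    have "norm (graph (f k)) \<le> norm (x k) + norm (graph (f k) - x k)" using norm_triangle_sub by blast
    moreover have "norm (graph (f k) - x k) \<le> 1 / real (Suc k)" using f(2)[of k] by (simp add: dist_norm)
    moreover have "1 / real (Suc k) \<le> 1" by simp
    ultimately show ?thesis using B[of k] by linarith
  qed
  have nf: "norm (L2 (f k)) \<le> B + 1" "norm (L2 (gradient (f k))) \<le> B + 1" for k
    using nb[of k] norm_fst_le[of "L2 (f k)" "L2 (gradient (f k))"] norm_snd_le[of "L2 (gradient (f k))" "L2 (f k)"]
    unfolding graph_def by linarith+
  from rellich[of \<Omega> f, OF \<Omega> f(1) nf] obtain r :: "nat \<Rightarrow> nat" where r: "strict_mono r" "Cauchy (\<lambda>k. L2 (f (r k)))"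
    by (elim exE conjE)
  have d0: "(\<lambda>k. dist (L2 (f (r k))) (fst (x (r k)))) \<longlonglongrightarrow> 0"
  proof (rule Lim_null_comparison)
    show "(\<lambda>k. 1 / real (Suc k)) \<longlonglongrightarrow> 0" using LIMSEQ_inverse_real_of_nat by (simp add: inverse_eq_divide)
    have "dist (L2 (f (r k))) (fst (x (r k))) \<le> 1 / real (Suc k)" for k
    proof -
      have "dist (L2 (f (r k))) (fst (x (r k))) \<le> dist (graph (f (r k))) (x (r k))"
        using dist_fst_le[of "graph (f (r k))" "x (r k)"] by (simp add: graph_def)
      also have "\<dots> \<le> 1 / real (Suc (r k))" using f(2) less_imp_le by blast
      also have "\<dots> \<le> 1 / real (Suc k)" using seq_suble[OF r(1), of k] by (simp add: frac_le)
      finally show ?thesis .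
    qed
    then show "\<forall>\<^sub>F k in sequentially. norm (dist (L2 (f (r k))) (fst (x (r k)))) \<le> 1 / real (Suc k)" by simp
  qed
  obtain l where l: "(\<lambda>k. L2 (f (r k))) \<longlonglongrightarrow> l" using r(2) Cauchy_convergent convergent_def by blast
  have "(\<lambda>k. L2 (f (r k)) - fst (x (r k))) \<longlonglongrightarrow> 0"
    by (rule tendsto_norm_zero_cancel) (use d0 in \<open>simp only: dist_norm\<close>)
  from tendsto_diff[OF l this] have "(\<lambda>k. fst (x (r k))) \<longlonglongrightarrow> l" by simp
  then show ?thesis using r(1) LIMSEQ_imp_Cauchy by blast
qed

section \<open>Complex scalar products, complex multiples and the weak equation\<close>

lemma
  assumes u: "square_integrable u" and v: "square_integrable v" and z: "AE x in lborel. x \<notin> \<Omega> \<longrightarrow> v x = 0"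
    and [measurable]: "\<Omega> \<in> sets borel"
  shows Re_L2_inner: "Re (L2_inner \<Omega> u v) = L2 u \<bullet> L2 v"
    and L2_inner_whole_space: "L2_inner \<Omega> u v = (\<integral>x. u x * cnj (v x) \<partial>lborel)"
proof -
  have [measurable]: "u \<in> borel_measurable borel" "v \<in> borel_measurable borel" using u v by (auto simp: square_integrable_def)
  have [measurable]: "cnj \<in> borel_measurable borel"
    by (intro borel_measurable_continuous_onI continuous_intros)
  have int: "integrable lborel (\<lambda>x. u x * cnj (v x))"
    by (rule Bochner_Integration.integrable_bound[OF integrable_mult_square[OF u v]]) (auto simp: norm_mult)
  show eq: "L2_inner \<Omega> u v = (\<integral>x. u x * cnj (v x) \<partial>lborel)"
    unfolding L2_inner_def set_lebesgue_integral_def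
    by (rule integral_cong_AE) (use z in \<open>auto simp: indicator_def elim!: AE_mp\<close>)
  have "u x * cnj (v x) = Complex (u x \<bullet> v x) (Im (u x * cnj (v x)))" for x
    by (simp add: complex_eq_iff inner_complex_def)
  then have "Re (u x * cnj (v x)) = u x \<bullet> v x" for x by (metis complex.sel(1))
  then show "Re (L2_inner \<Omega> u v) = L2 u \<bullet> L2 v"
    unfolding eq L2_inner_eq[OF u v] integral_Re[OF int, symmetric] by simp
qed

lemma L2_inner_cmult_left: "L2_inner \<Omega> (\<lambda>x. c * u x) v = c * L2_inner \<Omega> u v"
proof -
  have "indicator \<Omega> x *\<^sub>R (c * u x * cnj (v x)) = c * (indicator \<Omega> x *\<^sub>R (u x * cnj (v x)))" for x
    by (simp add: mult.assoc)
  then show ?thesis unfolding L2_inner_def set_lebesgue_integral_def by (simp only: integral_mult_right_zero)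
qed

lemma L2_inner_cmult_right: "L2_inner \<Omega> u (\<lambda>x. c * v x) = cnj c * L2_inner \<Omega> u v"
proof -
  have "indicator \<Omega> x *\<^sub>R (u x * cnj (c * v x)) = cnj c * (indicator \<Omega> x *\<^sub>R (u x * cnj (v x)))" for x
    by (simp add: mult.assoc mult.left_commute)
  then show ?thesis unfolding L2_inner_def set_lebesgue_integral_def by (simp only: integral_mult_right_zero)
qed


lemma L2_tendsto_cmult: "L2_tendsto f u \<Longrightarrow> L2_tendsto (\<lambda>k x. c * f k x) (\<lambda>x. c * u x)"
  if meas: "\<And>k. f k \<in> borel_measurable lborel" "u \<in> borel_measurable lborel"
proof -
  assume l: "L2_tendsto f u"
  have [measurable]: "\<And>k. f k \<in> borel_measurable borel" "u \<in> borel_measurable borel" using meas by auto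
  have "(\<integral>\<^sup>+x. ennreal ((cmod (c * f k x - c * u x))\<^sup>2) \<partial>lborel)
     = ennreal ((cmod c)\<^sup>2) * (\<integral>\<^sup>+x. ennreal ((cmod (f k x - u x))\<^sup>2) \<partial>lborel)" for k
    by (subst nn_integral_cmult[symmetric])
       (auto simp: norm_mult power_mult_distrib ennreal_mult[symmetric] simp flip: right_diff_distrib)
  moreover have "(\<lambda>k. ennreal ((cmod c)\<^sup>2) * (\<integral>\<^sup>+x. ennreal ((cmod (f k x - u x))\<^sup>2) \<partial>lborel)) \<longlonglongrightarrow> ennreal ((cmod c)\<^sup>2) * 0"
    using l unfolding L2_tendsto_def by (intro ennreal_tendsto_cmult) auto
  ultimately show ?thesis unfolding L2_tendsto_def by simp
qed

lemma H10_grad_cmult: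
  fixes v :: "'a::euclidean_space \<Rightarrow> complex"
  assumes "H10_grad \<Omega> v G"
  shows "H10_grad \<Omega> (\<lambda>x. c * v x) (\<lambda>b x. c * G b x)"
proof -
  from assms obtain f where f: "\<And>k. f k \<in> test_functions \<Omega>" "L2_tendsto f v"
    "\<And>b. b \<in> Basis \<Longrightarrow> L2_tendsto (\<lambda>k. pderiv_dir b (f k)) (G b)"
    and m: "v \<in> borel_measurable lborel" "\<And>b. b \<in> Basis \<Longrightarrow> G b \<in> borel_measurable lborel"
    unfolding H10_grad_def by auto
  have C1: "f k \<in> C1_functions" for k using f(1) test_functions_C1 by blast
  have fm: "f k \<in> borel_measurable lborel" for k using C1_integrable[OF C1] by auto
  have gm: "pderiv_dir b (f k) \<in> borel_measurable lborel" if "b \<in> Basis" for b k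
    using C1_pderiv_integrable[OF C1 that] by auto
  have "\<forall>k. (\<lambda>x. c * f k x) \<in> test_functions \<Omega>" using f(1) test_functions_cmult by blast
  moreover have "L2_tendsto (\<lambda>k x. c * f k x) (\<lambda>x. c * v x)" by (rule L2_tendsto_cmult[OF fm m(1) f(2)])
  moreover have "\<forall>b\<in>Basis. L2_tendsto (\<lambda>k. pderiv_dir b (\<lambda>x. c * f k x)) (\<lambda>x. c * G b x)"
  proof
    fix b :: 'a assume b: "b \<in> Basis"
    have "L2_tendsto (\<lambda>k x. c * pderiv_dir b (f k) x) (\<lambda>x. c * G b x)" by (rule L2_tendsto_cmult[OF gm[OF b] m(2)[OF b] f(3)[OF b]])
    then show "L2_tendsto (\<lambda>k. pderiv_dir b (\<lambda>x. c * f k x)) (\<lambda>x. c * G b x)"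
      by (simp add: pderiv_dir_cmult C1_differentiable C1)
  qed
  ultimately show ?thesis unfolding H10_grad_def using m by (auto intro!: exI[of _ "\<lambda>k x. c * f k x"])
qed

lemma dirichlet_eigenpair_cmult:
  assumes "dirichlet_eigenpair \<Omega> \<mu> v" "c \<noteq> 0"
  shows "dirichlet_eigenpair \<Omega> \<mu> (\<lambda>x. c * v x)"
proof -
  from assms(1) obtain G where G: "\<not> (AE x in lborel. v x = 0)" "H10_grad \<Omega> v G"
    "\<And>\<psi>. \<psi> \<in> test_functions \<Omega> \<Longrightarrow> (\<Sum>b\<in>Basis. L2_inner \<Omega> (G b) (pderiv_dir b \<psi>)) = of_real \<mu> * L2_inner \<Omega> v \<psi>"
    unfolding dirichlet_eigenpair_def by blast
  have "(\<Sum>b\<in>Basis. L2_inner \<Omega> (\<lambda>x. c * G b x) (pderiv_dir b \<psi>)) = of_real \<mu> * L2_inner \<Omega> (\<lambda>x. c * v x) \<psi>"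
    if "\<psi> \<in> test_functions \<Omega>" for \<psi>
    using G(3)[OF that] by (simp add: L2_inner_cmult_left sum_distrib_left[symmetric])
  then show ?thesis unfolding dirichlet_eigenpair_def using G(1) H10_grad_cmult[OF G(2), of c] assms(2) by auto
qed

text \<open>Integrals over \<Omega> become integrals over the whole space because \<psi> and its
  derivatives vanish outside \<Omega>; this puts the weak equation into the Hilbert space
  \<open>L2\<close>.\<close>

lemma weak_equation_real_form:
  assumes \<Omega>: "open \<Omega>" and H: "H10_grad \<Omega> v G" and \<psi>: "\<psi> \<in> test_functions \<Omega>"
  shows "Re (\<Sum>b\<in>Basis. L2_inner \<Omega> (G b) (pderiv_dir b \<psi>)) = L2 (\<lambda>x. real_imag_vector (\<lambda>b. G b x)) \<bullet> L2 (gradient \<psi>)"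
    and "Re (L2_inner \<Omega> v \<psi>) = L2 v \<bullet> L2 \<psi>"
proof -
  note HD = H10_grad_D[OF H]
  have C1: "\<psi> \<in> C1_functions" using \<psi> test_functions_C1 by blast
  have [measurable]: "\<Omega> \<in> sets borel" using \<Omega> by simp
  have out: "pderiv_dir b \<psi> x = 0" if "x \<notin> \<Omega>" for x b
    using pderiv_dir_eq_0[of x \<psi> b] \<psi> that by (auto simp: test_functions_def)
  have "Re (\<Sum>b\<in>Basis. L2_inner \<Omega> (G b) (pderiv_dir b \<psi>)) = (\<Sum>b\<in>Basis. L2 (G b) \<bullet> L2 (pderiv_dir b \<psi>))"
    unfolding Re_sum by (intro sum.cong refl Re_L2_inner HD C1_pderiv_square_integrable C1) (auto simp: out)
  also have "\<dots> = (\<Sum>b\<in>Basis. \<integral>x. G b x \<bullet> pderiv_dir b \<psi> x \<partial>lborel)"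
    by (intro sum.cong refl L2_inner_eq HD C1_pderiv_square_integrable C1)
  also have "\<dots> = (\<integral>x. (\<Sum>b\<in>Basis. G b x \<bullet> pderiv_dir b \<psi> x) \<partial>lborel)"
    by (intro Bochner_Integration.integral_sum[symmetric] integrable_inner_square HD C1_pderiv_square_integrable C1)
  also have "\<dots> = L2 (\<lambda>x. real_imag_vector (\<lambda>b. G b x)) \<bullet> L2 (gradient \<psi>)"
    using HD C1_gradient_square_integrable[OF C1]
    by (subst L2_inner_eq) (auto intro: square_integrable_real_imag_vector simp: gradient_def inner_real_imag_vector)
  finally show "Re (\<Sum>b\<in>Basis. L2_inner \<Omega> (G b) (pderiv_dir b \<psi>)) = L2 (\<lambda>x. real_imag_vector (\<lambda>b. G b x)) \<bullet> L2 (gradient \<psi>)" .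
  show "Re (L2_inner \<Omega> v \<psi>) = L2 v \<bullet> L2 \<psi>"
    by (intro Re_L2_inner HD C1_square_integrable C1) (auto simp: test_functions_eq_0[OF \<psi>])
qed

text \<open>The graph scalar product adds that of the functions to that of the gradients, hence the
  factor 1 + \<mu>. The identity holds against graphs of test functions and extends to their closure
  by continuity.\<close>

lemma eigenpair_graph:
  fixes v :: "'a::euclidean_space \<Rightarrow> complex"
  assumes \<Omega>: "open \<Omega>" and e: "dirichlet_eigenpair \<Omega> \<mu> v"
  shows "square_integrable v"
    and "\<exists>\<epsilon>\<in>H10_graph \<Omega>. fst \<epsilon> = L2 v \<and> (\<forall>p\<in>H10_graph \<Omega>. \<epsilon> \<bullet> p = (1 + \<mu>) * (L2 v \<bullet> fst p))"
proof -
  from e obtain G where G: "H10_grad \<Omega> v G"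
    "\<And>\<psi>. \<psi> \<in> test_functions \<Omega> \<Longrightarrow> (\<Sum>b\<in>Basis. L2_inner \<Omega> (G b) (pderiv_dir b \<psi>)) = of_real \<mu> * L2_inner \<Omega> v \<psi>"
    unfolding dirichlet_eigenpair_def by blast
  note HD = H10_grad_D[OF G(1)]
  show "square_integrable v" by (rule HD)
  define \<epsilon> where "\<epsilon> = (L2 v, L2 (\<lambda>x. real_imag_vector (\<lambda>b. G b x)))"
  have "\<epsilon> \<bullet> p = (1 + \<mu>) * (L2 v \<bullet> fst p)" if p: "p \<in> H10_graph \<Omega>" for p
  proof -
    have test: "\<epsilon> \<bullet> graph \<psi> = (1 + \<mu>) * (L2 v \<bullet> fst (graph \<psi>))" if "\<psi> \<in> test_functions \<Omega>" for \<psi>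
      using weak_equation_real_form[OF \<Omega> G(1) that] G(2)[OF that]
      by (simp add: \<epsilon>_def graph_def inner_prod_def algebra_simps)
    from p obtain F where F: "\<And>k. F k \<in> graph ` test_functions \<Omega>" "F \<longlonglongrightarrow> p"
      unfolding H10_graph_def closure_sequential by blast
    have "(\<lambda>k. \<epsilon> \<bullet> F k) \<longlonglongrightarrow> \<epsilon> \<bullet> p" by (intro tendsto_intros F)
    moreover have "\<epsilon> \<bullet> F k = (1 + \<mu>) * (L2 v \<bullet> fst (F k))" for k using test F(1)[of k] by auto
    moreover have "(\<lambda>k. (1 + \<mu>) * (L2 v \<bullet> fst (F k))) \<longlonglongrightarrow> (1 + \<mu>) * (L2 v \<bullet> fst p)" by (intro tendsto_intros F)
    ultimately show ?thesis using LIMSEQ_unique by simp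
  qed
  then show "\<exists>\<epsilon>\<in>H10_graph \<Omega>. fst \<epsilon> = L2 v \<and> (\<forall>p\<in>H10_graph \<Omega>. \<epsilon> \<bullet> p = (1 + \<mu>) * (L2 v \<bullet> fst p))"
    using HD(3) by (intro bexI[of _ \<epsilon>]) (auto simp: \<epsilon>_def)
qed

text \<open>Converse of \<open>eigenpair_graph\<close>: it lets the maximality of an eigensystem
  feed the abstract spectral argument. The shift \<mu> - 1 removes the L2 part of the graph scalar
  product.\<close>

lemma eigenpair_if_eigenvector:
  fixes \<Omega> :: "'a::euclidean_space set"
  assumes \<Omega>: "open \<Omega>" and p: "p \<in> H10_graph \<Omega>" "p \<noteq> 0"
    and eig: "\<And>q. q \<in> H10_graph \<Omega> \<Longrightarrow> p \<bullet> q = \<mu> * (fst p \<bullet> fst q)"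
  obtains v where "dirichlet_eigenpair \<Omega> (\<mu> - 1) v" "fst p = L2 v"
proof -
  obtain v G where G: "H10_grad \<Omega> v G" "p = (L2 v, L2 (\<lambda>x. real_imag_vector (\<lambda>b. G b x)))"
    by (rule H10_graph_cases[OF p(1)])
  note HD = H10_grad_D[OF G(1)]
  have nz: "\<not> (AE x in lborel. v x = 0)"
  proof
    assume "AE x in lborel. v x = 0"
    then have "L2 v = 0" using HD(1) by (simp add: L2_zero L2_eq_iff square_integrable_zero)
    then have "p \<bullet> p = 0" using eig[OF p(1)] G(2) by simp
    then show False using p(2) by simp
  qed
  have re: "Re (\<Sum>b\<in>Basis. L2_inner \<Omega> (G b) (pderiv_dir b \<psi>)) = (\<mu> - 1) * Re (L2_inner \<Omega> v \<psi>)"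
    if \<psi>: "\<psi> \<in> test_functions \<Omega>" for \<psi>
    using weak_equation_real_form[OF \<Omega> G(1) \<psi>] eig[OF graph_mem[OF \<psi>]] G(2)
    by (simp add: graph_def inner_prod_def algebra_simps)
  have "(\<Sum>b\<in>Basis. L2_inner \<Omega> (G b) (pderiv_dir b \<psi>)) = of_real (\<mu> - 1) * L2_inner \<Omega> v \<psi>"
    if \<psi>: "\<psi> \<in> test_functions \<Omega>" for \<psi>
  proof -
    have C1: "\<psi> \<in> C1_functions" using \<psi> test_functions_C1 by blast
    \<comment> \<open>The real Hilbert space yields the equation for real parts; putting \<i> \<psi>
      for \<psi> gives the imaginary parts.\<close>
    have "(\<Sum>b\<in>Basis. L2_inner \<Omega> (G b) (pderiv_dir b (\<lambda>x. \<i> * \<psi> x))) = - \<i> * (\<Sum>b\<in>Basis. L2_inner \<Omega> (G b) (pderiv_dir b \<psi>))"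
      by (simp add: pderiv_dir_cmult C1_differentiable C1 L2_inner_cmult_right sum_negf sum_distrib_left)
    then have "Im (\<Sum>b\<in>Basis. L2_inner \<Omega> (G b) (pderiv_dir b \<psi>)) = (\<mu> - 1) * Im (L2_inner \<Omega> v \<psi>)"
      using re[OF test_functions_cmult[OF \<psi>, of \<i>]] by (simp add: L2_inner_cmult_right)
    then show ?thesis using re[OF \<psi>] by (simp add: complex_eq_iff)
  qed
  then have "dirichlet_eigenpair \<Omega> (\<mu> - 1) v" unfolding dirichlet_eigenpair_def using nz G(1) by blast
  then show ?thesis using that G(2) by simp
qed

text \<open>|u| \<le> 1 + |u|^2, and the constant 1 is integrable over a ball containing S.\<close>

lemma square_integrable_integrable:
  fixes u :: "'a::euclidean_space \<Rightarrow> complex"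
  assumes bd: "bounded S" and u: "square_integrable u" and out: "AE x in lborel. x \<notin> S \<longrightarrow> u x = 0"
  shows "integrable lborel u"
proof -
  obtain R where R: "S \<subseteq> ball 0 R" using bounded_subset_ball_radius[OF bd] by metis
  have [measurable]: "u \<in> borel_measurable lborel" using u by (simp add: square_integrable_def)
  show ?thesis
  proof (rule Bochner_Integration.integrable_bound)
    show "integrable lborel (\<lambda>x. indicator (ball 0 R) x + (norm (u x))\<^sup>2 :: real)"
      using u emeasure_lborel_ball_finite[of "0::'a" R] by (intro Bochner_Integration.integrable_add) (auto simp: square_integrable_def)
    show "AE x in lborel. norm (u x) \<le> norm (indicator (ball 0 R) x + (norm (u x))\<^sup>2 :: real)"
      using out
    proof eventually_elim
      case (elim x)
      show ?case
      proof (cases "x \<in> S")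
        case True
        have "0 \<le> (norm (u x) - 1/2)\<^sup>2" by simp
        then have "norm (u x) \<le> 1 + (norm (u x))\<^sup>2" by (simp add: power2_eq_square algebra_simps)
        moreover have "0 \<le> 1 + (norm (u x))\<^sup>2" by (simp add: add_nonneg_nonneg)
        ultimately show ?thesis using True R by auto
      qed (use elim in simp)
    qed
  qed measurable
qed

text \<open>Real scalar products with \<psi> and \<i> \<psi> determine the complex one, so the
  fundamental lemma for box bumps applies.\<close>

lemma AE_zero_if_orthogonal_to_test_functions:
  fixes r :: "'a::euclidean_space \<Rightarrow> complex"
  assumes \<Omega>: "bounded \<Omega>" "open \<Omega>" and r: "square_integrable r" "AE x in lborel. x \<notin> \<Omega> \<longrightarrow> r x = 0"
    and orth: "\<And>\<psi>. \<psi> \<in> test_functions \<Omega> \<Longrightarrow> L2 r \<bullet> L2 \<psi> = 0"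
  shows "AE x in lborel. r x = 0"
proof (rule AE_zero_if_orthogonal_to_box_bumps[OF square_integrable_integrable[OF \<Omega>(1) r] \<Omega>(2) r(2)])
  fix m and a b :: 'a assume "cbox a b \<subseteq> \<Omega>"
  define \<psi> where "\<psi> x = complex_of_real (box_bump m a b x)" for x
  have \<psi>: "\<psi> \<in> test_functions \<Omega>" unfolding \<psi>_def[abs_def] by (rule box_bump_test_function) fact
  have i\<psi>: "(\<lambda>x. \<i> * \<psi> x) \<in> test_functions \<Omega>" by (rule test_functions_cmult[OF \<psi>])
  have z: "AE x in lborel. x \<notin> \<Omega> \<longrightarrow> \<psi> x = 0" "AE x in lborel. x \<notin> \<Omega> \<longrightarrow> \<i> * \<psi> x = 0"
    using test_functions_eq_0[OF \<psi>] by auto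
  have [measurable]: "\<Omega> \<in> sets borel" using \<Omega> by simp
  note sq = test_function_square_integrable[OF \<psi>] test_function_square_integrable[OF i\<psi>]
  have "Re (L2_inner \<Omega> r \<psi>) = 0" "Re (L2_inner \<Omega> r (\<lambda>x. \<i> * \<psi> x)) = 0"
    using Re_L2_inner[OF r(1) sq(1) z(1)] Re_L2_inner[OF r(1) sq(2) z(2)] orth[OF \<psi>] orth[OF i\<psi>] by simp_all
  then have "L2_inner \<Omega> r \<psi> = 0" by (simp add: L2_inner_cmult_right complex_eq_iff)
  then show "(\<integral>x. r x * of_real (box_bump m a b x) \<partial>lborel) = 0"
    using L2_inner_whole_space[OF r(1) sq(1) z(1)] by (simp add: \<psi>_def)
qed

text \<open>An eigensystem over \<open>\<complex>\<close> is turned into one over \<open>\<real>\<close> by interleaving \<open>\<phi> j\<close> and \<open>\<i> \<phi> j\<close>.\<close>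

definition interleave :: "(nat \<Rightarrow> 'a \<Rightarrow> complex) \<Rightarrow> nat \<Rightarrow> 'a \<Rightarrow> complex" where
  "interleave \<phi> k x = (if even k then 1 else \<i>) * \<phi> (k div 2) x"

text \<open>Every complex eigenfunction contributes two real eigenvectors with the same eigenvalue,
  hence the index \<open>k div 2\<close>.\<close>

lemma real_eigensystem:
  fixes \<Omega> :: "'a::euclidean_space set"
  assumes \<Omega>: "bounded \<Omega>" "open \<Omega>" and es: "dirichlet_eigensystem \<Omega> lam \<phi>"
  obtains \<epsilon> where "\<And>k. \<epsilon> k \<in> H10_graph \<Omega>" "\<And>k. fst (\<epsilon> k) = L2 (interleave \<phi> k)"
    "\<And>k p. p \<in> H10_graph \<Omega> \<Longrightarrow> \<epsilon> k \<bullet> p = (1 + lam (k div 2)) * (fst (\<epsilon> k) \<bullet> fst p)"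
    "\<And>k. square_integrable (interleave \<phi> k)"
    "\<And>k. AE x in lborel. x \<notin> \<Omega> \<longrightarrow> interleave \<phi> k x = 0"
proof -
  have ep: "dirichlet_eigenpair \<Omega> (lam (k div 2)) (interleave \<phi> k)" for k
    unfolding interleave_def[abs_def] using es
    by (intro dirichlet_eigenpair_cmult) (auto simp: dirichlet_eigensystem_def)
  note eg = eigenpair_graph[OF \<Omega>(2) ep]
  from eg(2) obtain \<epsilon> where \<epsilon>: "\<And>k. \<epsilon> k \<in> H10_graph \<Omega>" "\<And>k. fst (\<epsilon> k) = L2 (interleave \<phi> k)"
    "\<And>k p. p \<in> H10_graph \<Omega> \<Longrightarrow> \<epsilon> k \<bullet> p = (1 + lam (k div 2)) * (L2 (interleave \<phi> k) \<bullet> fst p)"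
    by metis
  have "AE x in lborel. x \<notin> \<Omega> \<longrightarrow> interleave \<phi> k x = 0" for k
    using fst_H10_graph_zero_outside[OF \<Omega>(2) \<epsilon>(1)[of k]] eg(1)[of k] by (simp add: \<epsilon>(2) L2_mem_zero_outside)
  then show ?thesis using that[of \<epsilon>] \<epsilon> eg(1) by simp
qed

lemma
  fixes \<Omega> :: "'a::euclidean_space set"
  assumes \<Omega>: "bounded \<Omega>" "open \<Omega>" and es: "dirichlet_eigensystem \<Omega> lam \<phi>" and u: "square_integrable u"
  shows L2_interleave_even: "L2 u \<bullet> L2 (interleave \<phi> (2 * j)) = Re (L2_inner \<Omega> u (\<phi> j))"
    and L2_interleave_odd: "L2 u \<bullet> L2 (interleave \<phi> (Suc (2 * j))) = Im (L2_inner \<Omega> u (\<phi> j))"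
proof -
  obtain \<epsilon> where \<epsilon>: "\<And>k. \<epsilon> k \<in> H10_graph \<Omega>" "\<And>k. fst (\<epsilon> k) = L2 (interleave \<phi> k)"
    "\<And>k p. p \<in> H10_graph \<Omega> \<Longrightarrow> \<epsilon> k \<bullet> p = (1 + lam (k div 2)) * (fst (\<epsilon> k) \<bullet> fst p)"
    and si: "\<And>k. square_integrable (interleave \<phi> k)"
    and z: "\<And>k. AE x in lborel. x \<notin> \<Omega> \<longrightarrow> interleave \<phi> k x = 0"
    by (rule real_eigensystem[OF \<Omega> es]) blast
  have \<Omega>b: "\<Omega> \<in> sets borel" using \<Omega> by simp
  have e: "interleave \<phi> (2 * j) = (\<lambda>x. 1 * \<phi> j x)" "interleave \<phi> (Suc (2 * j)) = (\<lambda>x. \<i> * \<phi> j x)"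
    by (simp_all add: interleave_def[abs_def])
  show "L2 u \<bullet> L2 (interleave \<phi> (2 * j)) = Re (L2_inner \<Omega> u (\<phi> j))"
    using Re_L2_inner[OF u si z \<Omega>b, of "2 * j"] by (simp only: e(1) mult_1)
  show "L2 u \<bullet> L2 (interleave \<phi> (Suc (2 * j))) = Im (L2_inner \<Omega> u (\<phi> j))"
    using Re_L2_inner[OF u si z \<Omega>b, of "Suc (2 * j)"] by (simp add: e(2) L2_inner_cmult_right)
qed

text \<open>Both facts are read off the same real eigensystem. The second provides a test function
  whose energy exceeds a partial sum of N_t by at most d: this bounds D_t by N_t and, when the two
  agree, makes f a near-minimiser.\<close>

lemma
  fixes \<Omega> :: "'a::euclidean_space set"
  assumes \<Omega>: "bounded \<Omega>" "open \<Omega>" and es: "dirichlet_eigensystem \<Omega> lam \<phi>"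
  shows eigenvalue_nonneg: "0 \<le> lam j"
    and energy_approximation: "\<lbrakk>square_integrable u; AE x in lborel. x \<notin> \<Omega> \<longrightarrow> u x = 0; 0 < t; 0 < d\<rbrakk> \<Longrightarrow>
      \<exists>f\<in>test_functions \<Omega>. \<exists>m. (norm (L2 (gradient f)))\<^sup>2 + t * (norm (L2 u - L2 f))\<^sup>2
        \<le> (\<Sum>j<m. t * lam j / (t + lam j) * (cmod (L2_inner \<Omega> u (\<phi> j)))\<^sup>2) + d"
proof -
  obtain \<epsilon> where \<epsilon>: "\<And>k. \<epsilon> k \<in> H10_graph \<Omega>" "\<And>k. fst (\<epsilon> k) = L2 (interleave \<phi> k)"
    "\<And>k p. p \<in> H10_graph \<Omega> \<Longrightarrow> \<epsilon> k \<bullet> p = (1 + lam (k div 2)) * (fst (\<epsilon> k) \<bullet> fst p)"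
    and si: "\<And>k. square_integrable (interleave \<phi> k)"
    and z: "\<And>k. AE x in lborel. x \<notin> \<Omega> \<longrightarrow> interleave \<phi> k x = 0"
    by (rule real_eigensystem[OF \<Omega> es]) blast
  note even = L2_interleave_even[OF \<Omega> es] and odd = L2_interleave_odd[OF \<Omega> es]
  have parity: "\<exists>j. k = 2 * j \<or> k = Suc (2 * j)" for k :: nat by presburger
  have onc: "L2_inner \<Omega> (\<phi> i) (\<phi> j) = (if i = j then 1 else 0)" for i j
    using es unfolding dirichlet_eigensystem_def by blast
  have on: "fst (\<epsilon> i) \<bullet> fst (\<epsilon> j) = (if i = j then 1 else 0)" for i j
  proof -
    obtain p q where "i = 2 * p \<or> i = Suc (2 * p)" "j = 2 * q \<or> j = Suc (2 * q)" using parity by metis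
    moreover have "interleave \<phi> (2 * p) = (\<lambda>x. 1 * \<phi> p x)" "interleave \<phi> (Suc (2 * p)) = (\<lambda>x. \<i> * \<phi> p x)"
      by (simp_all add: interleave_def[abs_def])
    then have "L2_inner \<Omega> (interleave \<phi> (2 * p)) (\<phi> q) = (if p = q then 1 else 0)"
      "L2_inner \<Omega> (interleave \<phi> (Suc (2 * p))) (\<phi> q) = (if p = q then \<i> else 0)"
      using onc[of p q] by (simp_all only: L2_inner_cmult_left) auto
    moreover have "Suc (2 * p) \<noteq> 2 * q" "2 * p \<noteq> Suc (2 * q)" by presburger+
    ultimately show ?thesis unfolding \<epsilon>(2) using even[OF si, of i q] odd[OF si, of i q] by (auto split: if_splits)
  qed
  \<comment> \<open>Testing \<epsilon> k with itself: its squared graph norm is 1 + \<lambda>, and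
    at least the squared norm 1 of its first component.\<close>
  have lam: "0 \<le> lam (k div 2)" for k
  proof -
    have "1 + lam (k div 2) = \<epsilon> k \<bullet> \<epsilon> k" using \<epsilon>(3)[OF \<epsilon>(1), of k k] on[of k k] by simp
    also have "\<dots> = fst (\<epsilon> k) \<bullet> fst (\<epsilon> k) + snd (\<epsilon> k) \<bullet> snd (\<epsilon> k)" by (simp add: inner_prod_def)
    also have "\<dots> \<ge> 1" using on[of k k] by simp
    finally show ?thesis by simp
  qed
  show "0 \<le> lam j" using lam[of "2 * j"] by simp
  assume u: "square_integrable u" "AE x in lborel. x \<notin> \<Omega> \<longrightarrow> u x = 0" and t: "0 < t" and d: "0 < d"
  \<comment> \<open>Completeness: what is orthogonal to all eigenfunctions is orthogonal to the
    first components of the whole form domain, in particular to test functions, and so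
    vanishes.\<close>
  have total: "r = 0" if r: "r \<in> zero_outside \<Omega>" "\<And>k. r \<bullet> fst (\<epsilon> k) = 0" for r
  proof -
    have orth: "r \<bullet> fst v = 0" if v: "v \<in> H10_graph \<Omega>" for v
    \<comment> \<open>The factor c is a function of the vector, so an eigenvalue is attached to it
      through a chosen index; any index representing the vector serves.\<close>
    proof (rule spectral_orthogonality[where S="H10_graph \<Omega>" and P=fst and F="range \<epsilon>" and c="\<lambda>e. 1 + lam ((SOME k. e = \<epsilon> k) div 2)"])
      show "subspace (H10_graph \<Omega>)" "closed (H10_graph \<Omega>)" by (rule subspace_H10_graph closed_H10_graph)+
      show "\<exists>r :: nat \<Rightarrow> nat. strict_mono r \<and> Cauchy (\<lambda>k. fst (x (r k)))" if "\<And>k. x k \<in> H10_graph \<Omega>" "bounded (range x)" for x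
        using H10_graph_compact[OF \<Omega> that] .
      show "\<phi> \<bullet> v = (1 + lam ((SOME k. \<phi> = \<epsilon> k) div 2)) * (fst \<phi> \<bullet> fst v)" if "\<phi> \<in> range \<epsilon>" "v \<in> H10_graph \<Omega>" for \<phi> v
      proof -
        have "\<phi> = \<epsilon> (SOME k. \<phi> = \<epsilon> k)" using that(1) by (intro someI_ex[of "\<lambda>k. \<phi> = \<epsilon> k"]) auto
        then show ?thesis using \<epsilon>(3)[OF that(2), of "SOME k. \<phi> = \<epsilon> k"] by simp
      qed
      show "\<exists>e\<in>range \<epsilon>. fst p \<bullet> fst e \<noteq> 0"
        if p: "p \<in> H10_graph \<Omega>" "p \<noteq> 0" "\<And>q. q \<in> H10_graph \<Omega> \<Longrightarrow> p \<bullet> q = \<mu> * (fst p \<bullet> fst q)" for p \<mu>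
      proof -
        obtain w where w: "dirichlet_eigenpair \<Omega> (\<mu> - 1) w" "fst p = L2 w"
          by (rule eigenpair_if_eigenvector[OF \<Omega>(2) p])
        then obtain j where j: "L2_inner \<Omega> w (\<phi> j) \<noteq> 0" using es unfolding dirichlet_eigensystem_def by blast
        have "square_integrable w" by (rule eigenpair_graph(1)[OF \<Omega>(2) w(1)])
        \<comment> \<open>A nonzero complex scalar product has a nonzero real or imaginary part;
          these are the products with the even and the odd member of the pair.\<close>
        then have "fst p \<bullet> fst (\<epsilon> (2 * j)) \<noteq> 0 \<or> fst p \<bullet> fst (\<epsilon> (Suc (2 * j))) \<noteq> 0"
          using j by (simp add: \<epsilon>(2) w(2) even odd complex_eq_iff)
        then show ?thesis by blast
      qed
    qed (use r(2) v \<epsilon>(1) bounded_linear_fst in auto)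
    obtain q where q: "square_integrable q" "r = L2 q" by (rule L2_cases)
    have "AE x in lborel. q x = 0"
    proof (rule AE_zero_if_orthogonal_to_test_functions[OF \<Omega> q(1)])
      show "AE x in lborel. x \<notin> \<Omega> \<longrightarrow> q x = 0" using r(1) q by (simp add: L2_mem_zero_outside)
      show "L2 q \<bullet> L2 \<psi> = 0" if "\<psi> \<in> test_functions \<Omega>" for \<psi>
        using orth[OF graph_mem[OF that]] q(2) by (simp add: graph_def)
    qed
    then show ?thesis using q by (simp add: L2_zero L2_eq_iff square_integrable_zero)
  qed
  have uZ: "L2 u \<in> zero_outside \<Omega>" using u by (simp add: L2_mem_zero_outside)
  have cZ: "closed (zero_outside \<Omega> :: ('a, complex) L2 set)" using \<Omega> by (intro closed_zero_outside) simp
  have eZ: "fst (\<epsilon> k) \<in> zero_outside \<Omega>" for k by (rule fst_H10_graph_zero_outside[OF \<Omega>(2) \<epsilon>(1)])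
  \<comment> \<open>Half of d pays for truncating the expansion, the other half for passing from the
    closure to a test function.\<close>
  have "0 < d / 2" using d by simp
  from eigen_expansion_energy[where S="H10_graph \<Omega>" and P=fst and l="\<lambda>k. lam (k div 2)" and Z="zero_outside \<Omega>",
      OF subspace_H10_graph \<epsilon>(1) bounded_linear.linear[OF bounded_linear_fst] on \<epsilon>(3) lam subspace_zero_outside cZ eZ total uZ t this]
  obtain v m where v: "v \<in> H10_graph \<Omega>" and
    le: "(norm v)\<^sup>2 - (norm (fst v))\<^sup>2 + t * (norm (L2 u - fst v))\<^sup>2
      \<le> (\<Sum>k<m. t * lam (k div 2) / (t + lam (k div 2)) * (L2 u \<bullet> fst (\<epsilon> k))\<^sup>2) + d / 2" by blast
  define a where "a k = t * lam (k div 2) / (t + lam (k div 2)) * (L2 u \<bullet> fst (\<epsilon> k))\<^sup>2" for k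
  have a0: "a k \<ge> 0" for k unfolding a_def using t lam[of k] by (intro mult_nonneg_nonneg divide_nonneg_nonneg) auto
  \<comment> \<open>Doubling the range adds nonnegative terms and allows grouping in pairs, each
    pair making up one complex coefficient.\<close>
  have "(\<Sum>k<m. a k) \<le> (\<Sum>k<m * 2. a k)" using a0 by (intro sum_mono2) auto
  also have "\<dots> = (\<Sum>j<m. \<Sum>k\<in>{j * 2..<j * 2 + 2}. a k)" by (rule sum.nat_group[symmetric])
  also have "\<dots> = (\<Sum>j<m. t * lam j / (t + lam j) * (cmod (L2_inner \<Omega> u (\<phi> j)))\<^sup>2)"
  proof (rule sum.cong[OF refl])
    fix j
    have "{j * 2..<j * 2 + 2} = {2 * j, Suc (2 * j)}" by auto
    then have "(\<Sum>k\<in>{j * 2..<j * 2 + 2}. a k) = a (2 * j) + a (Suc (2 * j))" by simp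
    also have "\<dots> = t * lam j / (t + lam j) * (cmod (L2_inner \<Omega> u (\<phi> j)))\<^sup>2"
      by (simp add: a_def \<epsilon>(2) even[OF u(1)] odd[OF u(1)] cmod_power2 distrib_left)
    finally show "(\<Sum>k\<in>{j * 2..<j * 2 + 2}. a k) = t * lam j / (t + lam j) * (cmod (L2_inner \<Omega> u (\<phi> j)))\<^sup>2" .
  qed
  finally have sum_le: "(\<Sum>k<m. a k) \<le> (\<Sum>j<m. t * lam j / (t + lam j) * (cmod (L2_inner \<Omega> u (\<phi> j)))\<^sup>2)" .
  \<comment> \<open>On graphs the first two terms leave the Dirichlet energy. J is continuous on the
    product space, so J v is approximated along graphs of test functions.\<close>
  define J where "J p = (norm p)\<^sup>2 - (norm (fst p))\<^sup>2 + t * (norm (L2 u - fst p))\<^sup>2" for p :: "('a, complex) L2 \<times> ('a, 'a \<times> 'a) L2"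
  from v have "\<exists>F. (\<forall>k. F k \<in> graph ` test_functions \<Omega>) \<and> F \<longlonglongrightarrow> v"
    unfolding H10_graph_def closure_sequential .
  then obtain F where F: "\<And>k. F k \<in> graph ` test_functions \<Omega>" "F \<longlonglongrightarrow> v" by blast
  have "(\<lambda>k. J (F k)) \<longlonglongrightarrow> J v" unfolding J_def by (intro tendsto_intros F)
  moreover have "J v < J v + d / 2" using d by simp
  ultimately have "\<forall>\<^sub>F k in sequentially. J (F k) < J v + d / 2" by (rule order_tendstoD(2))
  then obtain k where k: "J (F k) < J v + d / 2" by (auto simp: eventually_sequentially)
  obtain f where f: "f \<in> test_functions \<Omega>" "F k = graph f" using F(1) by blast
  have "J (graph f) = (norm (L2 (gradient f)))\<^sup>2 + t * (norm (L2 u - L2 f))\<^sup>2"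
    unfolding J_def graph_def power2_norm_eq_inner by (simp add: inner_prod_def)
  then have "(norm (L2 (gradient f)))\<^sup>2 + t * (norm (L2 u - L2 f))\<^sup>2
     \<le> (\<Sum>j<m. t * lam j / (t + lam j) * (cmod (L2_inner \<Omega> u (\<phi> j)))\<^sup>2) + d"
    using k le[folded a_def J_def] sum_le f(2) by simp
  then show "\<exists>f\<in>test_functions \<Omega>. \<exists>m. (norm (L2 (gradient f)))\<^sup>2 + t * (norm (L2 u - L2 f))\<^sup>2
        \<le> (\<Sum>j<m. t * lam j / (t + lam j) * (cmod (L2_inner \<Omega> u (\<phi> j)))\<^sup>2) + d"
    using f(1) by blast
qed

section \<open>Functions in \<open>Hs_tilde\<close>\<close>

text \<open>The translates of the graph in the direction \<open>e\<close> are pairwise disjoint, so a bounded piece of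
  it cannot have positive measure.\<close>

lemma negligible_lipschitz_graph_ball:
  fixes e p :: "'a::euclidean_space"
  assumes e: "norm e = 1" and g: "L-lipschitz_on {y. y \<bullet> e = 0} g"
  shows "negligible ({x. g (x - (x \<bullet> e) *\<^sub>R e) = x \<bullet> e} \<inter> ball p r)"
proof -
  define \<pi> where "\<pi> x = x - (x \<bullet> e) *\<^sub>R e" for x
  have ee: "e \<bullet> e = 1" using e by (simp add: norm_eq_1)
  have \<pi>0: "\<pi> x \<in> {y. y \<bullet> e = 0}" for x by (simp add: \<pi>_def inner_diff ee)
  have "continuous_on UNIV (\<lambda>x. g (\<pi> x))"
    by (rule continuous_on_compose2[OF lipschitz_on_continuous_on[OF g]])
       (use \<pi>0 in \<open>auto simp: \<pi>_def intro!: continuous_intros\<close>)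
  then have "closed {x. g (\<pi> x) = x \<bullet> e}" by (intro closed_Collect_eq continuous_intros)
  then have K[measurable]: "{x. g (\<pi> x) = x \<bullet> e} \<inter> ball p r \<in> sets borel" by auto
  define K where "K = {x. g (\<pi> x) = x \<bullet> e} \<inter> ball p r"
  have [measurable]: "K \<in> sets borel" unfolding K_def by (rule K)
  \<comment> \<open>Infinitely many distinct shifts of length at most 1, so that all translates stay
    in the ball of radius r + 1.\<close>
  define a where "a k = 1 / real (Suc k)" for k
  define T where "T k = (\<lambda>x. - (a k *\<^sub>R e) + x) -` K" for k
  have a: "0 \<le> a k" "a k \<le> 1" for k by (auto simp: a_def)
  have [measurable]: "T k \<in> sets borel" for k
  proof -
    have "(\<lambda>x. - (a k *\<^sub>R e) + x) -` K \<inter> space borel \<in> sets borel" by (rule measurable_sets) measurable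
    then show ?thesis by (simp add: T_def)
  qed
  have Tball: "T k \<subseteq> ball p (r + 1)" for k
  proof
    fix x assume "x \<in> T k"
    then have "dist p (- (a k *\<^sub>R e) + x) < r" by (simp add: T_def K_def)
    moreover have "dist p x \<le> dist p (- (a k *\<^sub>R e) + x) + dist (- (a k *\<^sub>R e) + x) x" by (rule dist_triangle)
    moreover have "dist (- (a k *\<^sub>R e) + x) x \<le> 1" using a[of k] e by (simp add: dist_norm)
    ultimately show "x \<in> ball p (r + 1)" by simp
  qed
  have finb: "emeasure lborel (ball p (r + 1)) \<noteq> \<infinity>" using emeasure_lborel_ball_finite[of p "r + 1"] by simp
  have Tfin: "emeasure lborel (T k) \<noteq> \<infinity>" for k
    using emeasure_mono[OF Tball[of k], of lborel] finb by (auto simp: top_unique)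
  have meas: "measure lborel (T k) = measure lborel K" for k
  proof -
    have "emeasure lborel K = emeasure (distr lborel borel (\<lambda>x. - (a k *\<^sub>R e) + x)) K"
      by (simp only: lborel_distr_translation)
    also have "\<dots> = emeasure lborel ((\<lambda>x. - (a k *\<^sub>R e) + x) -` K \<inter> space lborel)"
      by (rule emeasure_distr) measurable
    also have "\<dots> = emeasure lborel (T k)" by (simp only: T_def space_lborel space_borel Int_UNIV_right)
    finally show ?thesis by (simp add: measure_def)
  qed
  \<comment> \<open>Shifting along e leaves \<pi> x unchanged, and on K the coordinate along e is a
    function of \<pi> x; so no line in direction e meets K twice.\<close>
  have disj: "T i \<inter> T j = {}" if "i \<noteq> j" for i j
  proof (rule ccontr)
    assume "T i \<inter> T j \<noteq> {}"
    then obtain x where x: "- (a i *\<^sub>R e) + x \<in> K" "- (a j *\<^sub>R e) + x \<in> K" by (auto simp: T_def)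
    have "\<pi> (- (c *\<^sub>R e) + x) = \<pi> x" for c by (simp add: \<pi>_def inner_add inner_diff ee algebra_simps)
    then have "(- (a i *\<^sub>R e) + x) \<bullet> e = (- (a j *\<^sub>R e) + x) \<bullet> e" using x unfolding K_def by auto
    then have "a i = a j" by (simp add: inner_add inner_diff ee)
    then show False using that by (simp add: a_def)
  qed
  have bound: "real N * measure lborel K \<le> measure lborel (ball p (r + 1))" for N
  proof -
    have "real N * measure lborel K = (\<Sum>k<N. measure lborel (T k))" by (simp add: meas)
    also have "\<dots> = measure lborel (\<Union>k<N. T k)"
      by (rule measure_finite_Union[symmetric]) (use Tfin disj in \<open>auto simp: disjoint_family_on_def\<close>)
    also have "\<dots> \<le> measure lborel (ball p (r + 1))"
      using Tball finb by (intro measure_mono_fmeasurable) (auto simp: fmeasurable_def top.not_eq_extremum)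
    finally show ?thesis .
  qed
  have "measure lborel K \<le> 0"
  proof (rule ccontr)
    assume "\<not> measure lborel K \<le> 0"
    then obtain N where "measure lborel (ball p (r + 1)) < real N * measure lborel K"
      using reals_Archimedean3[of "measure lborel K"] by auto
    then show False using bound[of N] by simp
  qed
  then have m0: "measure lborel K = 0" using measure_nonneg[of lborel K] by linarith
  have "emeasure lborel K \<noteq> \<infinity>"
    using emeasure_mono[of K "ball p r" lborel] emeasure_lborel_ball_finite[of p r] by (auto simp: K_def top_unique)
  then have "emeasure lborel K = 0" using m0 by (simp add: measure_def enn2real_eq_0_iff)
  then have "K \<in> null_sets lborel" by auto
  then have "K \<in> null_sets lebesgue" by (rule null_sets_completionI)
  then show ?thesis by (simp add: negligible_iff_null_sets K_def \<pi>_def)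
qed

text \<open>Near p a frontier point lies on the graph: openness of \<Omega> excludes h < 0 there,
  and at a point with h > 0 a whole neighbourhood misses \<Omega>. Negligibility is a local
  property.\<close>

lemma negligible_frontier_lipschitz:
  fixes \<Omega> :: "'a::euclidean_space set"
  assumes op: "open \<Omega>" and L: "lipschitz_boundary \<Omega>"
  shows "negligible (frontier \<Omega>)"
proof (rule locally_negligible_alt[THEN iffD2], rule ballI)
  fix p assume p: "p \<in> frontier \<Omega>"
  define P where "P r e L g \<longleftrightarrow> norm e = 1 \<and> L-lipschitz_on {y. y \<bullet> e = 0} g \<and>
    \<Omega> \<inter> ball p r = {x \<in> ball p r. g (x - (x \<bullet> e) *\<^sub>R e) < x \<bullet> e}" for r e L and g :: "'a \<Rightarrow> real"
  have "\<exists>r>0. \<exists>e L. \<exists>g. P r e L g"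
    unfolding P_def using bspec[OF L[unfolded lipschitz_boundary_def] p] .
  then obtain r e L g where r: "r > 0" and P: "P r e L g" by blast
  have e: "norm e = 1" and g: "L-lipschitz_on {y. y \<bullet> e = 0} g"
    and \<Omega>: "\<Omega> \<inter> ball p r = {x \<in> ball p r. g (x - (x \<bullet> e) *\<^sub>R e) < x \<bullet> e}"
    using P by (simp_all only: P_def)
  have ee: "e \<bullet> e = 1" using e by (simp add: norm_eq_1)
  define h where "h x = g (x - (x \<bullet> e) *\<^sub>R e) - x \<bullet> e" for x
  have "continuous_on UNIV (\<lambda>x. g (x - (x \<bullet> e) *\<^sub>R e))"
    by (rule continuous_on_compose2[OF lipschitz_on_continuous_on[OF g]])
       (auto simp: inner_diff ee intro!: continuous_intros)
  then have hc: "continuous_on UNIV h" unfolding h_def by (intro continuous_intros)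
  have "frontier \<Omega> \<inter> ball p r \<subseteq> {x. g (x - (x \<bullet> e) *\<^sub>R e) = x \<bullet> e} \<inter> ball p r"
  proof safe
    fix x assume x: "x \<in> frontier \<Omega>" "x \<in> ball p r"
    then have "x \<notin> \<Omega>" using op by (simp add: frontier_def interior_open)
    then have "\<not> h x < 0" using \<Omega> x(2) unfolding h_def by auto
    moreover have "\<not> h x > 0"
    proof
      assume hx: "h x > 0"
      have "open {y. h y > 0}" by (intro open_Collect_less continuous_intros hc)
      then have "open ({y. h y > 0} \<inter> ball p r)" by auto
      moreover have "({y. h y > 0} \<inter> ball p r) \<inter> \<Omega> = {}"
      proof -
        have "y \<in> \<Omega> \<inter> ball p r \<Longrightarrow> h y < 0" for y unfolding \<Omega> by (simp add: h_def)
        then show ?thesis by fastforce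
      qed
      ultimately have "({y. h y > 0} \<inter> ball p r) \<inter> closure \<Omega> = {}" by (simp add: open_Int_closure_eq_empty)
      then show False using hx x by (auto simp: frontier_def)
    qed
    ultimately show "g (x - (x \<bullet> e) *\<^sub>R e) = x \<bullet> e" by (simp add: h_def)
  qed
  then have "negligible (frontier \<Omega> \<inter> ball p r)"
    by (rule negligible_subset[OF negligible_lipschitz_graph_ball[OF e g]])
  then show "\<exists>U. openin (top_of_set (frontier \<Omega>)) U \<and> p \<in> U \<and> negligible U"
    using p r by (intro exI[of _ "frontier \<Omega> \<inter> ball p r"]) (auto intro: openin_open_Int)
qed

text \<open>The definition removes a possibly uncountable union of open sets; Lindelof's theorem
  extracts a countable one, so the exceptional null sets can be united.\<close>

lemma AE_zero_outside_ess_support: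
  fixes u :: "'a::euclidean_space \<Rightarrow> complex"
  shows "AE x in lborel. x \<notin> ess_support u \<longrightarrow> u x = 0"
proof -
  define \<F> where "\<F> = {U. open U \<and> (AE x in lborel. x \<in> U \<longrightarrow> u x = 0)}"
  have "\<And>U. U \<in> \<F> \<Longrightarrow> open U" by (simp add: \<F>_def)
  then obtain D where D: "D \<subseteq> \<F>" "countable D" "\<Union>D = \<Union>\<F>" by (rule Lindelof)
  have "AE x in lborel. \<forall>U\<in>D. x \<in> U \<longrightarrow> u x = 0"
    using D(1) by (subst AE_ball_countable[OF D(2)]) (auto simp: \<F>_def)
  then show ?thesis
  proof eventually_elim
    case (elim x)
    show ?case
    proof
      assume "x \<notin> ess_support u"
      then have "x \<in> \<Union>D" unfolding D(3) \<F>_def ess_support_def by blast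
      then show "u x = 0" using elim by blast
    qed
  qed
qed

lemma Hs_square_integrable:
  fixes u :: "'a::euclidean_space \<Rightarrow> complex"
  assumes "u \<in> Hs s"
  shows "square_integrable u"
  using assms L2_tendsto_square_integrable test_function_square_integrable unfolding Hs_def by blast

text \<open>The support condition controls u outside the closure of \<Omega>, and the frontier is a
  null set. This puts u into \<open>zero_outside \<Omega>\<close>, where the eigenfunctions are
  complete.\<close>

lemma Hs_tilde_zero_outside:
  fixes \<Omega> :: "'a::euclidean_space set"
  assumes \<Omega>: "bounded_lipschitz_domain \<Omega>" and u: "u \<in> Hs_tilde s \<Omega>"
  shows "AE x in lborel. x \<notin> \<Omega> \<longrightarrow> u x = 0"
proof -
  have op: "open \<Omega>" using \<Omega> by (simp add: bounded_lipschitz_domain_def)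
  have "negligible (frontier \<Omega>)"
    using \<Omega> by (intro negligible_frontier_lipschitz) (auto simp: bounded_lipschitz_domain_def)
  then have "frontier \<Omega> \<in> null_sets (completion lborel)" by (simp add: negligible_iff_null_sets)
  then have "frontier \<Omega> \<in> null_sets lborel" by (subst (asm) null_sets_completion_iff) auto
  then have "AE x in lborel. x \<notin> frontier \<Omega>" by (rule AE_not_in)
  then show ?thesis using AE_zero_outside_ess_support[of u]
  proof eventually_elim
    case (elim x)
    show ?case
    proof
      assume "x \<notin> \<Omega>"
      then have "x \<notin> closure \<Omega>" using elim(1) op by (auto simp: frontier_def interior_open)
      then show "u x = 0" using elim(2) u by (auto simp: Hs_tilde_def)
    qed
  qed
qed

section \<open>Finiteness of the Dirichlet form\<close>

lemma Hs_norm_sq_test_function_finite: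
  fixes f :: "'a::euclidean_space \<Rightarrow> complex"
  assumes f: "f \<in> test_functions UNIV" and s: "s \<le> 1"
  shows "Hs_norm_sq s f < \<infinity>"
proof -
  have C1: "f \<in> C1_functions" using f test_functions_C1 by blast
  have [measurable]: "f \<in> borel_measurable borel" using C1_integrable[OF C1] by auto
  have "Hs_norm_sq s f \<le> (\<integral>\<^sup>+\<xi>. ennreal ((cmod (fourier f \<xi>))\<^sup>2) + ennreal ((norm \<xi>)\<^sup>2 * (cmod (fourier f \<xi>))\<^sup>2) \<partial>lborel)"
    unfolding Hs_norm_sq_def
  proof (rule nn_integral_mono)
    fix \<xi> :: 'a
    have "(1 + (norm \<xi>)\<^sup>2) powr s \<le> (1 + (norm \<xi>)\<^sup>2) powr 1" using s by (intro powr_mono) auto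
    also have "\<dots> = 1 + (norm \<xi>)\<^sup>2" by (simp add: add_nonneg_nonneg)
    finally have "(1 + (norm \<xi>)\<^sup>2) powr s * (cmod (fourier f \<xi>))\<^sup>2 \<le> (1 + (norm \<xi>)\<^sup>2) * (cmod (fourier f \<xi>))\<^sup>2"
      by (rule mult_right_mono) simp
    then have "ennreal ((1 + (norm \<xi>)\<^sup>2) powr s * (cmod (fourier f \<xi>))\<^sup>2) \<le> ennreal ((cmod (fourier f \<xi>))\<^sup>2 + (norm \<xi>)\<^sup>2 * (cmod (fourier f \<xi>))\<^sup>2)"
      by (intro ennreal_leI) (simp add: algebra_simps)
    then show "ennreal ((1 + (norm \<xi>)\<^sup>2) powr s * (cmod (fourier f \<xi>))\<^sup>2) \<le> ennreal ((cmod (fourier f \<xi>))\<^sup>2) + ennreal ((norm \<xi>)\<^sup>2 * (cmod (fourier f \<xi>))\<^sup>2)"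
      by (simp add: ennreal_plus)
  qed
  also have "\<dots> = (\<integral>\<^sup>+\<xi>. ennreal ((cmod (fourier f \<xi>))\<^sup>2) \<partial>lborel) + (\<integral>\<^sup>+\<xi>. ennreal ((norm \<xi>)\<^sup>2 * (cmod (fourier f \<xi>))\<^sup>2) \<partial>lborel)"
    by (rule nn_integral_add) measurable
  also have "\<dots> \<le> ennreal ((norm (L2 f))\<^sup>2) + ennreal ((norm (L2 (gradient f)))\<^sup>2)"
    unfolding ennreal_norm_L2_square[OF C1_square_integrable[OF C1]]
    by (intro add_mono fourier_norm_le fourier_gradient_bound C1 C1_integrable)
  also have "\<dots> < \<infinity>" by simp
  finally show ?thesis .
qed

lemma cmod_add_square_le: "(cmod (a + b))\<^sup>2 \<le> 2 * (cmod a)\<^sup>2 + 2 * (cmod b)\<^sup>2"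
proof -
  have "(cmod (a + b))\<^sup>2 \<le> (cmod a + cmod b)\<^sup>2" by (intro power_mono norm_triangle_ineq) simp
  also have "\<dots> \<le> 2 * (cmod a)\<^sup>2 + 2 * (cmod b)\<^sup>2"
    using sum_squares_bound[of "cmod a" "cmod b"] by (simp add: power2_sum)
  finally show ?thesis .
qed

text \<open>Needed for strictness, where two integrals are subtracted. The Fourier transforms of the
  approximants tend to that of u in L2 without weight, so the weight is first restricted to a ball,
  where it is bounded; Fatou's lemma then lets the radius grow.\<close>

lemma Q_Dirichlet_finite:
  fixes u :: "'a::euclidean_space \<Rightarrow> complex"
  assumes s: "0 < s" "s < 1" and u: "u \<in> Hs s" "integrable lborel u"
  shows "Q_Dirichlet s u < \<infinity>"
proof -
  from u(1) obtain f where f: "\<And>k. f k \<in> test_functions UNIV"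
    and cau: "\<And>e. e > 0 \<Longrightarrow> \<exists>N. \<forall>i\<ge>N. \<forall>j\<ge>N. Hs_norm_sq s (\<lambda>x. f i x - f j x) < e"
    and lim: "L2_tendsto f u" unfolding Hs_def by blast
  have C1: "f k \<in> C1_functions" for k using f test_functions_C1 by blast
  have [measurable]: "f k \<in> borel_measurable borel" for k using C1_integrable[OF C1] by auto
  have [measurable]: "u \<in> borel_measurable borel" using u by auto
  obtain N where N: "\<And>i j. i \<ge> N \<Longrightarrow> j \<ge> N \<Longrightarrow> Hs_norm_sq s (\<lambda>x. f i x - f j x) < 1"
    using cau[of 1] by auto
  \<comment> \<open>Bounds the norms of f k for k \<ge> N through |a + b|^2 \<le> 2 |a|^2 + 2 |b|^2,
    as the squared norm of f k - f N is below 1.\<close>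
  define C where "C = 2 * Hs_norm_sq s (f N) + 2"
  have C: "C < \<infinity>" unfolding C_def using Hs_norm_sq_test_function_finite[OF f, of s N] s
    by (simp add: ennreal_mult_less_top)
  have bd: "Hs_norm_sq s (f k) \<le> C" if k: "k \<ge> N" for k
  proof -
    have "Hs_norm_sq s (f k) \<le> (\<integral>\<^sup>+\<xi>. 2 * ennreal ((1 + (norm \<xi>)\<^sup>2) powr s * (cmod (fourier (f N) \<xi>))\<^sup>2)
        + 2 * ennreal ((1 + (norm \<xi>)\<^sup>2) powr s * (cmod (fourier (\<lambda>x. f k x - f N x) \<xi>))\<^sup>2) \<partial>lborel)"
      unfolding Hs_norm_sq_def
    proof (rule nn_integral_mono)
      fix \<xi> :: 'a
      let ?p = "(1 + (norm \<xi>)\<^sup>2) powr s" and ?a = "(cmod (fourier (f N) \<xi>))\<^sup>2" and ?b = "(cmod (fourier (\<lambda>x. f k x - f N x) \<xi>))\<^sup>2"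
      have "(cmod (fourier (f k) \<xi>))\<^sup>2 \<le> 2 * ?a + 2 * ?b"
        using cmod_add_square_le[of "fourier (f N) \<xi>" "fourier (\<lambda>x. f k x - f N x) \<xi>"]
        by (simp add: fourier_diff C1_integrable C1)
      then have "?p * (cmod (fourier (f k) \<xi>))\<^sup>2 \<le> ?p * (2 * ?a + 2 * ?b)" by (rule mult_left_mono) simp
      also have "\<dots> = 2 * (?p * ?a) + 2 * (?p * ?b)" by (simp add: algebra_simps)
      finally have "ennreal (?p * (cmod (fourier (f k) \<xi>))\<^sup>2) \<le> ennreal (2 * (?p * ?a) + 2 * (?p * ?b))" by (rule ennreal_leI)
      also have "ennreal (2 * x + 2 * y) = 2 * ennreal x + 2 * ennreal y" if "x \<ge> 0" "y \<ge> 0" for x y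
        using that by (simp add: ennreal_plus ennreal_mult)
      then have "ennreal (2 * (?p * ?a) + 2 * (?p * ?b)) = 2 * ennreal (?p * ?a) + 2 * ennreal (?p * ?b)" by simp
      finally show "ennreal (?p * (cmod (fourier (f k) \<xi>))\<^sup>2) \<le> 2 * ennreal (?p * ?a) + 2 * ennreal (?p * ?b)" .
    qed
    also have "\<dots> = 2 * Hs_norm_sq s (f N) + 2 * Hs_norm_sq s (\<lambda>x. f k x - f N x)"
      unfolding Hs_norm_sq_def by (subst nn_integral_add) (auto simp: nn_integral_cmult)
    also have "\<dots> \<le> C" unfolding C_def
      using mult_left_mono[OF less_imp_le[OF N[OF k order_refl]], of "2::ennreal"] by (intro add_left_mono) simp
    finally show ?thesis .
  qed
  have pm: "norm \<xi> powr (2 * s) \<le> (1 + (norm \<xi>)\<^sup>2) powr s" for \<xi> :: 'a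
  proof -
    have "norm \<xi> powr (2 * s) = ((norm \<xi>)\<^sup>2) powr s"
      by (cases "\<xi> = 0") (simp_all add: powr_powr[symmetric])
    also have "\<dots> \<le> (1 + (norm \<xi>)\<^sup>2) powr s" using s by (intro powr_mono2) auto
    finally show ?thesis .
  qed
  \<comment> \<open>For fixed R the unweighted error carries the factor 2 R^(2 s) and disappears as
    k grows; the remaining bound does not depend on R.\<close>
  have ball: "(\<integral>\<^sup>+\<xi>. indicator (ball 0 R) \<xi> * ennreal (norm \<xi> powr (2 * s) * (cmod (fourier u \<xi>))\<^sup>2) \<partial>lborel) \<le> 2 * C"
    if R: "R > 0" for R
  proof -
    have le: "(\<integral>\<^sup>+\<xi>. indicator (ball 0 R) \<xi> * ennreal (norm \<xi> powr (2 * s) * (cmod (fourier u \<xi>))\<^sup>2) \<partial>lborel)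
        \<le> 2 * C + ennreal (2 * R powr (2 * s)) * (\<integral>\<^sup>+x. ennreal ((cmod (f k x - u x))\<^sup>2) \<partial>lborel)" if k: "k \<ge> N" for k
    proof -
      have "(\<integral>\<^sup>+\<xi>. indicator (ball 0 R) \<xi> * ennreal (norm \<xi> powr (2 * s) * (cmod (fourier u \<xi>))\<^sup>2) \<partial>lborel)
        \<le> (\<integral>\<^sup>+\<xi>. 2 * ennreal ((1 + (norm \<xi>)\<^sup>2) powr s * (cmod (fourier (f k) \<xi>))\<^sup>2)
             + ennreal (2 * R powr (2 * s)) * ennreal ((cmod (fourier (\<lambda>x. f k x - u x) \<xi>))\<^sup>2) \<partial>lborel)"
      proof (rule nn_integral_mono)
        fix \<xi> :: 'a
        show "indicator (ball 0 R) \<xi> * ennreal (norm \<xi> powr (2 * s) * (cmod (fourier u \<xi>))\<^sup>2)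
          \<le> 2 * ennreal ((1 + (norm \<xi>)\<^sup>2) powr s * (cmod (fourier (f k) \<xi>))\<^sup>2)
             + ennreal (2 * R powr (2 * s)) * ennreal ((cmod (fourier (\<lambda>x. f k x - u x) \<xi>))\<^sup>2)"
        proof (cases "\<xi> \<in> ball 0 R")
          case True
          let ?a = "(cmod (fourier (f k) \<xi>))\<^sup>2" and ?b = "(cmod (fourier (\<lambda>x. f k x - u x) \<xi>))\<^sup>2"
          have "(cmod (fourier u \<xi>))\<^sup>2 \<le> 2 * ?a + 2 * ?b"
            using cmod_add_square_le[of "fourier (f k) \<xi>" "- fourier (\<lambda>x. f k x - u x) \<xi>"]
            by (simp add: fourier_diff C1_integrable C1 u norm_minus_commute)
          then have "norm \<xi> powr (2 * s) * (cmod (fourier u \<xi>))\<^sup>2 \<le> norm \<xi> powr (2 * s) * (2 * ?a + 2 * ?b)"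
            by (rule mult_left_mono) simp
          also have "\<dots> = norm \<xi> powr (2 * s) * (2 * ?a) + norm \<xi> powr (2 * s) * (2 * ?b)" by (simp add: algebra_simps)
          also have "\<dots> \<le> (1 + (norm \<xi>)\<^sup>2) powr s * (2 * ?a) + R powr (2 * s) * (2 * ?b)"
            using True s by (intro add_mono mult_right_mono pm powr_mono2) auto
          finally have "norm \<xi> powr (2 * s) * (cmod (fourier u \<xi>))\<^sup>2 \<le> 2 * ((1 + (norm \<xi>)\<^sup>2) powr s * ?a) + (2 * R powr (2 * s)) * ?b"
            by (simp add: algebra_simps)
          then have "ennreal (norm \<xi> powr (2 * s) * (cmod (fourier u \<xi>))\<^sup>2) \<le> ennreal (2 * ((1 + (norm \<xi>)\<^sup>2) powr s * ?a) + (2 * R powr (2 * s)) * ?b)"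
            by (rule ennreal_leI)
          also have "ennreal (2 * x + z * y) = 2 * ennreal x + ennreal z * ennreal y" if "x \<ge> 0" "y \<ge> 0" "z \<ge> 0" for x y z
            using that by (simp add: ennreal_plus ennreal_mult)
          then have "ennreal (2 * ((1 + (norm \<xi>)\<^sup>2) powr s * ?a) + (2 * R powr (2 * s)) * ?b)
            = 2 * ennreal ((1 + (norm \<xi>)\<^sup>2) powr s * ?a) + ennreal (2 * R powr (2 * s)) * ennreal ?b" by simp
          finally show ?thesis using True by simp
        qed simp
      qed
      also have "\<dots> = 2 * Hs_norm_sq s (f k) + ennreal (2 * R powr (2 * s)) * (\<integral>\<^sup>+\<xi>. ennreal ((cmod (fourier (\<lambda>x. f k x - u x) \<xi>))\<^sup>2) \<partial>lborel)"
        unfolding Hs_norm_sq_def by (subst nn_integral_add) (auto simp: nn_integral_cmult)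
      also have "\<dots> \<le> 2 * C + ennreal (2 * R powr (2 * s)) * (\<integral>\<^sup>+x. ennreal ((cmod (f k x - u x))\<^sup>2) \<partial>lborel)"
        using bd[OF k] C1_integrable[OF C1] u by (intro add_mono mult_left_mono fourier_norm_le) auto
      finally show ?thesis .
    qed
    have "(\<lambda>k. ennreal (2 * R powr (2 * s)) * (\<integral>\<^sup>+x. ennreal ((cmod (f k x - u x))\<^sup>2) \<partial>lborel)) \<longlonglongrightarrow> ennreal (2 * R powr (2 * s)) * 0"
      using lim unfolding L2_tendsto_def by (intro ennreal_tendsto_cmult) auto
    then have "(\<lambda>k. 2 * C + ennreal (2 * R powr (2 * s)) * (\<integral>\<^sup>+x. ennreal ((cmod (f k x - u x))\<^sup>2) \<partial>lborel)) \<longlonglongrightarrow> 2 * C + ennreal (2 * R powr (2 * s)) * 0"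
      by (rule tendsto_add[OF tendsto_const])
    from LIMSEQ_le_const[OF this] le show ?thesis by auto
  qed
  have [measurable]: "ball (0::'a) R \<in> sets borel" for R by simp
  have "Q_Dirichlet s u = (\<integral>\<^sup>+\<xi>. liminf (\<lambda>n. indicator (ball 0 (real (Suc n))) \<xi> * ennreal (norm \<xi> powr (2 * s) * (cmod (fourier u \<xi>))\<^sup>2)) \<partial>lborel)"
    unfolding Q_Dirichlet_def
  proof (rule nn_integral_cong, rule lim_imp_Liminf[symmetric])
    fix \<xi> :: 'a
    obtain n0 where n0: "norm \<xi> < real n0" using reals_Archimedean2 by blast
    have "\<forall>\<^sub>F n in sequentially. indicator (ball 0 (real (Suc n))) \<xi> * ennreal (norm \<xi> powr (2 * s) * (cmod (fourier u \<xi>))\<^sup>2)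
         = ennreal (norm \<xi> powr (2 * s) * (cmod (fourier u \<xi>))\<^sup>2)"
      by (rule eventually_mono[OF eventually_ge_at_top[of n0]]) (use n0 in auto)
    then show "(\<lambda>n. indicator (ball 0 (real (Suc n))) \<xi> * ennreal (norm \<xi> powr (2 * s) * (cmod (fourier u \<xi>))\<^sup>2))
       \<longlonglongrightarrow> ennreal (norm \<xi> powr (2 * s) * (cmod (fourier u \<xi>))\<^sup>2)" by (rule tendsto_eventually)
  qed simp
  also have "\<dots> \<le> liminf (\<lambda>n. \<integral>\<^sup>+\<xi>. indicator (ball 0 (real (Suc n))) \<xi> * ennreal (norm \<xi> powr (2 * s) * (cmod (fourier u \<xi>))\<^sup>2) \<partial>lborel)"
    by (rule nn_integral_liminf) measurable
  also have "\<dots> \<le> 2 * C"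
    by (rule order_trans[OF Liminf_le_Limsup Limsup_bounded]) (auto intro!: always_eventually ball)
  also have "\<dots> < \<infinity>" using C by (simp add: ennreal_mult_less_top)
  finally show ?thesis .
qed

section \<open>Both forms as integrals over the resolvent parameter\<close>

definition resolvent_weight :: "real \<Rightarrow> real \<Rightarrow> ennreal" where
  "resolvent_weight s t = indicator {0<..} t * ennreal (t powr (s - 2))"

text \<open>For 0 < s < 1 the value is pi / sin (pi s); what matters is that it is neither 0 nor
  infinite and can be cancelled.\<close>

definition resolvent_const :: "real \<Rightarrow> ennreal" where
  "resolvent_const s = (\<integral>\<^sup>+t. resolvent_weight s t * ennreal (t / (t + 1)) \<partial>lborel)"

lemma measurable_resolvent_weight [measurable]: "resolvent_weight s \<in> borel_measurable borel"
  unfolding resolvent_weight_def[abs_def] by measurable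

lemma resolvent_weight_pos: "t > 0 \<Longrightarrow> resolvent_weight s t \<noteq> 0" "resolvent_weight s t \<noteq> \<infinity>"
  by (auto simp: resolvent_weight_def indicator_def)

lemma resolvent_const_pos: "resolvent_const s \<noteq> 0"
proof
  assume "resolvent_const s = 0"
  then have "AE t in lborel. resolvent_weight s t * ennreal (t / (t + 1)) = 0"
    unfolding resolvent_const_def by (subst (asm) nn_integral_0_iff_AE) auto
  then have "AE t in lborel. t \<notin> {0<..<1::real}"
    by eventually_elim (auto simp: resolvent_weight_pos(1) ennreal_eq_0_iff divide_le_0_iff)
  then have "emeasure lborel {0<..<1::real} = 0" by (subst (asm) AE_iff_measurable[OF _ refl]) (auto simp: greaterThanLessThan_def greaterThan_def lessThan_def Int_def)
  then show False by simp
qed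

text \<open>The integrand is of order t^(s-1) at 0 and t^(s-2) at infinity: s > 0 gives convergence
  at 0, s < 1 at infinity.\<close>

lemma resolvent_const_finite:
  assumes s: "0 < s" "s < 1"
  shows "resolvent_const s < \<infinity>"
proof -
  have i1: "(\<integral>\<^sup>+t. ennreal (indicator {0..1} t * t powr (s - 1)) \<partial>lborel) = ennreal (1 powr (s - 1 + 1) / (s - 1 + 1))"
    by (rule nn_integral_has_integral_lebesgue[OF _ has_integral_powr_from_0]) (use s in auto)
  have i2: "(\<integral>\<^sup>+t. ennreal (indicator {1..} t * t powr (s - 2)) \<partial>lborel) = ennreal (- (1 powr (s - 2 + 1)) / (s - 2 + 1))"
    by (rule nn_integral_has_integral_lebesgue[OF _ has_integral_powr_to_inf]) (use s in auto)
  have "resolvent_const s \<le> (\<integral>\<^sup>+t. ennreal (indicator {0..1} t * t powr (s - 1)) + ennreal (indicator {1..} t * t powr (s - 2)) \<partial>lborel)"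
    unfolding resolvent_const_def
  proof (rule nn_integral_mono)
    fix t :: real
    show "resolvent_weight s t * ennreal (t / (t + 1)) \<le> ennreal (indicator {0..1} t * t powr (s - 1)) + ennreal (indicator {1..} t * t powr (s - 2))"
    proof (cases "t > 0")
      case True
      then have eq: "resolvent_weight s t * ennreal (t / (t + 1)) = ennreal (t powr (s - 2) * (t / (t + 1)))"
        by (simp add: resolvent_weight_def ennreal_mult[symmetric])
      show ?thesis
      proof (cases "t \<le> 1")
        case True
        have "t powr (s - 2) * (t / (t + 1)) \<le> t powr (s - 2) * t"
          using \<open>t > 0\<close> by (intro mult_left_mono) (auto simp: field_simps)
        also have "\<dots> = t powr (s - 2) * t powr 1" using \<open>t > 0\<close> by simp
        also have "\<dots> = t powr (s - 1)" by (simp only: powr_add[symmetric]) simp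
        finally have "ennreal (t powr (s - 2) * (t / (t + 1))) \<le> ennreal (indicator {0..1} t * t powr (s - 1))"
          using True \<open>t > 0\<close> by (intro ennreal_leI) simp
        then show ?thesis unfolding eq by (rule order_trans) simp
      next
        case False
        have "t powr (s - 2) * (t / (t + 1)) \<le> t powr (s - 2) * 1"
          using \<open>t > 0\<close> by (intro mult_left_mono) (auto simp: field_simps)
        then have "ennreal (t powr (s - 2) * (t / (t + 1))) \<le> ennreal (indicator {1..} t * t powr (s - 2))"
          using False by (intro ennreal_leI) simp
        then show ?thesis unfolding eq by (rule order_trans) simp
      qed
    qed (simp add: resolvent_weight_def)
  qed
  also have "\<dots> = (\<integral>\<^sup>+t. ennreal (indicator {0..1} t * t powr (s - 1)) \<partial>lborel) + (\<integral>\<^sup>+t. ennreal (indicator {1..} t * t powr (s - 2)) \<partial>lborel)"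
    by (rule nn_integral_add) measurable
  also have "\<dots> < \<infinity>" unfolding i1 i2 by simp
  finally show ?thesis .
qed

text \<open>Scaling t by l extracts the power: l from the measure, l^(s-2) from the weight and l
  from the quotient. For l = 0 both sides vanish, as \<open>0 powr s = 0\<close>.\<close>

lemma powr_eq_resolvent_integral:
  assumes l: "l \<ge> 0"
  shows "(\<integral>\<^sup>+t. resolvent_weight s t * ennreal (t * l / (t + l)) \<partial>lborel) = resolvent_const s * ennreal (l powr s)"
proof (cases "l = 0")
  case False
  then have l: "l > 0" using l by simp
  have "(\<integral>\<^sup>+t. resolvent_weight s t * ennreal (t * l / (t + l)) \<partial>lborel)
     = ennreal \<bar>l\<bar> * (\<integral>\<^sup>+t. resolvent_weight s (0 + l * t) * ennreal ((0 + l * t) * l / ((0 + l * t) + l)) \<partial>lborel)"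
    by (rule nn_integral_real_affine) (use l in auto)
  also have "(\<integral>\<^sup>+t. resolvent_weight s (0 + l * t) * ennreal ((0 + l * t) * l / ((0 + l * t) + l)) \<partial>lborel)
     = (\<integral>\<^sup>+t. ennreal (l powr (s - 1)) * (resolvent_weight s t * ennreal (t / (t + 1))) \<partial>lborel)"
  proof (rule nn_integral_cong)
    fix t :: real
    show "resolvent_weight s (0 + l * t) * ennreal ((0 + l * t) * l / ((0 + l * t) + l))
      = ennreal (l powr (s - 1)) * (resolvent_weight s t * ennreal (t / (t + 1)))"
    proof (cases "t > 0")
      case True
      have "l powr (s - 2) * l = l powr (s - 2) * l powr 1" using l by simp
      also have "\<dots> = l powr (s - 1)" by (simp only: powr_add[symmetric]) simp
      finally have p: "l powr (s - 2) * l = l powr (s - 1)" .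
      have q: "l * t * l / (l * t + l) = l * (t / (t + 1))"
      proof -
        have "l * t + l = l * (t + 1)" by (simp add: algebra_simps)
        then show ?thesis using l True by simp
      qed
      have "(l * t) powr (s - 2) * (l * t * l / (l * t + l)) = l powr (s - 1) * (t powr (s - 2) * (t / (t + 1)))"
        unfolding q p[symmetric] using l True by (simp add: powr_mult)
      then show ?thesis using l True by (simp add: resolvent_weight_def ennreal_mult[symmetric])
    qed (use l in \<open>simp add: resolvent_weight_def zero_less_mult_iff\<close>)
  qed
  also have "\<dots> = ennreal (l powr (s - 1)) * resolvent_const s"
    unfolding resolvent_const_def by (rule nn_integral_cmult) measurable
  also have "ennreal \<bar>l\<bar> * (ennreal (l powr (s - 1)) * resolvent_const s) = ennreal (l * l powr (s - 1)) * resolvent_const s"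
    using l by (simp add: ennreal_mult mult.assoc)
  also have "l * l powr (s - 1) = l powr s"
  proof -
    have "l * l powr (s - 1) = l powr 1 * l powr (s - 1)" using l by simp
    also have "\<dots> = l powr s" by (simp only: powr_add[symmetric]) simp
    finally show ?thesis .
  qed
  finally show ?thesis by (simp add: mult.commute)
qed simp

text \<open>The form of the Yosida approximation t A (t + A)^(-1) of A = - \<Delta> on the whole
  space; \<open>N_form\<close> is its counterpart for the Dirichlet Laplacian.\<close>

definition D_form :: "('a::euclidean_space \<Rightarrow> complex) \<Rightarrow> real \<Rightarrow> ennreal" where
  "D_form u t = (\<integral>\<^sup>+\<xi>. ennreal (t * (norm \<xi>)\<^sup>2 / (t + (norm \<xi>)\<^sup>2)) * ennreal ((cmod (fourier u \<xi>))\<^sup>2) \<partial>lborel)"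

definition N_form :: "'a::euclidean_space set \<Rightarrow> (nat \<Rightarrow> real) \<Rightarrow> (nat \<Rightarrow> 'a \<Rightarrow> complex) \<Rightarrow> ('a \<Rightarrow> complex) \<Rightarrow> real \<Rightarrow> ennreal" where
  "N_form \<Omega> lam \<phi> u t = (\<Sum>j. ennreal (t * lam j / (t + lam j)) * ennreal ((cmod (L2_inner \<Omega> u (\<phi> j)))\<^sup>2))"

lemma measurable_D_form [measurable]:
  fixes u :: "'a::euclidean_space \<Rightarrow> complex"
  assumes [measurable]: "u \<in> borel_measurable borel"
  shows "D_form u \<in> borel_measurable borel"
  unfolding D_form_def[abs_def] by measurable

lemma measurable_N_form [measurable]: "N_form \<Omega> lam \<phi> u \<in> borel_measurable borel"
  unfolding N_form_def[abs_def] by measurable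

text \<open>Tonelli's theorem, with \<open>powr_eq_resolvent_integral\<close> at l =
  |\<xi>|^2.\<close>

lemma Q_Dirichlet_eq_resolvent_integral:
  fixes u :: "'a::euclidean_space \<Rightarrow> complex"
  assumes [measurable]: "u \<in> borel_measurable borel"
  shows "resolvent_const s * Q_Dirichlet s u = (\<integral>\<^sup>+t. resolvent_weight s t * D_form u t \<partial>lborel)"
proof -
  have "resolvent_const s * Q_Dirichlet s u = (\<integral>\<^sup>+\<xi>. resolvent_const s * ennreal (norm \<xi> powr (2 * s) * (cmod (fourier u \<xi>))\<^sup>2) \<partial>lborel)"
    unfolding Q_Dirichlet_def by (rule nn_integral_cmult[symmetric]) measurable
  also have "\<dots> = (\<integral>\<^sup>+\<xi>. \<integral>\<^sup>+t. resolvent_weight s t * (ennreal (t * (norm \<xi>)\<^sup>2 / (t + (norm \<xi>)\<^sup>2)) * ennreal ((cmod (fourier u \<xi>))\<^sup>2)) \<partial>lborel \<partial>lborel)"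
  proof (rule nn_integral_cong)
    fix \<xi> :: 'a
    have "norm \<xi> powr (2 * s) = ((norm \<xi>)\<^sup>2) powr s"
      by (cases "\<xi> = 0") (simp_all add: powr_powr[symmetric])
    then have "resolvent_const s * ennreal (norm \<xi> powr (2 * s) * (cmod (fourier u \<xi>))\<^sup>2)
      = (resolvent_const s * ennreal (((norm \<xi>)\<^sup>2) powr s)) * ennreal ((cmod (fourier u \<xi>))\<^sup>2)"
      by (simp add: ennreal_mult mult.assoc)
    also have "\<dots> = (\<integral>\<^sup>+t. resolvent_weight s t * ennreal (t * (norm \<xi>)\<^sup>2 / (t + (norm \<xi>)\<^sup>2)) \<partial>lborel) * ennreal ((cmod (fourier u \<xi>))\<^sup>2)"
      by (simp only: powr_eq_resolvent_integral zero_le_power2)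
    also have "\<dots> = (\<integral>\<^sup>+t. resolvent_weight s t * ennreal (t * (norm \<xi>)\<^sup>2 / (t + (norm \<xi>)\<^sup>2)) * ennreal ((cmod (fourier u \<xi>))\<^sup>2) \<partial>lborel)"
      by (rule nn_integral_multc[symmetric]) measurable
    finally show "resolvent_const s * ennreal (norm \<xi> powr (2 * s) * (cmod (fourier u \<xi>))\<^sup>2)
      = (\<integral>\<^sup>+t. resolvent_weight s t * (ennreal (t * (norm \<xi>)\<^sup>2 / (t + (norm \<xi>)\<^sup>2)) * ennreal ((cmod (fourier u \<xi>))\<^sup>2)) \<partial>lborel)"
      by (simp only: mult.assoc)
  qed
  also have "\<dots> = (\<integral>\<^sup>+t. \<integral>\<^sup>+\<xi>. resolvent_weight s t * (ennreal (t * (norm \<xi>)\<^sup>2 / (t + (norm \<xi>)\<^sup>2)) * ennreal ((cmod (fourier u \<xi>))\<^sup>2)) \<partial>lborel \<partial>lborel)"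
    by (rule lborel_pair.Fubini'[symmetric]) measurable
  also have "\<dots> = (\<integral>\<^sup>+t. resolvent_weight s t * D_form u t \<partial>lborel)"
    unfolding D_form_def by (intro nn_integral_cong nn_integral_cmult) measurable
  finally show ?thesis .
qed

lemma Q_Navier_eq_resolvent_integral:
  assumes lam: "\<And>j. lam j \<ge> 0"
  shows "resolvent_const s * Q_Navier \<Omega> lam \<phi> s u = (\<integral>\<^sup>+t. resolvent_weight s t * N_form \<Omega> lam \<phi> u t \<partial>lborel)"
proof -
  let ?c = "\<lambda>j. ennreal ((cmod (L2_inner \<Omega> u (\<phi> j)))\<^sup>2)"
  have "resolvent_const s * Q_Navier \<Omega> lam \<phi> s u = (\<Sum>j. (resolvent_const s * ennreal (lam j powr s)) * ?c j)"
  proof -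
    have "resolvent_const s * ennreal (lam j powr s * (cmod (L2_inner \<Omega> u (\<phi> j)))\<^sup>2)
      = (resolvent_const s * ennreal (lam j powr s)) * ?c j" for j
      by (simp add: ennreal_mult mult.assoc)
    then show ?thesis unfolding Q_Navier_def ennreal_suminf_cmult[symmetric] by (rule arg_cong[OF ext])
  qed
  also have "\<dots> = (\<Sum>j. (\<integral>\<^sup>+t. resolvent_weight s t * ennreal (t * lam j / (t + lam j)) \<partial>lborel) * ?c j)"
    by (simp only: powr_eq_resolvent_integral[OF lam])
  also have "\<dots> = (\<Sum>j. \<integral>\<^sup>+t. resolvent_weight s t * ennreal (t * lam j / (t + lam j)) * ?c j \<partial>lborel)"
    by (intro suminf_cong nn_integral_multc[symmetric]) measurable
  also have "\<dots> = (\<integral>\<^sup>+t. (\<Sum>j. resolvent_weight s t * ennreal (t * lam j / (t + lam j)) * ?c j) \<partial>lborel)"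
    by (rule nn_integral_suminf[symmetric]) measurable
  also have "\<dots> = (\<integral>\<^sup>+t. resolvent_weight s t * N_form \<Omega> lam \<phi> u t \<partial>lborel)"
    unfolding N_form_def by (intro nn_integral_cong) (simp only: ennreal_suminf_cmult[symmetric] mult.assoc)
  finally show ?thesis .
qed

section \<open>Comparison of the forms\<close>

lemma D_form_le_energy:
  fixes u f :: "'a::euclidean_space \<Rightarrow> complex"
  assumes "f \<in> C1_functions" "integrable lborel u" "square_integrable u" "t > 0"
  shows "D_form u t \<le> ennreal ((norm (L2 (gradient f)))\<^sup>2 + t * (norm (L2 u - L2 f))\<^sup>2)"
proof -
  have "D_form u t = (\<integral>\<^sup>+\<xi>. ennreal (t * (norm \<xi>)\<^sup>2 / (t + (norm \<xi>)\<^sup>2) * (cmod (fourier u \<xi>))\<^sup>2) \<partial>lborel)"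
    unfolding D_form_def using assms(4)
    by (intro nn_integral_cong ennreal_mult[symmetric] divide_nonneg_nonneg mult_nonneg_nonneg add_nonneg_nonneg) auto
  then show ?thesis using resolvent_form_le_energy[OF assms] by simp
qed

lemma sum_le_N_form:
  assumes lam: "\<And>j. lam j \<ge> 0" and t: "t > 0"
  shows "ennreal (\<Sum>j<m. t * lam j / (t + lam j) * (cmod (L2_inner \<Omega> u (\<phi> j)))\<^sup>2) \<le> N_form \<Omega> lam \<phi> u t"
proof -
  have c: "t * lam j / (t + lam j) \<ge> 0" for j using lam[of j] t by (intro divide_nonneg_nonneg mult_nonneg_nonneg) auto
  have "ennreal (\<Sum>j<m. t * lam j / (t + lam j) * (cmod (L2_inner \<Omega> u (\<phi> j)))\<^sup>2)
      = (\<Sum>j<m. ennreal (t * lam j / (t + lam j) * (cmod (L2_inner \<Omega> u (\<phi> j)))\<^sup>2))"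
    by (rule sum_ennreal[symmetric]) (rule mult_nonneg_nonneg[OF c], simp)
  also have "\<dots> = (\<Sum>j<m. ennreal (t * lam j / (t + lam j)) * ennreal ((cmod (L2_inner \<Omega> u (\<phi> j)))\<^sup>2))"
    by (intro sum.cong refl ennreal_mult c) simp
  also have "\<dots> \<le> N_form \<Omega> lam \<phi> u t" unfolding N_form_def by (rule sum_le_suminf) auto
  finally show ?thesis .
qed

text \<open>A test function in \<Omega> is also a competitor on the whole space, so its energy
  bounds D_t, and it can be chosen with energy at most N_t + d.\<close>

lemma D_form_le_N_form:
  fixes \<Omega> :: "'a::euclidean_space set"
  assumes \<Omega>: "bounded \<Omega>" "open \<Omega>" and es: "dirichlet_eigensystem \<Omega> lam \<phi>"
    and u: "square_integrable u" "AE x in lborel. x \<notin> \<Omega> \<longrightarrow> u x = 0" and t: "t > 0"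
  shows "D_form u t \<le> N_form \<Omega> lam \<phi> u t"
proof (rule ennreal_le_epsilon)
  fix d :: real assume d: "0 < d"
  have ui: "integrable lborel u" by (rule square_integrable_integrable[OF \<Omega>(1) u])
  let ?S = "\<lambda>m. \<Sum>j<m. t * lam j / (t + lam j) * (cmod (L2_inner \<Omega> u (\<phi> j)))\<^sup>2"
  obtain f m where f: "f \<in> test_functions \<Omega>" "(norm (L2 (gradient f)))\<^sup>2 + t * (norm (L2 u - L2 f))\<^sup>2 \<le> ?S m + d"
    using energy_approximation[OF \<Omega> es u t d] by blast
  have "D_form u t \<le> ennreal (?S m + d)"
    by (rule order_trans[OF D_form_le_energy[OF test_functions_C1[OF f(1)] ui u(1) t] ennreal_leI[OF f(2)]])
  also have "\<dots> = ennreal (?S m) + ennreal d"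
    using d t eigenvalue_nonneg[OF \<Omega> es] by (intro ennreal_plus sum_nonneg mult_nonneg_nonneg divide_nonneg_nonneg add_nonneg_nonneg) auto
  also have "\<dots> \<le> N_form \<Omega> lam \<phi> u t + ennreal d"
    by (intro add_right_mono sum_le_N_form eigenvalue_nonneg[OF \<Omega> es] t)
  finally show "D_form u t \<le> N_form \<Omega> lam \<phi> u t + ennreal d" .
qed

text \<open>Agreement of w with c exp (\<eta> \<bullet> x) is asked for where v is nonzero, so a
  cut-off exponential qualifies against any v vanishing outside \<Omega>. The factor
  \<open>1 *\<close> keeps the shape of \<open>integral_exp_pderiv_dir\<close> at z = 1.\<close>

lemma integral_inner_exp:
  fixes v w :: "'a::euclidean_space \<Rightarrow> complex"
  assumes int: "integrable lborel (\<lambda>x. exp (1 * of_real (\<eta> \<bullet> x)) * v x)"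
    and m: "v \<in> borel_measurable lborel" "w \<in> borel_measurable lborel"
    and w: "AE x in lborel. v x = 0 \<or> w x = c * exp (of_real (\<eta> \<bullet> x))"
  shows "(\<integral>x. v x \<bullet> w x \<partial>lborel) = Re (cnj c * (\<integral>x. exp (1 * of_real (\<eta> \<bullet> x)) * v x \<partial>lborel))"
proof -
  have e: "exp (complex_of_real r) = of_real (exp r)" for r by (simp add: exp_of_real)
  have [measurable]: "v \<in> borel_measurable lborel" "w \<in> borel_measurable lborel" by fact+
  have int': "integrable lborel (\<lambda>x. cnj c * (exp (1 * of_real (\<eta> \<bullet> x)) * v x))" using int by (intro integrable_mult_right)
  have "(\<integral>x. v x \<bullet> w x \<partial>lborel) = (\<integral>x. Re (cnj c * (exp (1 * of_real (\<eta> \<bullet> x)) * v x)) \<partial>lborel)"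
  proof (rule integral_cong_AE)
    show "AE x in lborel. v x \<bullet> w x = Re (cnj c * (exp (1 * of_real (\<eta> \<bullet> x)) * v x))"
      using w
    proof eventually_elim
      case (elim x)
      then show ?case by (auto simp: inner_complex_def e algebra_simps)
    qed
  qed measurable
  also have "\<dots> = Re (\<integral>x. cnj c * (exp (1 * of_real (\<eta> \<bullet> x)) * v x) \<partial>lborel)" by (rule integral_Re[OF int'])
  also have "(\<integral>x. cnj c * (exp (1 * of_real (\<eta> \<bullet> x)) * v x) \<partial>lborel) = cnj c * (\<integral>x. exp (1 * of_real (\<eta> \<bullet> x)) * v x \<partial>lborel)"
    by (rule integral_mult_right_zero)
  finally show ?thesis .
qed

lemma integrable_exp_mult:
  fixes u :: "'a::euclidean_space \<Rightarrow> complex"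
  assumes bd: "bounded \<Omega>" and u: "integrable lborel u" "AE x in lborel. x \<notin> \<Omega> \<longrightarrow> u x = 0"
  shows "integrable lborel (\<lambda>x. exp (1 * of_real (\<eta> \<bullet> x)) * u x)"
proof -
  obtain R where R: "R > 0" "\<Omega> \<subseteq> ball 0 R" using bounded_subset_ball_radius[OF bd] by metis
  have [measurable]: "u \<in> borel_measurable borel" using u by auto
  have "integrable lborel (\<lambda>x. of_real (exp (norm \<eta> * R)) * u x)" using u by simp
  then show ?thesis
  proof (rule Bochner_Integration.integrable_bound)
    show "AE x in lborel. norm (exp (1 * of_real (\<eta> \<bullet> x)) * u x) \<le> norm (of_real (exp (norm \<eta> * R)) * u x)"
      using u(2)
    proof eventually_elim
      case (elim x)
      show ?case
      proof (cases "x \<in> \<Omega>")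
        case True
        have "\<eta> \<bullet> x \<le> norm \<eta> * norm x" by (rule norm_cauchy_schwarz)
        also have "\<dots> \<le> norm \<eta> * R" using True R by (intro mult_left_mono) auto
        finally show ?thesis by (auto simp: norm_mult intro!: mult_right_mono)
      qed (use elim in simp)
    qed
  qed measurable
qed

text \<open>If the two minima agree, the minimiser over \<open>H\<^sub>0\<^sup>1(\<Omega>)\<close> minimises over \<open>\<real>\<^sup>n\<close>, so it satisfies
  \<open>-\<Delta>w + t w = t u\<close> on all of \<open>\<real>\<^sup>n\<close>; testing with \<open>exp(\<eta> \<bullet> x)\<close>, which is annihilated by \<open>-\<Delta> + t\<close>,
  shows that \<open>u\<close> is orthogonal to it.\<close>

lemma exp_integral_zero_if_forms_agree:
  fixes \<Omega> :: "'a::euclidean_space set"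
  assumes \<Omega>: "bounded \<Omega>" "open \<Omega>" and es: "dirichlet_eigensystem \<Omega> lam \<phi>"
    and u: "square_integrable u" "AE x in lborel. x \<notin> \<Omega> \<longrightarrow> u x = 0" and t: "t > 0"
    and eq: "N_form \<Omega> lam \<phi> u t \<le> D_form u t" and \<eta>: "(norm \<eta>)\<^sup>2 = t"
  shows "(\<integral>x. exp (1 * of_real (\<eta> \<bullet> x)) * u x \<partial>lborel) = 0"
proof -
  have ui: "integrable lborel u" by (rule square_integrable_integrable[OF \<Omega>(1) u])
  have um: "u \<in> borel_measurable lborel" using ui by auto
  obtain \<psi> where \<psi>: "\<psi> \<in> C1_functions" "\<And>x. x \<in> \<Omega> \<Longrightarrow> \<psi> x = exp (of_real (\<eta> \<bullet> x))"
    "\<And>x b. x \<in> \<Omega> \<Longrightarrow> pderiv_dir b \<psi> x = of_real (\<eta> \<bullet> b) * exp (of_real (\<eta> \<bullet> x))"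
    using exists_C1_extension_of_exp[OF \<Omega>(1)] by metis
  let ?S = "\<lambda>m. \<Sum>j<m. t * lam j / (t + lam j) * (cmod (L2_inner \<Omega> u (\<phi> j)))\<^sup>2"
  let ?I = "\<integral>x. exp (1 * of_real (\<eta> \<bullet> x)) * u x \<partial>lborel"
  \<comment> \<open>The constant c serves to extract the real and the imaginary part at the end,
    with c = 1 and c = \<i>.\<close>
  have key: "Re (cnj c * ?I) = 0" for c
  proof -
    define g where "g x = c * \<psi> x" for x
    have g: "g \<in> C1_functions" unfolding g_def[abs_def] by (rule C1_cmult[OF \<psi>(1)])
    have pg: "pderiv_dir b g x = c * pderiv_dir b \<psi> x" for b x
      unfolding g_def[abs_def] by (rule pderiv_dir_cmult[OF C1_differentiable[OF \<psi>(1)]])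
    note gq = C1_square_integrable[OF g] C1_gradient_square_integrable[OF g]
    have gm: "g \<in> borel_measurable lborel" using C1_integrable[OF g] by auto
    have ug: "L2 u \<bullet> L2 g = Re (cnj c * ?I)"
      unfolding L2_inner_eq[OF u(1) gq(1)]
    proof (rule integral_inner_exp[OF integrable_exp_mult[OF \<Omega>(1) ui u(2)] um gm])
      show "AE x in lborel. u x = 0 \<or> g x = c * exp (of_real (\<eta> \<bullet> x))"
        using u(2) by eventually_elim (auto simp: g_def \<psi>(2))
    qed
    define A where "A = (norm (L2 (gradient g)))\<^sup>2 + t * (norm (L2 g))\<^sup>2"
    \<comment> \<open>The energy of f is at most ?S m + d. As the forms agree, the competitor f + r
      g on the whole space has energy at least ?S m, so passing to it gains no more than d.\<close>
    have quad: "0 \<le> d - 2 * r * t * (L2 u \<bullet> L2 g) + r\<^sup>2 * A" if d: "d > 0" for d r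
    proof -
      obtain f m where f: "f \<in> test_functions \<Omega>" "(norm (L2 (gradient f)))\<^sup>2 + t * (norm (L2 u - L2 f))\<^sup>2 \<le> ?S m + d"
        using energy_approximation[OF \<Omega> es u t d] by blast
      have fC: "f \<in> C1_functions" by (rule test_functions_C1[OF f(1)])
      have fm: "f \<in> borel_measurable lborel" using C1_integrable[OF fC] by auto
      have fi: "integrable lborel (\<lambda>x. exp (1 * of_real (\<eta> \<bullet> x)) * f x)"
        by (rule integrable_exp_mult[OF \<Omega>(1) C1_integrable[OF fC]]) (simp add: test_functions_eq_0[OF f(1)])
      let ?J = "\<integral>x. exp (1 * of_real (\<eta> \<bullet> x)) * f x \<partial>lborel"
      have fg: "L2 f \<bullet> L2 g = Re (cnj c * ?J)"
        unfolding L2_inner_eq[OF C1_square_integrable[OF fC] gq(1)]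
      proof (rule integral_inner_exp[OF fi fm gm])
        have "f x = 0 \<or> g x = c * exp (of_real (\<eta> \<bullet> x))" for x
          by (cases "x \<in> \<Omega>") (simp_all add: g_def \<psi>(2) test_functions_eq_0[OF f(1)])
        then show "AE x in lborel. f x = 0 \<or> g x = c * exp (of_real (\<eta> \<bullet> x))" by simp
      qed
      have "L2 (gradient f) \<bullet> L2 (gradient g) = (\<Sum>b\<in>Basis. \<integral>x. pderiv_dir b f x \<bullet> pderiv_dir b g x \<partial>lborel)"
        by (rule inner_L2_gradient[OF fC g])
      also have "\<dots> = (\<Sum>b\<in>Basis. - ((\<eta> \<bullet> b)\<^sup>2) * Re (cnj c * ?J))"
      proof (rule sum.cong[OF refl])
        fix b :: 'a assume b: "b \<in> Basis"
        have out: "pderiv_dir b f x = 0" if "x \<notin> \<Omega>" for x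
          using pderiv_dir_eq_0[of x f b] f(1) that by (auto simp: test_functions_def)
        have "(\<integral>x. pderiv_dir b f x \<bullet> pderiv_dir b g x \<partial>lborel)
          = Re (cnj (c * of_real (\<eta> \<bullet> b)) * (\<integral>x. exp (1 * of_real (\<eta> \<bullet> x)) * pderiv_dir b f x \<partial>lborel))"
        proof (rule integral_inner_exp)
          show "integrable lborel (\<lambda>x. exp (1 * of_real (\<eta> \<bullet> x)) * pderiv_dir b f x)"
            by (rule integrable_exp_mult[OF \<Omega>(1) C1_pderiv_integrable[OF fC b]]) (simp add: out)
          show "pderiv_dir b f \<in> borel_measurable lborel" "pderiv_dir b g \<in> borel_measurable lborel"
            using C1_pderiv_integrable[OF fC b] C1_pderiv_integrable[OF g b] by auto
          have "pderiv_dir b f x = 0 \<or> pderiv_dir b g x = c * of_real (\<eta> \<bullet> b) * exp (of_real (\<eta> \<bullet> x))" for x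
            by (cases "x \<in> \<Omega>") (simp_all add: pg \<psi>(3) out)
          then show "AE x in lborel. pderiv_dir b f x = 0 \<or> pderiv_dir b g x = c * of_real (\<eta> \<bullet> b) * exp (of_real (\<eta> \<bullet> x))" by simp
        qed
        also have "(\<integral>x. exp (1 * of_real (\<eta> \<bullet> x)) * pderiv_dir b f x \<partial>lborel) = - (1 * of_real (\<eta> \<bullet> b)) * ?J"
          by (rule integral_exp_pderiv_dir[OF fC b])
        also have "Re (cnj (c * of_real (\<eta> \<bullet> b)) * (- (1 * of_real (\<eta> \<bullet> b)) * ?J)) = - ((\<eta> \<bullet> b)\<^sup>2) * Re (cnj c * ?J)"
        proof -
          have "cnj (c * of_real (\<eta> \<bullet> b)) * (- (1 * of_real (\<eta> \<bullet> b)) * ?J) = of_real (- ((\<eta> \<bullet> b)\<^sup>2)) * (cnj c * ?J)"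
            by (simp add: power2_eq_square mult.assoc mult.left_commute)
          moreover have "Re (of_real r * w) = r * Re w" for r w by simp
          ultimately show ?thesis by (simp only:)
        qed
        finally show "(\<integral>x. pderiv_dir b f x \<bullet> pderiv_dir b g x \<partial>lborel) = - ((\<eta> \<bullet> b)\<^sup>2) * Re (cnj c * ?J)" .
      qed
      also have "\<dots> = - t * Re (cnj c * ?J)"
      proof -
        have "(\<Sum>b\<in>Basis. (\<eta> \<bullet> b)\<^sup>2) = t"
          unfolding \<eta>[symmetric] power2_norm_eq_inner euclidean_inner[of \<eta> \<eta>] by (simp only: power2_eq_square)
        then show ?thesis by (simp add: sum_distrib_right[symmetric] sum_negf)
      qed
      \<comment> \<open>The weak form of \<Delta> exp (\<eta> \<bullet> x) = t exp (\<eta> \<bullet>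
        x), tested with f; since f vanishes outside \<Omega>, the cut-off is not felt.\<close>
      finally have parts: "L2 (gradient f) \<bullet> L2 (gradient g) = - t * (L2 f \<bullet> L2 g)" by (simp add: fg)
      define h where "h x = f x + of_real r * g x" for x
      have rg: "(\<lambda>x. of_real r * g x) \<in> C1_functions" by (rule C1_cmult[OF g])
      have h: "h \<in> C1_functions" unfolding h_def[abs_def] by (rule C1_add[OF fC rg])
      have "graph h = graph f + r *\<^sub>R graph g"
        unfolding h_def[abs_def] graph_add[OF fC rg] graph_scaleR[OF g] ..
      then have L2h: "L2 h = L2 f + r *\<^sub>R L2 g" "L2 (gradient h) = L2 (gradient f) + r *\<^sub>R L2 (gradient g)"
        by (simp_all add: graph_def)
      have e1: "L2 u - L2 h = (L2 u - L2 f) + (- r) *\<^sub>R L2 g" unfolding L2h by (simp add: algebra_simps)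
      have "ennreal (?S m) \<le> N_form \<Omega> lam \<phi> u t" by (rule sum_le_N_form[OF eigenvalue_nonneg[OF \<Omega> es] t])
      also have "\<dots> \<le> D_form u t" by (rule eq)
      also have "\<dots> \<le> ennreal ((norm (L2 (gradient h)))\<^sup>2 + t * (norm (L2 u - L2 h))\<^sup>2)"
        by (rule D_form_le_energy[OF h ui u(1) t])
      finally have "?S m \<le> (norm (L2 (gradient h)))\<^sup>2 + t * (norm (L2 u - L2 h))\<^sup>2"
        using t by (subst (asm) ennreal_le_iff) (auto intro: add_nonneg_nonneg)
      \<comment> \<open>The terms linear in r are 2 r times (grad f, grad g) + t (f, g) - t (u, g);
        by \<open>parts\<close> the first two cancel.\<close>
      also have "\<dots> = ((norm (L2 (gradient f)))\<^sup>2 + t * (norm (L2 u - L2 f))\<^sup>2) - 2 * r * t * (L2 u \<bullet> L2 g) + r\<^sup>2 * A"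
        unfolding e1 L2h(2) norm_add_scaleR_square A_def parts by (simp add: inner_diff algebra_simps)
      finally show ?thesis using f(2) by linarith
    qed
    have A: "A \<ge> 0" unfolding A_def using t by (intro add_nonneg_nonneg mult_nonneg_nonneg) auto
    define B where "B = t * (L2 u \<bullet> L2 g)"
    \<comment> \<open>d has tended to 0. Taking A + 1 for A keeps the leading coefficient positive,
      so that r = B / (A + 1) is admissible below.\<close>
    have q: "0 \<le> - 2 * r * B + r\<^sup>2 * (A + 1)" for r
    proof (rule field_le_epsilon)
      fix d :: real assume "d > 0"
      from quad[OF this, of r] have "0 \<le> d - 2 * r * B + r\<^sup>2 * A" by (simp add: B_def mult.assoc)
      also have "\<dots> \<le> - 2 * r * B + r\<^sup>2 * (A + 1) + d" by (simp add: algebra_simps)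
      finally show "0 \<le> - 2 * r * B + r\<^sup>2 * (A + 1) + d" .
    qed
    have A1: "A + 1 > 0" using A by linarith
    have "- 2 * (B / (A + 1)) * B + (B / (A + 1))\<^sup>2 * (A + 1) = - (B\<^sup>2 / (A + 1))"
    proof -
      have "(B / (A + 1))\<^sup>2 * (A + 1) = B\<^sup>2 / (A + 1)" using A1 by (simp add: power2_eq_square)
      then show ?thesis by (simp add: power2_eq_square)
    qed
    then have "B\<^sup>2 / (A + 1) \<le> 0" using q[of "B / (A + 1)"] by linarith
    then have "B\<^sup>2 \<le> 0" using A1 by (simp add: divide_le_0_iff)
    then have "B = 0" by simp
    then show ?thesis using t ug by (simp add: B_def)
  qed
  have "Re ?I = 0" using key[of 1] by simp
  moreover have "Im ?I = 0" using key[of \<i>] by simp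
  ultimately show ?thesis by (simp add: complex_eq_iff)
qed

text \<open>The algebra of real exponentials to which the Stone-Weierstrass theorem is applied:
  \<eta> = 0 gives the constants, and products add exponents.\<close>

inductive exp_sum :: "('a::euclidean_space \<Rightarrow> real) \<Rightarrow> bool" where
  single: "exp_sum (\<lambda>x. c * exp (\<eta> \<bullet> x))"
| add: "exp_sum f \<Longrightarrow> exp_sum g \<Longrightarrow> exp_sum (\<lambda>x. f x + g x)"

lemma exp_sum_const: "exp_sum (\<lambda>x. c)"
  using exp_sum.single[of c 0] by simp

lemma exp_sum_continuous: "exp_sum f \<Longrightarrow> continuous_on S f"
  by (induction rule: exp_sum.induct) (auto intro!: continuous_intros)

lemma exp_sum_mult: "exp_sum f \<Longrightarrow> exp_sum g \<Longrightarrow> exp_sum (\<lambda>x. f x * g x)"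
proof (induction f rule: exp_sum.induct)
  case (single c \<eta>)
  from single show ?case
  proof (induction g rule: exp_sum.induct)
    case (single d \<zeta>)
    have "(\<lambda>x. c * exp (\<eta> \<bullet> x) * (d * exp (\<zeta> \<bullet> x))) = (\<lambda>x. (c * d) * exp ((\<eta> + \<zeta>) \<bullet> x))"
      by (simp add: inner_add_left exp_add algebra_simps)
    then show ?case by (simp only: exp_sum.single)
  next
    case (add f g)
    then show ?case by (simp add: distrib_left exp_sum.add)
  qed
next
  case (add f1 f2)
  then show ?case by (simp add: distrib_right exp_sum.add)
qed

text \<open>Sums of real exponentials approximate each box bump uniformly on a ball containing
  \<Omega>, so orthogonality passes to box bumps and the fundamental lemma applies.\<close>

lemma AE_zero_if_orthogonal_to_exponentials:
  fixes u :: "'a::euclidean_space \<Rightarrow> complex"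
  assumes bd: "bounded \<Omega>" and u: "integrable lborel u" "AE x in lborel. x \<notin> \<Omega> \<longrightarrow> u x = 0"
    and orth: "\<And>\<eta>. (\<integral>x. exp (1 * of_real (\<eta> \<bullet> x)) * u x \<partial>lborel) = 0"
  shows "AE x in lborel. u x = 0"
proof (rule AE_zero_if_orthogonal_to_box_bumps[OF u(1) open_UNIV])
  obtain R where R: "R > 0" "\<Omega> \<subseteq> ball 0 R" using bounded_subset_ball_radius[OF bd] by metis
  have [measurable]: "u \<in> borel_measurable borel" using u by auto
  have bounded_mult: "integrable lborel (\<lambda>x. u x * of_real (f x))" if f: "continuous_on UNIV f" for f :: "'a \<Rightarrow> real"
  proof -
    have [measurable]: "f \<in> borel_measurable borel" by (rule borel_measurable_continuous_onI[OF f])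
    have "compact (f ` cball 0 R)"
      by (rule compact_continuous_image[OF continuous_on_subset[OF f subset_UNIV] compact_cball])
    from compact_imp_bounded[OF this] obtain B where B: "\<And>x. x \<in> cball 0 R \<Longrightarrow> \<bar>f x\<bar> \<le> B"
      unfolding bounded_real by blast
    have "integrable lborel (\<lambda>x. u x * of_real B)" using u by simp
    then show ?thesis
    proof (rule Bochner_Integration.integrable_bound)
      show "AE x in lborel. norm (u x * of_real (f x)) \<le> norm (u x * of_real B)"
        using u(2)
      proof eventually_elim
        case (elim x)
        show ?case
        proof (cases "x \<in> \<Omega>")
          case True
          then have "x \<in> cball 0 R" using R by auto
          from B[OF this] show ?thesis by (simp add: norm_mult mult_left_mono)
        qed (use elim in simp)
      qed
    qed measurable
  qed
  have es: "(\<integral>x. u x * of_real (f x) \<partial>lborel) = 0" if "exp_sum f" for f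
    using that
  proof (induction rule: exp_sum.induct)
    case (single c \<eta>)
    have "(\<integral>x. u x * of_real (c * exp (\<eta> \<bullet> x)) \<partial>lborel) = (\<integral>x. of_real c * (exp (1 * of_real (\<eta> \<bullet> x)) * u x) \<partial>lborel)"
      by (intro Bochner_Integration.integral_cong refl) (simp add: exp_of_real)
    also have "\<dots> = of_real c * (\<integral>x. exp (1 * of_real (\<eta> \<bullet> x)) * u x \<partial>lborel)" by (rule integral_mult_right_zero)
    also have "\<dots> = 0" unfolding orth by simp
    finally show ?case .
  next
    case (add f g)
    have "(\<integral>x. u x * of_real (f x + g x) \<partial>lborel) = (\<integral>x. u x * of_real (f x) + u x * of_real (g x) \<partial>lborel)"
      by (simp add: distrib_left)
    also have "\<dots> = (\<integral>x. u x * of_real (f x) \<partial>lborel) + (\<integral>x. u x * of_real (g x) \<partial>lborel)"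
      using add exp_sum_continuous by (intro Bochner_Integration.integral_add bounded_mult) auto
    finally show ?case using add by simp
  qed
  fix m and a b :: 'a
  let ?\<beta> = "box_bump m a b"
  define N where "N = (\<integral>x. cmod (u x) \<partial>lborel)"
  have N0: "N \<ge> 0" by (simp add: N_def)
  have "cmod (\<integral>x. u x * of_real (?\<beta> x) \<partial>lborel) \<le> 0"
  proof (rule field_le_epsilon)
    fix e :: real assume e: "e > 0"
    \<comment> \<open>A uniform error e / (N + 1) changes the integral by at most e N / (N + 1),
      where N is the L1 norm of u.\<close>
    have e': "e / (N + 1) > 0" using e N0 by simp
    have "\<exists>g. exp_sum g \<and> (\<forall>x\<in>cball 0 R. \<bar>?\<beta> x - g x\<bar> < e / (N + 1))"
    proof (rule Stone_Weierstrass_HOL[where P=exp_sum, OF compact_cball])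
      show "\<exists>f. exp_sum f \<and> f x \<noteq> f y" if "x \<in> cball 0 R \<and> y \<in> cball 0 R \<and> x \<noteq> y" for x y :: 'a
      proof -
        \<comment> \<open>The exponential in the direction x - y separates x from y.\<close>
        have "(x - y) \<bullet> x \<noteq> (x - y) \<bullet> y"
        proof
          assume "(x - y) \<bullet> x = (x - y) \<bullet> y"
          then have "(x - y) \<bullet> (x - y) = 0" by (simp add: inner_diff_right)
          then show False using that by simp
        qed
        then have "1 * exp ((x - y) \<bullet> x) \<noteq> 1 * exp ((x - y) \<bullet> y)" by simp
        then show ?thesis using exp_sum.single[of 1 "x - y"] by blast
      qed
      show "continuous_on (cball 0 R) ?\<beta>" using continuous_box_bump continuous_on_subset by blast
    qed (use e' in \<open>auto intro: exp_sum_const exp_sum_continuous exp_sum.add exp_sum_mult\<close>)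
    then obtain g where g: "exp_sum g" "\<And>x. x \<in> cball 0 R \<Longrightarrow> \<bar>?\<beta> x - g x\<bar> < e / (N + 1)" by blast
    have gc: "continuous_on UNIV g" by (rule exp_sum_continuous[OF g(1)])
    note i = bounded_mult[OF continuous_box_bump[of m a b]] bounded_mult[OF gc]
    have "(\<integral>x. u x * of_real (?\<beta> x) \<partial>lborel) = (\<integral>x. u x * of_real (?\<beta> x) \<partial>lborel) - (\<integral>x. u x * of_real (g x) \<partial>lborel)"
      using es[OF g(1)] by simp
    also have "\<dots> = (\<integral>x. u x * of_real (?\<beta> x) - u x * of_real (g x) \<partial>lborel)"
      by (rule Bochner_Integration.integral_diff[symmetric, OF i])
    finally have "cmod (\<integral>x. u x * of_real (?\<beta> x) \<partial>lborel) \<le> (\<integral>x. cmod (u x * of_real (?\<beta> x) - u x * of_real (g x)) \<partial>lborel)"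
      using integral_norm_bound[of lborel "\<lambda>x. u x * of_real (?\<beta> x) - u x * of_real (g x)"] by simp
    also have "\<dots> \<le> (\<integral>x. e / (N + 1) * cmod (u x) \<partial>lborel)"
    proof (rule integral_mono_AE)
      show "AE x in lborel. cmod (u x * of_real (?\<beta> x) - u x * of_real (g x)) \<le> e / (N + 1) * cmod (u x)"
        using u(2)
      proof eventually_elim
        case (elim x)
        show ?case
        proof (cases "x \<in> \<Omega>")
          case True
          then have x: "x \<in> cball 0 R" using R by auto
          have "u x * of_real (?\<beta> x) - u x * of_real (g x) = of_real (?\<beta> x - g x) * u x" by (simp add: algebra_simps)
          then have "cmod (u x * of_real (?\<beta> x) - u x * of_real (g x)) = \<bar>?\<beta> x - g x\<bar> * cmod (u x)"
            by (simp only: norm_mult norm_of_real)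
          also have "\<dots> \<le> e / (N + 1) * cmod (u x)" using g(2)[OF x] by (intro mult_right_mono) auto
          finally show ?thesis .
        qed (use elim in simp)
      qed
      show "integrable lborel (\<lambda>x. cmod (u x * of_real (?\<beta> x) - u x * of_real (g x)))"
        by (intro integrable_norm Bochner_Integration.integrable_diff i)
      show "integrable lborel (\<lambda>x. e / (N + 1) * cmod (u x))" using u by simp
    qed
    also have "\<dots> = e / (N + 1) * N" by (simp add: N_def)
    also have "\<dots> \<le> e" using e N0 by (simp add: pos_divide_le_eq mult_left_mono)
    finally show "cmod (\<integral>x. u x * of_real (?\<beta> x) \<partial>lborel) \<le> 0 + e" by simp
  qed
  then show "(\<integral>x. u x * of_real (?\<beta> x) \<partial>lborel) = 0" by simp
qed simp

text \<open>No interval consists of exceptional t, so |\<eta>|^2 is a limit of good values, and the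
  integral depends continuously on \<eta> because \<Omega> is bounded. This also reaches \<eta> =
  0.\<close>

lemma exp_integral_zero_by_density:
  fixes u :: "'a::euclidean_space \<Rightarrow> complex"
  assumes bd: "bounded \<Omega>" and u: "integrable lborel u" "AE x in lborel. x \<notin> \<Omega> \<longrightarrow> u x = 0"
    and ae: "AE t in lborel. t > 0 \<longrightarrow> (\<forall>\<eta>. (norm \<eta>)\<^sup>2 = t \<longrightarrow> (\<integral>x. exp (1 * of_real (\<eta> \<bullet> x)) * u x \<partial>lborel) = 0)"
  shows "(\<integral>x. exp (1 * of_real (\<eta> \<bullet> x)) * u x \<partial>lborel) = 0"
proof -
  have [measurable]: "u \<in> borel_measurable borel" using u by auto
  obtain R where R: "R > 0" "\<Omega> \<subseteq> ball 0 R" using bounded_subset_ball_radius[OF bd] by metis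
  \<comment> \<open>The direction along which \<eta> is approached; for \<eta> = 0 any unit vector
    serves.\<close>
  obtain v where v: "norm v = 1" "\<eta> = norm \<eta> *\<^sub>R v"
  proof (cases "\<eta> = 0")
    case True
    obtain b :: 'a where "b \<in> Basis" using nonempty_Basis by blast
    then show ?thesis using that[of b] True by simp
  next
    case False
    then show ?thesis using that[of "(1 / norm \<eta>) *\<^sub>R \<eta>"] by simp
  qed
  have "\<exists>t. a < t \<and> t < b \<and> (\<forall>\<eta>. (norm \<eta>)\<^sup>2 = t \<longrightarrow> (\<integral>x. exp (1 * of_real (\<eta> \<bullet> x)) * u x \<partial>lborel) = 0)"
    if ab: "0 \<le> a" "a < b" for a b
  proof (rule ccontr)
    assume no: "\<nexists>t. a < t \<and> t < b \<and> (\<forall>\<eta>. (norm \<eta>)\<^sup>2 = t \<longrightarrow> (\<integral>x. exp (1 * of_real (\<eta> \<bullet> x)) * u x \<partial>lborel) = 0)"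
    have "AE t in lborel. t \<notin> {a<..<b}"
      using ae
    proof eventually_elim
      case (elim t)
      then show ?case using no ab by fastforce
    qed
    then have "emeasure lborel {a<..<b} = 0"
      by (subst (asm) AE_iff_measurable[OF _ refl]) (auto simp: greaterThanLessThan_def greaterThan_def lessThan_def Int_def)
    then show False using ab by simp
  qed
  then have "\<exists>t. (norm \<eta>)\<^sup>2 < t \<and> t < (norm \<eta>)\<^sup>2 + 1 / real (Suc n) \<and>
      (\<forall>\<eta>. (norm \<eta>)\<^sup>2 = t \<longrightarrow> (\<integral>x. exp (1 * of_real (\<eta> \<bullet> x)) * u x \<partial>lborel) = 0)" for n
    by simp
  then obtain t where t: "\<And>n. (norm \<eta>)\<^sup>2 < t n" "\<And>n. t n < (norm \<eta>)\<^sup>2 + 1 / real (Suc n)"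
    "\<And>n \<zeta>. (norm \<zeta>)\<^sup>2 = t n \<Longrightarrow> (\<integral>x. exp (1 * of_real (\<zeta> \<bullet> x)) * u x \<partial>lborel) = 0" by metis
  have t0: "t n \<ge> 0" for n using t(1)[of n] zero_le_power2[of "norm \<eta>"] by linarith
  have "(\<lambda>n. (norm \<eta>)\<^sup>2 + 1 / real (Suc n)) \<longlonglongrightarrow> (norm \<eta>)\<^sup>2 + 0"
    using LIMSEQ_inverse_real_of_nat by (intro tendsto_intros) (simp add: inverse_eq_divide)
  then have "t \<longlonglongrightarrow> (norm \<eta>)\<^sup>2"
    using t(1,2) by (intro tendsto_sandwich[OF _ _ tendsto_const, of _ t])
      (simp_all only: add_0_right less_imp_le always_eventually simp_thms)
  then have st: "(\<lambda>n. sqrt (t n)) \<longlonglongrightarrow> norm \<eta>" using tendsto_real_sqrt by fastforce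
  define \<zeta> where "\<zeta> n = sqrt (t n) *\<^sub>R v" for n
  have \<zeta>: "\<zeta> \<longlonglongrightarrow> \<eta>"
    unfolding \<zeta>_def using tendsto_scaleR[OF st tendsto_const[of v]] v(2) by simp
  obtain B where B: "\<And>n. norm (\<zeta> n) \<le> B"
    using convergent_imp_bounded[OF \<zeta>] by (auto simp: bounded_iff)
  have "(\<lambda>n. \<integral>x. exp (1 * of_real (\<zeta> n \<bullet> x)) * u x \<partial>lborel) \<longlonglongrightarrow> (\<integral>x. exp (1 * of_real (\<eta> \<bullet> x)) * u x \<partial>lborel)"
  proof (rule integral_dominated_convergence[where w="\<lambda>x. exp (B * R) * cmod (u x)"])
    show "integrable lborel (\<lambda>x. exp (B * R) * cmod (u x))" using u by simp
    show "AE x in lborel. (\<lambda>n. exp (1 * of_real (\<zeta> n \<bullet> x)) * u x) \<longlonglongrightarrow> exp (1 * of_real (\<eta> \<bullet> x)) * u x"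
      by (intro AE_I2 tendsto_intros \<zeta>)
    show "AE x in lborel. norm (exp (1 * of_real (\<zeta> n \<bullet> x)) * u x) \<le> exp (B * R) * cmod (u x)" for n
      using u(2)
    proof eventually_elim
      case (elim x)
      show ?case
      proof (cases "x \<in> \<Omega>")
        case True
        have "\<zeta> n \<bullet> x \<le> norm (\<zeta> n) * norm x" by (rule norm_cauchy_schwarz)
        also have "\<dots> \<le> B * R" using True R B[of n] by (intro mult_mono) (auto intro: order_trans[OF norm_ge_zero])
        finally show ?thesis by (auto simp: norm_mult intro!: mult_right_mono)
      qed (use elim in simp)
    qed
  qed measurable
  moreover have "(\<integral>x. exp (1 * of_real (\<zeta> n \<bullet> x)) * u x \<partial>lborel) = 0" for n
    by (rule t(3)) (use t0 v in \<open>simp add: \<zeta>_def\<close>)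
  ultimately show ?thesis by (simp add: LIMSEQ_const_iff)
qed

text \<open>Finiteness allows the integrals to be subtracted, and a nonnegative function with
  integral 0 vanishes almost everywhere.\<close>

lemma AE_eq_if_nn_integral_le:
  fixes f g :: "'b \<Rightarrow> ennreal"
  assumes [measurable]: "f \<in> borel_measurable M" "g \<in> borel_measurable M"
    and le: "AE x in M. f x \<le> g x" and int: "(\<integral>\<^sup>+x. g x \<partial>M) \<le> (\<integral>\<^sup>+x. f x \<partial>M)" "(\<integral>\<^sup>+x. f x \<partial>M) < \<infinity>"
  shows "AE x in M. g x \<le> f x"
proof -
  have "(\<integral>\<^sup>+x. g x - f x \<partial>M) = (\<integral>\<^sup>+x. g x \<partial>M) - (\<integral>\<^sup>+x. f x \<partial>M)"
    by (rule nn_integral_diff) (use le int in auto)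
  also have "\<dots> = 0" using int(1) le_less_trans[OF int] by (simp add: diff_eq_0_iff_ennreal)
  finally have "AE x in M. g x - f x = 0" by (subst (asm) nn_integral_0_iff_AE) auto
  moreover have "AE x in M. f x \<noteq> \<infinity>" by (rule nn_integral_PInf_AE) (use int in auto)
  ultimately show ?thesis
  proof eventually_elim
    case (elim x)
    then show ?case by (cases "g x \<le> f x") (auto simp: diff_eq_0_iff_ennreal)
  qed
qed

theorem theorem2:
  fixes \<Omega> :: "'a::euclidean_space set"
    and lam :: "nat \<Rightarrow> real"
    and \<phi> :: "nat \<Rightarrow> 'a \<Rightarrow> complex"
    and s :: real
    and u :: "'a \<Rightarrow> complex"
  assumes "0 < s" and "s < 1"
    and "bounded_lipschitz_domain \<Omega>"
    and "dirichlet_eigensystem \<Omega> lam \<phi>"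
    and "u \<in> Hs_tilde s \<Omega>"
  shows "Q_Navier \<Omega> lam \<phi> s u \<ge> Q_Dirichlet s u \<and>
         (\<not> (AE x in lborel. u x = 0) \<longrightarrow> Q_Navier \<Omega> lam \<phi> s u > Q_Dirichlet s u)"
proof -
  note s = assms(1,2) and es = assms(4)
  have \<Omega>: "bounded \<Omega>" "open \<Omega>" using assms(3) by (auto simp: bounded_lipschitz_domain_def)
  have uH: "u \<in> Hs s" using assms(5) by (simp add: Hs_tilde_def)
  have u: "square_integrable u" "AE x in lborel. x \<notin> \<Omega> \<longrightarrow> u x = 0"
    using Hs_square_integrable[OF uH] Hs_tilde_zero_outside[OF assms(3,5)] by auto
  have ui: "integrable lborel u" by (rule square_integrable_integrable[OF \<Omega>(1) u])
  have [measurable]: "u \<in> borel_measurable borel" using ui by auto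
  let ?C = "resolvent_const s" and ?w = "resolvent_weight s"
  have C: "?C \<noteq> 0" "?C \<noteq> top" using resolvent_const_pos[of s] resolvent_const_finite[OF s] by auto
  have QD: "?C * Q_Dirichlet s u = (\<integral>\<^sup>+t. ?w t * D_form u t \<partial>lborel)"
    by (rule Q_Dirichlet_eq_resolvent_integral) measurable
  have QN: "?C * Q_Navier \<Omega> lam \<phi> s u = (\<integral>\<^sup>+t. ?w t * N_form \<Omega> lam \<phi> u t \<partial>lborel)"
    by (rule Q_Navier_eq_resolvent_integral) (rule eigenvalue_nonneg[OF \<Omega> es])
  \<comment> \<open>For t \<le> 0 the weight vanishes, so the forms are compared at positive t
    alone.\<close>
  have le: "?w t * D_form u t \<le> ?w t * N_form \<Omega> lam \<phi> u t" for t
  proof (cases "t > 0")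
    case True
    then show ?thesis by (intro mult_left_mono D_form_le_N_form[OF \<Omega> es u]) auto
  qed (simp add: resolvent_weight_def)
  have "?C * Q_Dirichlet s u \<le> ?C * Q_Navier \<Omega> lam \<phi> s u"
    unfolding QD QN by (intro nn_integral_mono le)
  then have ge: "Q_Dirichlet s u \<le> Q_Navier \<Omega> lam \<phi> s u" using C by (simp add: ennreal_mult_le_mult_iff)
  \<comment> \<open>Strictness by contraposition: the reverse inequality forces the weighted forms
    to agree for almost every t.\<close>
  have "AE x in lborel. u x = 0" if eq: "Q_Navier \<Omega> lam \<phi> s u \<le> Q_Dirichlet s u"
  proof -
    have "AE t in lborel. ?w t * N_form \<Omega> lam \<phi> u t \<le> ?w t * D_form u t"
    proof (rule AE_eq_if_nn_integral_le)
      show "(\<integral>\<^sup>+t. ?w t * N_form \<Omega> lam \<phi> u t \<partial>lborel) \<le> (\<integral>\<^sup>+t. ?w t * D_form u t \<partial>lborel)"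
        unfolding QD[symmetric] QN[symmetric] by (intro mult_left_mono eq) simp
      show "(\<integral>\<^sup>+t. ?w t * D_form u t \<partial>lborel) < \<infinity>"
        unfolding QD[symmetric] using Q_Dirichlet_finite[OF s uH ui] resolvent_const_finite[OF s]
        by (simp add: ennreal_mult_less_top)
    qed (use le in auto)
    then have "AE t in lborel. t > 0 \<longrightarrow> (\<forall>\<eta>. (norm \<eta>)\<^sup>2 = t \<longrightarrow> (\<integral>x. exp (1 * of_real (\<eta> \<bullet> x)) * u x \<partial>lborel) = 0)"
    proof eventually_elim
      case (elim t)
      show ?case
      proof (intro impI allI)
        fix \<eta> :: 'a assume t: "t > 0" and \<eta>: "(norm \<eta>)\<^sup>2 = t"
        \<comment> \<open>At t > 0 the weight is positive and finite, so it can be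
          cancelled.\<close>
        have "N_form \<Omega> lam \<phi> u t \<le> D_form u t"
          using elim resolvent_weight_pos(1)[OF t, of s] resolvent_weight_pos(2)[of s t]
          by (simp add: ennreal_mult_le_mult_iff)
        then show "(\<integral>x. exp (1 * of_real (\<eta> \<bullet> x)) * u x \<partial>lborel) = 0"
          by (rule exp_integral_zero_if_forms_agree[OF \<Omega> es u t _ \<eta>])
      qed
    qed
    then show ?thesis
      by (intro AE_zero_if_orthogonal_to_exponentials[OF \<Omega>(1) ui u(2)] exp_integral_zero_by_density[OF \<Omega>(1) ui u(2)])
  qed
  then show ?thesis using ge not_le by blast
qed

end
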